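(* Let $(k,\lambda)$ be a pair for which $k \geq 4$, $\lambda \in \{24,28\}$, and $k \geq 352$ whenever $\lambda = 24$. Let $G$ be a simple graph on $n$ vertices, and let $(G,H,L)$ be a minimal triple. If $\ell(v) = |L(v)| = k-1$ for each $v \in V(G)$, then $|E(G)| > \left(k-1+\frac{1}{\lambda}\right)\frac n2$ or $G$ has a $K_k$-subgraph.
   Context: A (simple) graph has no loops or parallel edges; a multigraph possibly has parallel edges but no loops. $E_G(u,v)$ is the set of edges of $G$ joining $u$ and $v$, and $K_k$ is the complete graph on $k$ vertices. A correspondence cover of a multigraph $G$ is a pair $(H,L)$ such that $H$ is a multigraph; $L:V(G)\to 2^{V(H)}$ assigns a subset $L(v)\subseteq V(H)$ to each $v\in V(G)$; each set $L(v)$ is independent in $H$; the family $\{L(v): v\in V(G)\}$ partitions $V(H)$; and for each pair $u,v\in V(G)$, $H[L(u)\cup L(v)]$ is a union of $|E_G(u,v)|$ matchings. An $(H,L)$-coloring of $G$ is a function $\phi:V(G)\to V(H)$ that satisfies $\phi(v)\in L(v)$ for each $v\in V(G)$ and whose image is an independent set in $H$. For a multigraph $G$ and a correspondence cover $(H,L)$ of $G$, the triple $(G,H,L)$ is minimal if $G$ has no $(H,L)$-coloring, but if $H'$ is obtained from $H$ by removing any edge, $G$ has an $(H',L)$-coloring.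
   Formalization: Added assumption: every list L(v) contains an end of some edge of H; without it, adding isolated vertices of G whose lists meet no edge of H keeps (G,H,L) minimal and makes the edge bound false. *)

theory Defs
  imports Complex_Main "HOL-Library.Disjoint_Sets"
begin

record ('v, 'e) mgraph =
  verts :: "'v set"
  edges :: "'e set"
  ends :: "'e \<Rightarrow> 'v set"

text \<open>Edges are named, so that parallel edges are different edges with the same set of ends;
  loops are excluded because every edge has two ends. All graphs are finite.\<close>

definition multigraph :: "('v, 'e) mgraph \<Rightarrow> bool" where
  "multigraph G \<longleftrightarrow> finite (verts G) \<and> finite (edges G) \<and>
     (\<forall>e\<in>edges G. ends G e \<subseteq> verts G \<and> card (ends G e) = 2)"

definition simple_graph :: "('v, 'e) mgraph \<Rightarrow> bool" where
  "simple_graph G \<longleftrightarrow> multigraph G \<and> inj_on (ends G) (edges G)"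

definition edges_between :: "('v, 'e) mgraph \<Rightarrow> 'v \<Rightarrow> 'v \<Rightarrow> 'e set" where
  "edges_between G u v = {e \<in> edges G. ends G e = {u, v}}"

definition subgraph :: "('v, 'e) mgraph \<Rightarrow> ('v, 'e) mgraph \<Rightarrow> bool" where
  "subgraph F G \<longleftrightarrow> multigraph F \<and> verts F \<subseteq> verts G \<and> edges F \<subseteq> edges G \<and>
     (\<forall>e\<in>edges F. ends F e = ends G e)"

definition complete_graph :: "nat \<Rightarrow> ('v, 'e) mgraph \<Rightarrow> bool" where
  "complete_graph k F \<longleftrightarrow> simple_graph F \<and> card (verts F) = k \<and>
     (\<forall>u\<in>verts F. \<forall>v\<in>verts F. u \<noteq> v \<longrightarrow> edges_between F u v \<noteq> {})"

definition has_complete_subgraph :: "nat \<Rightarrow> ('v, 'e) mgraph \<Rightarrow> bool" where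
  "has_complete_subgraph k G \<longleftrightarrow> (\<exists>F. subgraph F G \<and> complete_graph k F)"

definition induced :: "('v, 'e) mgraph \<Rightarrow> 'v set \<Rightarrow> ('v, 'e) mgraph" where
  "induced G S = G\<lparr>verts := verts G \<inter> S, edges := {e \<in> edges G. ends G e \<subseteq> S}\<rparr>"

definition delete_edge :: "('v, 'e) mgraph \<Rightarrow> 'e \<Rightarrow> ('v, 'e) mgraph" where
  "delete_edge G e = G\<lparr>edges := edges G - {e}\<rparr>"

definition independent_set :: "('v, 'e) mgraph \<Rightarrow> 'v set \<Rightarrow> bool" where
  "independent_set G S \<longleftrightarrow> S \<subseteq> verts G \<and> (\<forall>e\<in>edges G. \<not> ends G e \<subseteq> S)"

definition matching :: "('v, 'e) mgraph \<Rightarrow> 'e set \<Rightarrow> bool" where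
  "matching G M \<longleftrightarrow> M \<subseteq> edges G \<and>
     (\<forall>e\<in>M. \<forall>f\<in>M. e \<noteq> f \<longrightarrow> ends G e \<inter> ends G f = {})"

definition union_of_matchings :: "nat \<Rightarrow> ('v, 'e) mgraph \<Rightarrow> bool" where
  "union_of_matchings m G \<longleftrightarrow>
     (\<exists>M :: nat \<Rightarrow> 'e set. (\<forall>i<m. matching G (M i)) \<and> edges G = (\<Union>i<m. M i))"

text \<open>The partition is that of an indexed family: \<open>L u\<close> and \<open>L v\<close> are disjoint for different
  \<open>u\<close> and \<open>v\<close>, and a single \<open>L v\<close> may be empty.\<close>

definition correspondence_cover ::
    "('v, 'e) mgraph \<Rightarrow> ('w, 'f) mgraph \<Rightarrow> ('v \<Rightarrow> 'w set) \<Rightarrow> bool" where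
  "correspondence_cover G H L \<longleftrightarrow> multigraph G \<and> multigraph H \<and>
     (\<forall>v\<in>verts G. independent_set H (L v)) \<and>
     disjoint_family_on L (verts G) \<and> (\<Union>v\<in>verts G. L v) = verts H \<and>
     (\<forall>u\<in>verts G. \<forall>v\<in>verts G. u \<noteq> v \<longrightarrow>
        union_of_matchings (card (edges_between G u v)) (induced H (L u \<union> L v)))"

definition HL_coloring ::
    "('v, 'e) mgraph \<Rightarrow> ('w, 'f) mgraph \<Rightarrow> ('v \<Rightarrow> 'w set) \<Rightarrow> ('v \<Rightarrow> 'w) \<Rightarrow> bool" where
  "HL_coloring G H L \<phi> \<longleftrightarrow>
     (\<forall>v\<in>verts G. \<phi> v \<in> L v) \<and> independent_set H (\<phi> ` verts G)"

definition minimal_triple ::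
    "('v, 'e) mgraph \<Rightarrow> ('w, 'f) mgraph \<Rightarrow> ('v \<Rightarrow> 'w set) \<Rightarrow> bool" where
  "minimal_triple G H L \<longleftrightarrow> correspondence_cover G H L \<and>
     (\<nexists>\<phi>. HL_coloring G H L \<phi>) \<and>
     (\<forall>e\<in>edges H. \<exists>\<phi>. HL_coloring G (delete_edge H e) L \<phi>)"

text \<open>Minimality only concerns the edges of \<open>H\<close>, so a triple stays minimal when one adds to \<open>G\<close>
  vertices whose lists meet no edge of \<open>H\<close> (for instance isolated vertices of \<open>G\<close>). Enough such
  vertices violate any lower bound on the number of edges that is linear in the number of
  vertices, which is why they are ruled out by a condition of their own. For a minimal triple with
  nonempty lists the condition says that deleting any vertex of \<open>G\<close>, together with its list,
  leaves a colorable graph.\<close>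

definition every_list_meets_edge ::
    "('v, 'e) mgraph \<Rightarrow> ('w, 'f) mgraph \<Rightarrow> ('v \<Rightarrow> 'w set) \<Rightarrow> bool" where
  "every_list_meets_edge G H L \<longleftrightarrow>
     (\<forall>v\<in>verts G. \<exists>e\<in>edges H. ends H e \<inter> L v \<noteq> {})"

end

theory Submission
  imports Defs
begin

text \<open>
  Write \<open>c = k - 1\<close> for the list size. Minimality makes every vertex \<open>v\<close> have degree at least \<open>c\<close>;
  call \<open>v\<close> low if its degree is \<open>c\<close> and high otherwise, and let \<open>deg v - c\<close> be its excess. Twice the
  number of edges is \<open>c n\<close> plus the total excess, so the theorem says that the total excess is
  larger than \<open>n / \<lambda>\<close> unless there is a \<open>K\<^sub>k\<close>.

  Any proper induced part of \<open>G\<close> can be colored, so every nonempty set of vertices is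
  uncolorable from the lists that a coloring of its complement leaves. A connected set of low
  vertices is left with lists at least as long as its degrees. It is therefore tight in the sense
  of Gallai: it can be colored as soon as one list has a spare color (\<open>extend_surplus\<close>), or as soon
  as some color of a non-cut vertex conflicts with no color that is left at some neighbor
  (\<open>extend_mismatch\<close>). Consequently all two-connected sets of low
  vertices are regular (\<open>low_hereditarily_regular\<close>), and then the blocks of the graph of low vertices
  are cliques and cycles (\<open>block_clique\<close>). For \<open>k \<le> 24\<close> Gallai's count of the edges of such a graph
  suffices (\<open>gallai_slack\<close>, \<open>gallai_excess\<close>).

  For larger \<open>k\<close>, the low vertices send few edges to high ones only if nearly all of them lie
  inside cliques of at least \<open>3 k / 4\<close> low vertices (\<open>simplicial_many\<close>). Let \<open>W\<close> be the set of vertices of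
  such a clique that have no low neighbor outside it. Two vertices \<open>t\<close> and \<open>t'\<close> of \<open>W\<close> make the
  clique colorable if the colors forbidden at \<open>t\<close> and at \<open>t'\<close> do not correspond to each other. A
  high vertex \<open>b\<close> adjacent to \<open>t\<close> but not to \<open>t'\<close> can bring this about, or preserve it, by avoiding a
  single color, while its edges to \<open>W\<close> may be many. If \<open>W\<close> has many high neighbors that each miss
  at least two vertices of \<open>W\<close>, there is a wide choice of vertices \<open>b\<close> for this task, and Hall's
  theorem distributes the tasks among the high vertices, unless the high vertices have so
  many edges among themselves and so large an excess that the bound holds anyway
  (\<open>reducible_configuration\<close>, \<open>light_edges_bound\<close>). Otherwise \<open>W\<close> has a neighbor that sees all of \<open>W\<close> or
  all but one vertex and that has excess at least about \<open>card W / 2\<close>; this uses that there is no \<open>K\<^sub>k\<close>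
  (\<open>partial_neighbor_excess\<close>, \<open>common_neighbors_excess\<close>, \<open>rich_neighbor\<close>). Adding up both kinds
  of cliques bounds \<open>n\<close> by 23 times the total excess (\<open>large_excess\<close>).
\<close>

section \<open>Connected and two-connected vertex sets\<close>

locale sgraph =
  fixes adj :: "'v \<Rightarrow> 'v \<Rightarrow> bool"
  assumes adj_sym: "adj u v \<Longrightarrow> adj v u"
    and adj_irrefl: "\<not> adj u u"
begin

definition deg :: "'v set \<Rightarrow> 'v \<Rightarrow> nat" where
  "deg S v = card {u \<in> S. adj v u}"

definition is_connected :: "'v set \<Rightarrow> bool" where
  "is_connected S \<longleftrightarrow> (\<forall>A. A \<subseteq> S \<and> A \<noteq> {} \<and> A \<noteq> S \<longrightarrow> (\<exists>u\<in>A. \<exists>v\<in>S - A. adj u v))"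

definition two_connected :: "'v set \<Rightarrow> bool" where
  "two_connected S \<longleftrightarrow> is_connected S \<and> (\<forall>x\<in>S. is_connected (S - {x}))"

definition is_clique :: "'v set \<Rightarrow> bool" where
  "is_clique S \<longleftrightarrow> (\<forall>u\<in>S. \<forall>v\<in>S. u \<noteq> v \<longrightarrow> adj u v)"

lemma deg_union: "finite A \<Longrightarrow> finite B \<Longrightarrow> A \<inter> B = {} \<Longrightarrow> deg (A \<union> B) v = deg A v + deg B v"
proof -
  assume "finite A" "finite B" "A \<inter> B = {}"
  moreover have "{u \<in> A \<union> B. adj v u} = {u \<in> A. adj v u} \<union> {u \<in> B. adj v u}" by auto
  ultimately show ?thesis unfolding deg_def
    by (simp add: card_Un_disjoint disjoint_iff)
qed

lemma deg_remove: "finite S \<Longrightarrow> x \<in> S \<Longrightarrow> deg S v = deg (S - {x}) v + (if adj v x then 1 else 0)"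
proof -
  assume f: "finite S" "x \<in> S"
  have "deg (S - {x} \<union> {x}) v = deg (S - {x}) v + deg {x} v"
    by (rule deg_union) (use f in auto)
  moreover have "S - {x} \<union> {x} = S" using f by auto
  moreover have "deg {x} v = (if adj v x then 1 else 0)"
    unfolding deg_def by (auto simp: Collect_conv_if conj_commute cong: conj_cong)
  ultimately show ?thesis by simp
qed

lemma deg_mono: "finite B \<Longrightarrow> A \<subseteq> B \<Longrightarrow> deg A v \<le> deg B v"
  unfolding deg_def by (rule card_mono) auto

lemma deg_less_card: "finite S \<Longrightarrow> v \<in> S \<Longrightarrow> deg S v < card S"
  unfolding deg_def using adj_irrefl by (intro psubset_card_mono) auto

lemma deg_clique: "finite S \<Longrightarrow> is_clique S \<Longrightarrow> v \<in> S \<Longrightarrow> deg S v = card S - 1"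
proof -
  assume a: "finite S" "is_clique S" "v \<in> S"
  have "{u \<in> S. adj v u} = S - {v}" using a adj_irrefl unfolding is_clique_def by auto
  then show ?thesis unfolding deg_def using a by simp
qed

lemma clique_if_deg: "finite S \<Longrightarrow> (\<And>v. v \<in> S \<Longrightarrow> card S \<le> deg S v + 1) \<Longrightarrow> is_clique S"
proof (unfold is_clique_def, intro ballI impI)
  fix u v assume f: "finite S" and d: "\<And>v. v \<in> S \<Longrightarrow> card S \<le> deg S v + 1" and uv: "u \<in> S" "v \<in> S" "u \<noteq> v"
  show "adj u v"
  proof (rule ccontr)
    assume "\<not> adj u v"
    then have "{w \<in> S. adj u w} \<subseteq> S - {u, v}" using adj_irrefl by auto
    then have "deg S u \<le> card (S - {u, v})" unfolding deg_def using f by (intro card_mono) auto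
    also have "\<dots> = card S - 2" using uv f by (subst card_Diff_subset) auto
    finally have "deg S u \<le> card S - 2" .
    moreover have "card {u, v} \<le> card S" using uv f by (intro card_mono) auto
    ultimately show False using d[OF uv(1)] uv(3) by simp
  qed
qed

lemma is_connectedD: "is_connected S \<Longrightarrow> A \<subseteq> S \<Longrightarrow> A \<noteq> {} \<Longrightarrow> A \<noteq> S \<Longrightarrow> \<exists>u\<in>A. \<exists>v\<in>S - A. adj u v"
  unfolding is_connected_def by blast

text \<open>It suffices to look at the side of a partition that avoids a given vertex.\<close>

lemma is_connectedI_avoid:
  assumes "x \<in> S"
    and "\<And>A. A \<subseteq> S - {x} \<Longrightarrow> A \<noteq> {} \<Longrightarrow> \<exists>u\<in>A. \<exists>v\<in>S - A. adj u v"
  shows "is_connected S"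
  unfolding is_connected_def
proof (intro allI impI)
  fix A assume A: "A \<subseteq> S \<and> A \<noteq> {} \<and> A \<noteq> S"
  show "\<exists>u\<in>A. \<exists>v\<in>S - A. adj u v"
  proof (cases "x \<in> A")
    case False then show ?thesis using assms(2)[of A] A by blast
  next
    case True
    then obtain u v where "u \<in> S - A" "v \<in> S - (S - A)" "adj u v"
      using assms(2)[of "S - A"] A by blast
    then show ?thesis using adj_sym by blast
  qed
qed

lemma connected_insert: "is_connected S \<Longrightarrow> u \<in> S \<Longrightarrow> adj v u \<Longrightarrow> is_connected (insert v S)"
proof (rule is_connectedI_avoid[of v])
  fix A assume c: "is_connected S" "u \<in> S" "adj v u" and A: "A \<subseteq> insert v S - {v}" "A \<noteq> {}"
  then have "A \<subseteq> S" by auto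
  show "\<exists>a\<in>A. \<exists>b\<in>insert v S - A. adj a b"
  proof (cases "A = S")
    case True then show ?thesis using c A adj_sym by blast
  next
    case False then show ?thesis using is_connectedD[OF c(1) \<open>A \<subseteq> S\<close> A(2)] by blast
  qed
qed auto

lemma clique_connected: "is_clique S \<Longrightarrow> is_connected S"
  unfolding is_connected_def is_clique_def by (metis DiffD1 DiffI psubsetI psubset_imp_ex_mem DiffD2 all_not_in_conv subsetD)

lemma clique_subset: "is_clique S \<Longrightarrow> A \<subseteq> S \<Longrightarrow> is_clique A"
  unfolding is_clique_def by blast

lemma clique_two_connected: "is_clique S \<Longrightarrow> two_connected S"
  unfolding two_connected_def using clique_connected clique_subset by blast

text \<open>Adding a vertex with two neighbors is the only way in which larger two-connected sets are built
  below; applied to a clique it produces two-connected sets that are not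
  regular, unless the new vertex is adjacent to all of the clique.\<close>

lemma two_connected_insert:
  assumes S: "two_connected S" and u: "u1 \<in> S" "u2 \<in> S" "u1 \<noteq> u2" "adj v u1" "adj v u2"
  shows "two_connected (insert v S)"
  unfolding two_connected_def
proof (intro conjI ballI)
  have c: "is_connected S" using S by (simp add: two_connected_def)
  show "is_connected (insert v S)" using connected_insert[OF c u(1,4)] .
  fix x assume x: "x \<in> insert v S"
  show "is_connected (insert v S - {x})"
  proof (cases "x = v")
    case True
    show ?thesis
    proof (cases "v \<in> S")
      case True then show ?thesis using S \<open>x = v\<close> by (simp add: two_connected_def insert_absorb)
    next
      case False then show ?thesis using c True by simp
    qed
  next
    case False
    then have cx: "is_connected (S - {x})" using S x by (simp add: two_connected_def)
    obtain w where "w \<in> S - {x}" "adj v w" using u by (cases "u1 = x") auto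
    from connected_insert[OF cx this] False show ?thesis by (simp add: insert_Diff_if)
  qed
qed

text \<open>The connected sets that contain \<open>v0\<close> grow one vertex at a time, so a maximal proper one omits
  exactly one vertex. This drives the greedy coloring towards \<open>v0\<close>.\<close>

lemma connected_noncut_vertex:
  assumes "finite S" "is_connected S" "v0 \<in> S" "S \<noteq> {v0}"
  obtains v where "v \<in> S" "v \<noteq> v0" "is_connected (S - {v})"
proof -
  define F where "F = {A. A \<subseteq> S \<and> A \<noteq> S \<and> v0 \<in> A \<and> is_connected A}"
  have f: "finite F" using assms(1) unfolding F_def by simp
  have "is_connected {v0}" unfolding is_connected_def by auto
  then have m: "{v0} \<in> F" using assms unfolding F_def by auto
  obtain A where "A \<in> F" and max: "\<forall>B\<in>F. A \<subseteq> B \<longrightarrow> A = B"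
    using finite_has_maximal2[OF f m] by metis
  then have A: "A \<subseteq> S" "A \<noteq> S" "v0 \<in> A" "is_connected A" unfolding F_def by auto
  then have "A \<noteq> {}" by blast
  then obtain u v where uv: "u \<in> A" "v \<in> S - A" "adj u v" using is_connectedD[OF assms(2), of A] A by blast
  have "is_connected (insert v A)" using connected_insert[of A u v] A uv adj_sym by blast
  then have "insert v A = S" using max A uv unfolding F_def by blast
  then have "S - {v} = A" using uv by blast
  then show ?thesis using that[of v] A uv by blast
qed

text \<open>Minimality of the piece \<open>K\<close> cut off is what makes \<open>insert x K\<close> two-connected: a cut vertex
  of it would cut off a smaller piece.\<close>

lemma leaf_block:
  assumes fin: "finite T" and c: "is_connected T" and n: "\<not> two_connected T"
  obtains x K where "x \<in> T" "K \<subseteq> T - {x}" "K \<noteq> {}" "T - insert x K \<noteq> {}"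
    "\<And>u v. u \<in> K \<Longrightarrow> v \<in> T - insert x K \<Longrightarrow> \<not> adj u v"
    "two_connected (insert x K)" "is_connected (T - K)"
proof -
  define P where "P = (\<lambda>(x, K). x \<in> T \<and> K \<subseteq> T - {x} \<and> K \<noteq> {} \<and> T - insert x K \<noteq> {} \<and>
      (\<forall>u\<in>K. \<forall>v\<in>T - insert x K. \<not> adj u v))"
  obtain x0 where x0: "x0 \<in> T" "\<not> is_connected (T - {x0})" using c n by (auto simp: two_connected_def)
  then obtain A0 where A0: "A0 \<subseteq> T - {x0}" "A0 \<noteq> {}" "A0 \<noteq> T - {x0}"
      "\<forall>u\<in>A0. \<forall>v\<in>T - {x0} - A0. \<not> adj u v"
    unfolding is_connected_def by blast
  have "P (x0, A0)" using x0 A0 unfolding P_def by auto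
  then obtain p where p: "P p" and least: "\<And>q. P q \<Longrightarrow> card (snd p) \<le> card (snd q)"
    using ex_has_least_nat[of P "(x0, A0)" "\<lambda>q. card (snd q)"] by blast
  obtain x K where pe: "p = (x, K)" by (cases p)
  have xT: "x \<in> T" and KT: "K \<subseteq> T - {x}" and Kne: "K \<noteq> {}" and rest: "T - insert x K \<noteq> {}"
    and no: "\<And>u v. u \<in> K \<Longrightarrow> v \<in> T - insert x K \<Longrightarrow> \<not> adj u v"
    using p unfolding P_def pe by auto
  have finK: "finite K" using KT fin by (metis finite_Diff finite_subset)
  have small: False if "P (y, A)" "A \<subset> K" for y A
    using least[OF that(1)] psubset_card_mono[OF finK that(2)] unfolding pe by simp
  have cK: "is_connected (T - K)"
  proof (rule is_connectedI_avoid[of x])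
    fix A assume A: "A \<subseteq> T - K - {x}" "A \<noteq> {}"
    have "A \<subseteq> T" "A \<noteq> T" using A xT by blast+
    then obtain u v where uv: "u \<in> A" "v \<in> T - A" "adj u v" using is_connectedD[OF c _ A(2)] by blast
    then have "v \<notin> K" using no[of v u] A adj_sym by blast
    then show "\<exists>u\<in>A. \<exists>v\<in>T - K - A. adj u v" using uv by blast
  qed (use xT KT in auto)
  have edge: "\<exists>u\<in>A. \<exists>v\<in>insert x K - A. adj u v" if A: "A \<subseteq> K" "A \<noteq> {}" for A
  proof -
    have "A \<subseteq> T" "A \<noteq> T" using A xT KT by blast+
    then obtain u v where uv: "u \<in> A" "v \<in> T - A" "adj u v"
      using is_connectedD[OF c _ A(2)] by blast
    then have "v \<in> insert x K" using no[of u v] A by blast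
    then show ?thesis using uv by blast
  qed
  have "is_connected (insert x K)"
    by (rule is_connectedI_avoid[of x]) (use edge in blast)+
  moreover have "is_connected (insert x K - {y})" if y: "y \<in> insert x K" for y
  proof (cases "y = x")
    case True
    have "is_connected K" unfolding is_connected_def
    proof (intro allI impI, rule ccontr)
      fix A assume A: "A \<subseteq> K \<and> A \<noteq> {} \<and> A \<noteq> K" and ne: "\<not> (\<exists>u\<in>A. \<exists>v\<in>K - A. adj u v)"
      have "\<forall>u\<in>A. \<forall>v\<in>T - insert x A. \<not> adj u v" using ne A no by blast
      then have "P (x, A)" unfolding P_def using A xT KT by auto
      then show False using small A by blast
    qed
    then show ?thesis using True KT by (simp add: insert_Diff_if subset_Diff_insert)
  next
    case False
    then have yK: "y \<in> K" using y by blast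
    show ?thesis
    proof (rule is_connectedI_avoid[of x], use False in blast, rule ccontr)
      fix A assume A: "A \<subseteq> insert x K - {y} - {x}" "A \<noteq> {}"
        and ne: "\<not> (\<exists>u\<in>A. \<exists>v\<in>insert x K - {y} - A. adj u v)"
      have "\<forall>u\<in>A. \<forall>v\<in>T - insert y A. \<not> adj u v" using ne A no by blast
      then have "P (y, A)" unfolding P_def using A xT KT yK by auto
      then show False using small[of y A] A yK by blast
    qed
  qed
  ultimately have "two_connected (insert x K)" unfolding two_connected_def by blast
  then show ?thesis using that[OF xT KT Kne rest no _ cK] by blast
qed

end

section \<open>Graphs whose two-connected induced subgraphs are regular\<close>

context sgraph
begin

text \<open>For a set of low vertices this is what remains of the theory of degree-choosability: a
  two-connected set whose degrees are not all equal could be colored from lists of the sizes of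
  its degrees.\<close>

definition hereditarily_regular :: "'v set \<Rightarrow> bool" where
  "hereditarily_regular D \<longleftrightarrow>
     (\<forall>S\<subseteq>D. two_connected S \<longrightarrow> (\<forall>u\<in>S. \<forall>v\<in>S. deg S u = deg S v))"

lemma hereditarily_regularD:
  "hereditarily_regular D \<Longrightarrow> S \<subseteq> D \<Longrightarrow> two_connected S \<Longrightarrow> u \<in> S \<Longrightarrow> v \<in> S \<Longrightarrow> deg S u = deg S v"
  unfolding hereditarily_regular_def by blast

lemma deg_cong: "{u \<in> A. adj v u} = {u \<in> B. adj v u} \<Longrightarrow> deg A v = deg B v"
  unfolding deg_def by simp

lemma deg_insert_not_adj: "\<not> adj v x \<Longrightarrow> deg (insert x A) v = deg A v"
  by (rule deg_cong) auto

lemma deg_insert_self: "deg (insert v A) v = deg A v"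
  using adj_irrefl by (intro deg_cong) auto

lemma deg_insert_adj: "finite A \<Longrightarrow> x \<notin> A \<Longrightarrow> adj v x \<Longrightarrow> deg (insert x A) v = deg A v + 1"
  using deg_remove[of "insert x A" x v] by simp

lemma deg_pos: "finite S \<Longrightarrow> deg S v \<ge> 1 \<longleftrightarrow> (\<exists>u\<in>S. adj v u)"
  unfolding deg_def by (simp add: Suc_le_eq card_gt_0_iff) blast

lemma connected_deg_pos:
  assumes "finite S" "is_connected S" "v \<in> S" "S \<noteq> {v}"
  shows "deg S v \<ge> 1"
  using is_connectedD[OF assms(2), of "{v}"] assms deg_pos by auto

text \<open>Delete a vertex \<open>v\<close> of the \<open>m\<close>-regular set \<open>Q\<close>. If the rest is two-connected, it is again regular,
  which is only possible if \<open>v\<close> is adjacent to everything. If not, a leaf block of the rest is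
  \<open>(m - 1)\<close>-regular, and counting the edges at \<open>v\<close> shows that it is a clique on \<open>m\<close> vertices of which
  \<open>v\<close> misses only the cut vertex; such a set is two-connected but not regular.\<close>

lemma block_clique:
  assumes D: "hereditarily_regular D" and Q: "Q \<subseteq> D" "finite Q" "two_connected Q"
    and v: "v \<in> Q" and m3: "3 \<le> deg Q v"
  shows "is_clique Q"
proof -
  define m where "m = deg Q v"
  have reg: "deg Q u = m" if "u \<in> Q" for u
    unfolding m_def using hereditarily_regularD[OF D Q(1,3)] that v by blast
  have all_if: "is_clique Q" if "card Q \<le> m + 1"
    using clique_if_deg[OF Q(2)] reg that by simp
  have degv: "deg (Q - {v}) u = (if adj u v then m - 1 else m)" if "u \<in> Q" for u
    using deg_remove[OF Q(2) v, of u] reg[OF that] by auto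
  show ?thesis
  proof (cases "two_connected (Q - {v})")
    case True
    obtain u where u: "u \<in> Q" "adj v u" using deg_pos[OF Q(2), of v] m3 by auto
    have "u \<noteq> v" using u adj_irrefl by auto
    have "adj w v" if w: "w \<in> Q - {v}" for w
    proof (rule ccontr)
      assume "\<not> adj w v"
      then have "deg (Q - {v}) w = m" using degv[of w] w by simp
      moreover have "deg (Q - {v}) w = deg (Q - {v}) u"
        using hereditarily_regularD[OF D _ True] w u \<open>u \<noteq> v\<close> Q(1) by blast
      moreover have "deg (Q - {v}) u = m - 1" using degv[OF u(1)] adj_sym[OF u(2)] by simp
      ultimately show False using m3 unfolding m_def by linarith
    qed
    then have "{u \<in> Q. adj v u} = Q - {v}" using adj_sym adj_irrefl by blast
    then have "m = card Q - 1" unfolding m_def deg_def using Q(2) v by simp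
    then show ?thesis using all_if by simp
  next
    case False
    have "is_connected (Q - {v})" using Q(3) v by (simp add: two_connected_def)
    then obtain x K where x: "x \<in> Q - {v}" and K: "K \<subseteq> Q - {v} - {x}" "K \<noteq> {}"
      and rest: "Q - {v} - insert x K \<noteq> {}"
      and no: "\<And>u w. u \<in> K \<Longrightarrow> w \<in> Q - {v} - insert x K \<Longrightarrow> \<not> adj u w"
      and tc: "two_connected (insert x K)" and "is_connected (Q - {v} - K)"
      using leaf_block[of "Q - {v}"] False Q(2) by (metis finite_Diff)
    let ?B = "insert x K"
    have finK: "finite K" using K(1) Q(2) by (metis finite_Diff finite_subset)
    have xK: "x \<notin> K" using K(1) by blast
    have cx: "is_connected (Q - {x})" using Q(3) x by (simp add: two_connected_def)
    \<comment> \<open>\<open>x\<close> does not separate \<open>Q\<close>, so \<open>v\<close> has neighbors in \<open>K\<close> and outside \<open>insert x K\<close>.\<close>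
    have out: "\<exists>a\<in>A. adj a v" if A: "A \<subseteq> Q - {v} - {x}" "A \<noteq> {}" 
      "\<And>a b. a \<in> A \<Longrightarrow> b \<in> Q - {v} - insert x A \<Longrightarrow> \<not> adj a b" for A
    proof -
      have "A \<subseteq> Q - {x}" "A \<noteq> Q - {x}" using A x v by blast+
      then obtain a b where "a \<in> A" "b \<in> Q - {x} - A" "adj a b" using is_connectedD[OF cx _ A(2)] by blast
      then show ?thesis using A(3)[of a b] by blast
    qed
    have inK: "\<exists>a\<in>K. adj a v" by (rule out) (use K no in auto)
    have "\<exists>a\<in>Q - {v} - ?B. adj a v"
    proof (rule out)
      show "\<not> adj a b" if "a \<in> Q - {v} - ?B" "b \<in> Q - {v} - insert x (Q - {v} - ?B)" for a b
        using no[of b a] that adj_sym by blast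
    qed (use rest in auto)
    then obtain z where z: "z \<in> Q - {v} - ?B" "adj v z" using adj_sym by blast
    have degK: "deg ?B u = (if adj u v then m - 1 else m)" if "u \<in> K" for u
    proof -
      have "deg ?B u = deg (Q - {v}) u" by (rule deg_cong) (use no that K x in blast)
      then show ?thesis using degv that K by auto
    qed
    obtain a where a: "a \<in> K" "adj a v" using inK by blast
    have BD: "?B \<subseteq> D" using K(1) Q(1) x by blast
    have regB: "deg ?B u = m - 1" if "u \<in> ?B" for u
    proof -
      have "deg ?B u = deg ?B a"
        by (rule hereditarily_regularD[OF D BD tc that]) (use a in blast)
      then show ?thesis using a(2) degK[OF a(1)] by simp
    qed
    have Kv: "adj u v" if "u \<in> K" for u
    proof (rule ccontr)
      assume "\<not> adj u v"
      then have "deg ?B u = m" using degK[OF that] by simp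
      moreover have "deg ?B u = m - 1" by (rule regB) (use that in blast)
      ultimately show False using m3 unfolding m_def by linarith
    qed
    have "card (insert z K) \<le> deg Q v" unfolding deg_def
      by (rule card_mono) (use Q z Kv K adj_sym in auto)
    then have "card K + 1 \<le> m" using z finK unfolding m_def by simp
    moreover have "m - 1 < card ?B" using deg_less_card[of ?B x] regB finK by simp
    ultimately have cB: "card ?B = m" using finK xK by simp
    have "\<not> adj x v"
    proof
      assume xv: "adj x v"
      have cc: "is_connected (Q - {v})" by fact
      have "?B \<subseteq> Q - {v}" "?B \<noteq> Q - {v}" using K x rest by blast+
      then obtain u w where uw: "u \<in> ?B" "w \<in> Q - {v} - ?B" "adj u w" using is_connectedD[OF cc, of ?B] by blast
      then have ux: "adj x w" using no[of u w] by blast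
      have "card ({u \<in> ?B. adj x u} \<union> {v, w}) \<le> deg Q x" unfolding deg_def
        by (rule card_mono) (use Q K x v uw ux xv in auto)
      moreover have "card ({u \<in> ?B. adj x u} \<union> {v, w}) = deg ?B x + 2"
        unfolding deg_def using finK uw K x by (subst card_Un_disjoint) auto
      ultimately show False using regB[of x] reg[of x] x m3 unfolding m_def by simp
    qed
    \<comment> \<open>Now \<open>v\<close> is adjacent to all of the clique \<open>insert x K\<close> except \<open>x\<close>: two-connected but not regular.\<close>
    have "is_clique ?B" using clique_if_deg[of ?B] regB cB finK m3 unfolding m_def by simp
    obtain b where b: "b \<in> K" "b \<noteq> a"
    proof -
      have "card K \<ge> 2" using cB m3 finK xK unfolding m_def by simp
      then have "K \<noteq> {a}" by auto
      then show ?thesis using that K(2) by blast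
    qed
    have "two_connected (insert v ?B)"
      by (rule two_connected_insert[OF tc, of a b]) (use a b Kv adj_sym in auto)
    then have "deg (insert v ?B) x = deg (insert v ?B) a"
      using hereditarily_regularD[OF D, of "insert v ?B"] K Q v x a by blast
    moreover have "deg (insert v ?B) x = m - 1"
      using \<open>\<not> adj x v\<close> regB[of x] by (simp add: deg_insert_not_adj)
    moreover have "deg (insert v ?B) a = m - 1 + 1"
      using regB[of a] a finK K x by (subst deg_insert_adj) auto
    ultimately show ?thesis by simp
  qed
qed

text \<open>For degree 2 this leaves cycles of any length, about which only the number of vertices matters.\<close>

lemma block_regular:
  assumes D: "hereditarily_regular D" and Q: "Q \<subseteq> D" "finite Q" "two_connected Q" and "x \<in> Q"
  obtains m where "\<And>u. u \<in> Q \<Longrightarrow> deg Q u = m" "m + 1 \<le> card Q"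
    "3 \<le> m \<Longrightarrow> is_clique Q \<and> card Q = m + 1"
proof (rule that[of "deg Q x"])
  show "deg Q u = deg Q x" if "u \<in> Q" for u
    using hereditarily_regularD[OF D Q(1,3)] that assms(5) by blast
  show "deg Q x + 1 \<le> card Q" using deg_less_card[OF Q(2) assms(5)] by simp
  show "is_clique Q \<and> card Q = deg Q x + 1" if "3 \<le> deg Q x"
    using block_clique[OF D Q assms(5) that] deg_clique[OF Q(2) _ assms(5)] deg_less_card[OF Q(2) assms(5)]
    by auto
qed

text \<open>For a set \<open>T\<close> of low vertices and \<open>c\<close> the list size this is the number of edges that leave \<open>T\<close>, but
  it is defined by the degrees within \<open>T\<close> alone, so that induction on \<open>T\<close> is possible.\<close>

definition slack :: "int \<Rightarrow> 'v set \<Rightarrow> int" where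
  "slack c T = (\<Sum>v\<in>T. c - int (deg T v))"

lemma slack_disconnected:
  assumes "finite T" "A \<subseteq> T" "\<And>u v. u \<in> A \<Longrightarrow> v \<in> T - A \<Longrightarrow> \<not> adj u v"
  shows "slack c T = slack c A + slack c (T - A)"
proof -
  have "slack c T = (\<Sum>v\<in>T-A. c - int (deg T v)) + (\<Sum>v\<in>A. c - int (deg T v))"
    unfolding slack_def by (rule sum.subset_diff) (use assms in auto)
  moreover have "(\<Sum>v\<in>A. c - int (deg T v)) = slack c A" unfolding slack_def
  proof (rule sum.cong)
    fix v assume "v \<in> A" then show "c - int (deg T v) = c - int (deg A v)"
      using assms by (subst deg_cong[of T v A]) auto
  qed simp
  moreover have "(\<Sum>v\<in>T-A. c - int (deg T v)) = slack c (T - A)" unfolding slack_def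
  proof (rule sum.cong)
    fix v assume v: "v \<in> T - A"
    have "{u \<in> T. adj v u} = {u \<in> T - A. adj v u}" using assms(3) v adj_sym by blast
    then show "c - int (deg T v) = c - int (deg (T - A) v)" using deg_cong by simp
  qed simp
  ultimately show ?thesis by simp
qed

lemma leaf_block_degs:
  assumes "finite T" "x \<in> T" "K \<subseteq> T - {x}"
    and no: "\<And>u v. u \<in> K \<Longrightarrow> v \<in> T - insert x K \<Longrightarrow> \<not> adj u v"
  shows "u \<in> K \<Longrightarrow> {w \<in> T. adj u w} = {w \<in> insert x K. adj u w}"
    and "u \<in> T - insert x K \<Longrightarrow> {w \<in> T. adj u w} = {w \<in> T - K. adj u w}"
    and "deg T x = deg (T - K) x + deg (insert x K) x"
proof -
  show "u \<in> K \<Longrightarrow> {w \<in> T. adj u w} = {w \<in> insert x K. adj u w}" using no[of u] assms by auto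
  show "u \<in> T - insert x K \<Longrightarrow> {w \<in> T. adj u w} = {w \<in> T - K. adj u w}"
    using no[of _ u] assms adj_sym by blast
  have "deg T x = deg (T - K) x + deg K x"
    using deg_union[of "T - K" K x] assms
    by (metis Diff_disjoint Diff_empty Un_Diff_cancel2 Un_absorb2 assms(1) finite_Diff finite_subset inf_commute subset_Diff_insert)
  then show "deg T x = deg (T - K) x + deg (insert x K) x" by (simp add: deg_insert_self)
qed

lemma slack_leaf_block:
  assumes T: "finite T" "x \<in> T" "K \<subseteq> T - {x}"
    and no: "\<And>u v. u \<in> K \<Longrightarrow> v \<in> T - insert x K \<Longrightarrow> \<not> adj u v"
    and reg: "\<And>u. u \<in> insert x K \<Longrightarrow> deg (insert x K) u = m"
  shows "slack c T = slack c (T - K) + int (card K) * (c - int m) - int m"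
proof -
  note d = leaf_block_degs[OF T no]
  have finK: "finite K" using T by (metis finite_Diff finite_subset)
  have "slack c T = (\<Sum>v\<in>T-K. c - int (deg T v)) + (\<Sum>v\<in>K. c - int (deg T v))"
    unfolding slack_def by (rule sum.subset_diff) (use T in auto)
  also have "(\<Sum>v\<in>K. c - int (deg T v)) = (\<Sum>v\<in>K. c - int m)"
  proof (rule sum.cong)
    fix v assume "v \<in> K" then show "c - int (deg T v) = c - int m"
      using deg_cong[OF d(1)] reg by auto
  qed simp
  also have "\<dots> = int (card K) * (c - int m)" by simp
  also have "(\<Sum>v\<in>T-K. c - int (deg T v)) = slack c (T - K) - int m"
  proof -
    have xin: "x \<in> T - K" using T by auto
    have "(\<Sum>v\<in>T-K. c - int (deg T v)) = (c - int (deg T x)) + (\<Sum>v\<in>T-K-{x}. c - int (deg T v))"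
      by (rule sum.remove) (use T xin in auto)
    also have "(\<Sum>v\<in>T-K-{x}. c - int (deg T v)) = (\<Sum>v\<in>T-K-{x}. c - int (deg (T - K) v))"
    proof (rule sum.cong)
      fix v assume "v \<in> T - K - {x}"
      then show "c - int (deg T v) = c - int (deg (T - K) v)" using deg_cong[OF d(2)] by auto
    qed simp
    also have "c - int (deg T x) = (c - int (deg (T - K) x)) - int m" using d(3) reg by simp
    also have "\<dots> + (\<Sum>v\<in>T-K-{x}. c - int (deg (T - K) v)) = slack c (T - K) - int m"
      unfolding slack_def using sum.remove[of "T - K" x "\<lambda>v. c - int (deg (T - K) v)"] T xin by simp
    finally show ?thesis .
  qed
  finally show ?thesis by simp
qed

lemma slack_remove_pendant:
  assumes "finite T" "x \<in> T" "z \<in> T" "\<And>u. u \<in> T \<Longrightarrow> adj x u \<Longrightarrow> u = z" "adj x z"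
  shows "slack c T = slack c (T - {x}) + c - 2"
proof -
  have zx: "z \<noteq> x" using assms(5) adj_irrefl by auto
  have "slack c T = (c - int (deg T x)) + (\<Sum>v\<in>T-{x}. c - int (deg T v))"
    unfolding slack_def by (rule sum.remove) (use assms(1,2) in auto)
  also have "{u \<in> T. adj x u} = {z}" using assms(3,4,5) by blast
  then have "deg T x = 1" unfolding deg_def by simp
  also have "(\<Sum>v\<in>T-{x}. c - int (deg T v)) = (\<Sum>v\<in>T-{x}. (c - int (deg (T - {x}) v)) - (if v = z then 1 else 0))"
  proof (rule sum.cong)
    fix v assume v: "v \<in> T - {x}"
    have "adj v x \<longleftrightarrow> v = z" using assms v adj_sym by blast
    then show "c - int (deg T v) = (c - int (deg (T - {x}) v)) - (if v = z then 1 else 0)"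
      using deg_remove[OF assms(1,2), of v] by simp
  qed simp
  also have "\<dots> = slack c (T - {x}) - 1"
    unfolding slack_def using assms(1,3) zx by (simp add: sum_subtractf)
  finally show ?thesis by simp
qed

text \<open>Gallai's bound. When a leaf block that is regular of degree \<open>k - 2\<close>, such as a clique on \<open>k - 1\<close>
  vertices, hangs at \<open>x\<close>, exactly one more edge leaves \<open>x\<close>. The block alone would lose too much, and
  the induction removes \<open>x\<close> together with it.\<close>

lemma gallai_slack:
  assumes D: "finite D" "hereditarily_regular D" and k: "4 \<le> k"
    and nok: "\<And>S. S \<subseteq> D \<Longrightarrow> is_clique S \<Longrightarrow> card S \<noteq> k"
  shows "T \<subseteq> D \<Longrightarrow> T \<noteq> {} \<Longrightarrow> (\<And>v. v \<in> T \<Longrightarrow> deg T v \<le> k - 1) \<Longrightarrow>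
    (int k - 1) * slack (int k - 1) T \<ge> (int k - 3) * int (card T) + 2 * (int k - 1)"
proof (induction "card T" arbitrary: T rule: less_induct)
  case less
  define c where "c = int k - 1"
  have c3: "c \<ge> 3" using k unfolding c_def by simp
  have finT: "finite T" using less.prems(1) D(1) finite_subset by blast
  have IH: "c * slack c S \<ge> (c - 2) * int (card S) + 2 * c" if S: "S \<subset> T" "S \<noteq> {}" for S
  proof -
    have "deg S v \<le> k - 1" if "v \<in> S" for v
      using deg_mono[OF finT, of S v] less.prems(3)[of v] S that by (meson le_trans psubsetD psubset_imp_subset)
    moreover have "card S < card T" using S finT by (simp add: psubset_card_mono)
    ultimately show ?thesis using less.hyps[of S] S less.prems(1) unfolding c_def by (simp add: algebra_simps)
  qed
  have goal: "c * slack c T \<ge> (c - 2) * int (card T) + 2 * c"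
  proof (cases "is_connected T")
    case False
    then obtain A where A: "A \<subseteq> T" "A \<noteq> {}" "A \<noteq> T" "\<And>u v. u \<in> A \<Longrightarrow> v \<in> T - A \<Longrightarrow> \<not> adj u v"
      unfolding is_connected_def by blast
    have "card T = card A + card (T - A)"
      using A finT by (metis card_Diff_subset card_mono finite_subset le_add_diff_inverse)
    moreover have "slack c T = slack c A + slack c (T - A)"
      by (rule slack_disconnected) (use A finT in auto)
    moreover have "c * slack c A \<ge> (c - 2) * int (card A) + 2 * c" by (rule IH) (use A in auto)
    moreover have "c * slack c (T - A) \<ge> (c - 2) * int (card (T - A)) + 2 * c"
      by (rule IH) (use A in auto)
    ultimately show ?thesis using c3 by (simp add: algebra_simps)
  next
    case is_connected: True
    show ?thesis
    proof (cases "two_connected T")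
      case True
      obtain x where x: "x \<in> T" using less.prems by blast
      obtain m where m: "\<And>u. u \<in> T \<Longrightarrow> deg T u = m" "m + 1 \<le> card T"
          "3 \<le> m \<Longrightarrow> is_clique T \<and> card T = m + 1"
        using block_regular[OF D(2) less.prems(1) finT True x] by blast
      have "m \<le> k - 1" using m(1) less.prems(3) x by force
      moreover have "m \<noteq> k - 1" using m(3) nok[OF less.prems(1)] k by auto
      ultimately have mk: "int m \<le> c - 1" unfolding c_def by simp
      have sl: "slack c T = int (card T) * (c - int m)" unfolding slack_def using m(1) by simp
      have "c * slack c T - (c - 2) * int (card T) = int (card T) * (c * (c - int m) - (c - 2))"
        unfolding sl by (simp add: algebra_simps)
      moreover have "c * (c - int m) - (c - 2) \<ge> 2" 
      proof -
        have "c * (c - int m) \<ge> c * 1" by (rule mult_left_mono) (use mk c3 in auto)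
        then show ?thesis by simp
      qed
      then have "int (card T) * (c * (c - int m) - (c - 2)) \<ge> (int m + 1) * (c * (c - int m) - (c - 2))"
        using m(2) by (intro mult_right_mono) auto
      moreover have "(int m + 1) * (c * (c - int m) - (c - 2)) \<ge> 2 * c"
      proof (cases "int m = c - 1")
        case True show ?thesis unfolding True by (simp add: algebra_simps)
      next
        case False
        then have a: "c - 1 - int m \<ge> 1" using mk by simp
        have "(int m + 1) * (c * (c - int m) - (c - 2)) = c * ((int m + 1) * (c - 1 - int m)) + 2 * (int m + 1)"
          by (simp add: algebra_simps)
        moreover have "(int m + 1) * (c - 1 - int m) \<ge> c - 1"
        proof -
          have "(int m + 1) * (c - 1 - int m) - (c - 1) = int m * (c - 2 - int m)" by (simp add: algebra_simps)
          also have "\<dots> \<ge> 0" using a by simp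
          finally show ?thesis by simp
        qed
        then have "c * ((int m + 1) * (c - 1 - int m)) \<ge> c * (c - 1)"
          using c3 by (intro mult_left_mono) auto
        moreover have "c * (c - 1) \<ge> c * 2" using c3 by (intro mult_left_mono) auto
        ultimately show ?thesis by simp
      qed
      ultimately show ?thesis by linarith
    next
      case False
      obtain x K where x: "x \<in> T" and K: "K \<subseteq> T - {x}" "K \<noteq> {}" and rest: "T - insert x K \<noteq> {}"
        and no: "\<And>u v. u \<in> K \<Longrightarrow> v \<in> T - insert x K \<Longrightarrow> \<not> adj u v"
        and tc: "two_connected (insert x K)" and cTK: "is_connected (T - K)"
        using leaf_block[OF finT is_connected False] by metis
      have finK: "finite K" using K(1) finT by (metis finite_Diff finite_subset)
      have BT: "insert x K \<subseteq> T" using x K by blast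
      have xK: "x \<notin> K" using K by blast
      obtain m where m: "\<And>u. u \<in> insert x K \<Longrightarrow> deg (insert x K) u = m" "m + 1 \<le> card (insert x K)"
          "3 \<le> m \<Longrightarrow> is_clique (insert x K) \<and> card (insert x K) = m + 1"
        using block_regular[OF D(2) _ _ tc, of x] BT less.prems(1) finK by (metis finite_insert insertI1 order_trans)
      have mK: "m \<le> card K" using m(2) finK xK by simp
      have sl: "slack c T = slack c (T - K) + int (card K) * (c - int m) - int m"
        by (rule slack_leaf_block[OF finT x K(1) no m(1)])
      have cd: "card T = card (T - K) + card K"
        using K finT by (metis Diff_empty card_Diff_subset card_mono finK le_add_diff_inverse2 subset_Diff_insert)
      have dx: "deg T x = deg (T - K) x + m" using leaf_block_degs(3)[OF finT x K(1) no] m(1) by simp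
      have "is_connected (T - K)" "x \<in> T - K" "T - K \<noteq> {x}" using cTK x xK rest by auto
      then have dp: "deg (T - K) x \<ge> 1" using connected_deg_pos finT by blast
      have "deg T x \<le> k - 1" using less.prems(3) x by blast
      then have mk: "int m \<le> c - 1" using dx dp k unfolding c_def by simp
      show ?thesis
      proof (cases "int m = c - 1")
        case False
        have "c * slack c (T - K) \<ge> (c - 2) * int (card (T - K)) + 2 * c"
          by (rule IH) (use K x xK in auto)
        moreover have "int (card K) * (c * (c - int m) - (c - 2)) \<ge> c * int m"
        proof -
          have a: "c - int m \<ge> 2" using mk False by simp
          have "c * (c - int m) \<ge> c * 2" by (rule mult_left_mono) (use a c3 in auto)
          then have "c * (c - int m) - (c - 2) \<ge> c" by simp
          then have "int (card K) * (c * (c - int m) - (c - 2)) \<ge> int (card K) * c"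
            by (intro mult_left_mono) auto
          moreover have "int (card K) * c \<ge> int m * c" using mK c3 by (intro mult_right_mono) auto
          ultimately show ?thesis by (simp add: algebra_simps)
        qed
        ultimately show ?thesis unfolding sl cd by (simp add: algebra_simps)
      next
        case True
        have "deg (T - K) x = 1" using dx dp \<open>deg T x \<le> k - 1\<close> True k unfolding c_def by simp
        then obtain z where z: "{u \<in> T - K. adj x u} = {z}" unfolding deg_def by (auto simp: card_1_singleton_iff)
        let ?T = "T - K - {x}"
        have zz: "z \<in> T - K" "adj x z" "\<And>u. u \<in> T - K \<Longrightarrow> adj x u \<Longrightarrow> u = z" using z by auto
        have sl': "slack c (T - K) = slack c ?T + c - 2"
          by (rule slack_remove_pendant[OF _ \<open>x \<in> T - K\<close> zz(1,3,2)]) (use finT in auto)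
        have "c * slack c ?T \<ge> (c - 2) * int (card ?T) + 2 * c"
          by (rule IH) (use x rest in auto)
        moreover have "card (T - K) = card ?T + 1"
          using \<open>x \<in> T - K\<close> finT by (metis Suc_eq_plus1 card.remove finite_Diff)
        moreover have "int (card K) \<ge> c - 1" using mK True by simp
        ultimately show ?thesis unfolding sl sl' cd True by (simp add: algebra_simps)
      qed
    qed
  qed
  then show ?case unfolding c_def by (simp add: algebra_simps)
qed

text \<open>In a tree of blocks these are the vertices that lie in one block only, when this block is a clique
  on at least \<open>3 * k / 4\<close> vertices. Two such blocks cannot meet in a vertex of degree below \<open>k\<close>, and
  their size is at least three times the number \<open>k - card S\<close> of edges by which a vertex of a
  clique \<open>S\<close> falls short of being in a clique on \<open>k\<close> vertices.\<close>

definition simplicial :: "nat \<Rightarrow> 'v set \<Rightarrow> 'v set" where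
  "simplicial k T = {v \<in> T. is_clique (insert v {u \<in> T. adj v u}) \<and> 3 * k \<le> 4 * (deg T v + 1)}"

lemma simplicial_cong:
  "v \<in> T \<Longrightarrow> v \<in> S \<Longrightarrow> {u \<in> T. adj v u} = {u \<in> S. adj v u} \<Longrightarrow> v \<in> simplicial k T \<longleftrightarrow> v \<in> simplicial k S"
  unfolding simplicial_def using deg_cong[of T v S] by simp

text \<open>A leaf block that is not a large clique contributes much slack, enough to pay for its own
  vertices and for the status that its cut vertex may lose. A leaf block that is a large clique
  contributes only simplicial vertices, and the vertex \<open>x\<close> where it is attached has too little
  degree left to be simplicial in the rest.\<close>

lemma simplicial_many:
  assumes D: "finite D" "hereditarily_regular D" and k: "16 \<le> k"
    and nok: "\<And>S. S \<subseteq> D \<Longrightarrow> is_clique S \<Longrightarrow> card S \<noteq> k"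
  shows "T \<subseteq> D \<Longrightarrow> (\<And>v. v \<in> T \<Longrightarrow> deg T v \<le> k - 1) \<Longrightarrow>
    6 * slack (int k - 1) T + int k * int (card (simplicial k T)) \<ge> int k * int (card T)"
proof (induction "card T" arbitrary: T rule: less_induct)
  case less
  define c where "c = int k - 1"
  have finT: "finite T" using less.prems(1) D(1) finite_subset by blast
  have sfin: "finite (simplicial k S)" if "finite S" for S using that unfolding simplicial_def by simp
  have IH: "6 * slack c S + int k * int (card (simplicial k S)) \<ge> int k * int (card S)" if S: "S \<subset> T" for S
  proof -
    have "deg S v \<le> k - 1" if "v \<in> S" for v
      using deg_mono[OF finT, of S v] less.prems(2)[of v] S that by (meson le_trans psubsetD psubset_imp_subset)
    moreover have "card S < card T" using S finT by (simp add: psubset_card_mono)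
    ultimately show ?thesis using less.hyps[of S] S less.prems(1) unfolding c_def by simp
  qed
  have goal: "6 * slack c T + int k * int (card (simplicial k T)) \<ge> int k * int (card T)"
  proof (cases "is_connected T")
    case False
    then obtain A where A: "A \<subseteq> T" "A \<noteq> {}" "A \<noteq> T" "\<And>u v. u \<in> A \<Longrightarrow> v \<in> T - A \<Longrightarrow> \<not> adj u v"
      unfolding is_connected_def by blast
    have "card T = card A + card (T - A)"
      using A finT by (metis card_Diff_subset card_mono finite_subset le_add_diff_inverse)
    moreover have "slack c T = slack c A + slack c (T - A)"
      by (rule slack_disconnected) (use A finT in auto)
    moreover have "simplicial k T = simplicial k A \<union> simplicial k (T - A)"
    proof -
      have "v \<in> simplicial k T \<longleftrightarrow> v \<in> simplicial k A" if "v \<in> A" for v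
        by (rule simplicial_cong) (use A that in blast)+
      moreover have "v \<in> simplicial k T \<longleftrightarrow> v \<in> simplicial k (T - A)" if "v \<in> T - A" for v
        by (rule simplicial_cong) (use A that adj_sym in blast)+
      moreover have "simplicial k S \<subseteq> S" for S unfolding simplicial_def by auto
      ultimately show ?thesis using A(1) by blast
    qed
    moreover have "simplicial k A \<inter> simplicial k (T - A) = {}" unfolding simplicial_def by auto
    ultimately have "card (simplicial k T) = card (simplicial k A) + card (simplicial k (T - A))"
      using sfin finT A by (metis card_Un_disjoint finite_Diff finite_subset)
    moreover have "6 * slack c A + int k * int (card (simplicial k A)) \<ge> int k * int (card A)" by (rule IH) (use A in auto)
    moreover have "6 * slack c (T - A) + int k * int (card (simplicial k (T - A))) \<ge> int k * int (card (T - A))"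
      by (rule IH) (use A in auto)
    ultimately show ?thesis using \<open>card T = _\<close> \<open>slack c T = _\<close> by (simp add: algebra_simps)
  next
    case is_connected: True
    show ?thesis
    proof (cases "two_connected T")
      case True
      show ?thesis
      proof (cases "T = {}")
        case False
        then obtain x where x: "x \<in> T" by blast
        obtain m where m: "\<And>u. u \<in> T \<Longrightarrow> deg T u = m" "m + 1 \<le> card T"
            "3 \<le> m \<Longrightarrow> is_clique T \<and> card T = m + 1"
          using block_regular[OF D(2) less.prems(1) finT True x] by blast
        have "m \<le> k - 1" using m(1) less.prems(2) x by force
        then have mk: "int m \<le> c" using k unfolding c_def by simp
        have sl: "slack c T = int (card T) * (c - int m)" unfolding slack_def using m(1) by simp
        show ?thesis
        proof (cases "3 * k \<le> 4 * (m + 1)")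
          case True
          then have cl: "is_clique T" using m(3) k by auto
          have "simplicial k T = T" unfolding simplicial_def
            using True m(1) cl by (auto intro: clique_subset)
          then show ?thesis using sl mk by simp
        next
          case False
          have "6 * slack c T = int (card T) * (6 * (c - int m))" using sl by simp
          also have "\<dots> \<ge> int (card T) * int k"
            by (rule mult_left_mono) (use False in \<open>auto simp: c_def\<close>)
          finally have "6 * slack c T \<ge> int k * int (card T)" by (simp add: mult.commute)
          moreover have "int k * int (card (simplicial k T)) \<ge> 0" by simp
          ultimately show ?thesis by linarith
        qed
      qed (simp add: slack_def)
    next
      case False
      obtain x K where x: "x \<in> T" and K: "K \<subseteq> T - {x}" "K \<noteq> {}" and rest: "T - insert x K \<noteq> {}"
        and no: "\<And>u v. u \<in> K \<Longrightarrow> v \<in> T - insert x K \<Longrightarrow> \<not> adj u v"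
        and tc: "two_connected (insert x K)" and cTK: "is_connected (T - K)"
        using leaf_block[OF finT is_connected False] by metis
      have finK: "finite K" using K(1) finT by (metis finite_Diff finite_subset)
      have BT: "insert x K \<subseteq> T" using x K by blast
      have xK: "x \<notin> K" using K by blast
      obtain m where m: "\<And>u. u \<in> insert x K \<Longrightarrow> deg (insert x K) u = m" "m + 1 \<le> card (insert x K)"
          "3 \<le> m \<Longrightarrow> is_clique (insert x K) \<and> card (insert x K) = m + 1"
        using block_regular[OF D(2) _ _ tc, of x] BT less.prems(1) finK by (metis finite_insert insertI1 order_trans)
      have mK: "m \<le> card K" using m(2) finK xK by simp
      have sl: "slack c T = slack c (T - K) + int (card K) * (c - int m) - int m"
        by (rule slack_leaf_block[OF finT x K(1) no m(1)])
      have cd: "card T = card (T - K) + card K"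
        using K finT by (metis Diff_empty card_Diff_subset card_mono finK le_add_diff_inverse2 subset_Diff_insert)
      have dx: "deg T x = deg (T - K) x + m" using leaf_block_degs(3)[OF finT x K(1) no] m(1) by simp
      have "is_connected (T - K)" "x \<in> T - K" "T - K \<noteq> {x}" using cTK x xK rest by auto
      then have dp: "deg (T - K) x \<ge> 1" using connected_deg_pos finT by blast
      have dTx: "deg T x \<le> k - 1" using less.prems(2) x by blast
      then have mk: "int m \<le> c - 1" using dx dp k unfolding c_def by simp
      have m1: "1 \<le> m"
        using connected_deg_pos[of "insert x K" x] tc finK K xK m(1)[of x] by (auto simp: two_connected_def)
      have IHK: "6 * slack c (T - K) + int k * int (card (simplicial k (T - K))) \<ge> int k * int (card (T - K))"
        by (rule IH) (use K x in auto)
      have same: "v \<in> simplicial k T \<longleftrightarrow> v \<in> simplicial k (T - K)" if "v \<in> T - insert x K" for v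
        by (rule simplicial_cong) (use that leaf_block_degs(2)[OF finT x K(1) no that] in auto)
      show ?thesis
      proof (cases "3 * k \<le> 4 * (m + 1)")
        case True
        have cl: "is_clique (insert x K)" and cK: "card K = m" using m(3) True k finK xK by auto
        have "K \<subseteq> simplicial k T"
        proof
          fix v assume v: "v \<in> K"
          note e = leaf_block_degs(1)[OF finT x K(1) no v]
          have "insert v {u \<in> T. adj v u} \<subseteq> insert x K" using e v by auto
          then have "is_clique (insert v {u \<in> T. adj v u})" using cl clique_subset by blast
          moreover have "deg T v = m" using deg_cong[OF e] m(1) v by simp
          ultimately show "v \<in> simplicial k T" unfolding simplicial_def using v K(1) True by auto
        qed
        moreover have "x \<notin> simplicial k (T - K)"
          unfolding simplicial_def using dTx dx True k by auto
        then have "simplicial k (T - K) \<subseteq> simplicial k T"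
          using same unfolding simplicial_def by blast
        ultimately have "card (simplicial k (T - K) \<union> K) \<le> card (simplicial k T)"
          by (intro card_mono) (use sfin finT in auto)
        moreover have "card (simplicial k (T - K) \<union> K) = card (simplicial k (T - K)) + card K"
          by (rule card_Un_disjoint) (use sfin finT finK in \<open>auto simp: simplicial_def\<close>)
        ultimately have "int k * int (card (simplicial k T)) \<ge> int k * (int (card (simplicial k (T - K))) + int (card K))"
          by (intro mult_left_mono) auto
        moreover have "int (card K) * (c - int m) \<ge> int m" unfolding cK
          using mk mult_left_mono[of 1 "c - int m" "int m"] by simp
        ultimately show ?thesis using IHK unfolding sl cd by (simp add: algebra_simps)
      next
        case False
        have "simplicial k (T - K) \<subseteq> insert x (simplicial k T)"
          using same unfolding simplicial_def by blast
        then have "card (simplicial k (T - K)) \<le> card (insert x (simplicial k T))"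
          by (intro card_mono) (use sfin finT in auto)
        also have "\<dots> \<le> card (simplicial k T) + 1" using card_insert_le_m1 by (simp add: card_insert_if sfin finT)
        finally have "int k * int (card (simplicial k (T - K))) \<le> int k * (int (card (simplicial k T)) + 1)"
          by (intro mult_left_mono) auto
        moreover have "6 * (int (card K) * (c - int m)) - 6 * int m \<ge> int k * int (card K) + int k"
        proof -
          define M where "M = int m"
          have M1: "M \<ge> 1" and Mk: "4 * (M + 1) \<le> 3 * int k - 1" using m1 False unfolding M_def by auto
          have k16: "int k \<ge> 16" using k by simp
          have pos: "6 * (c - M) - int k \<ge> 0" using Mk k16 unfolding c_def by simp
          have "int (card K) * (6 * (c - M) - int k) \<ge> M * (6 * (c - M) - int k)"
            by (rule mult_right_mono) (use mK pos in \<open>auto simp: M_def\<close>)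
          moreover have "M * (6 * (c - M) - int k) \<ge> 6 * M + int k"
          proof -
            \<comment> \<open>The difference is concave in \<open>M\<close> and nonnegative at both ends of the range of \<open>M\<close>.\<close>
            have "M * (6 * (c - M) - int k) - (6 * M + int k)
                = M * (5 * int k - 12 - 6 * M) - int k"
              unfolding c_def by (simp add: algebra_simps)
            moreover have "2 * (M * (5 * int k - 12 - 6 * M) - int k)
                = 3 * ((M - 1) * (3 * int k - 4 - 4 * M)) + (M - 1) * (int k - 24) + 8 * int k - 36"
              by (simp add: algebra_simps)
            moreover have "(M - 1) * (3 * int k - 4 - 4 * M) \<ge> 0" using M1 Mk by simp
            moreover have "(M - 1) * (int k - 24) + 8 * int k - 36 \<ge> 0"
            proof -
              have "(M - 1) * (int k - 24) \<ge> (M - 1) * (-8)" using k16 M1 by (intro mult_left_mono) auto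
              then show ?thesis using Mk k16 by simp
            qed
            ultimately show ?thesis by simp
          qed
          ultimately show ?thesis unfolding M_def by (simp add: algebra_simps)
        qed
        ultimately show ?thesis using IHK unfolding sl cd by (simp add: algebra_simps)
      qed
    qed
  qed
  then show ?case unfolding c_def .
qed

end

section \<open>Partial colorings from correspondence covers\<close>

text \<open>The cover is described by the conflicts between a color \<open>x\<close> at \<open>u\<close> and a color \<open>y\<close> at \<open>v\<close>; such
  colors are called partners below, and a colored vertex kills the partners of its color. A color
  conflicts with at most one color of each other vertex because over each edge of a simple graph the
  cover is a single matching.\<close>

locale cover = sgraph adj
  for adj :: "'v \<Rightarrow> 'v \<Rightarrow> bool" +
  fixes V :: "'v set" and L :: "'v \<Rightarrow> 'w set" and conf :: "'v \<Rightarrow> 'w \<Rightarrow> 'v \<Rightarrow> 'w \<Rightarrow> bool" and c :: nat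
  assumes finV: "finite V"
    and list_finite: "v \<in> V \<Longrightarrow> finite (L v)"
    and list_size: "v \<in> V \<Longrightarrow> card (L v) = c"
    and conf_sym: "conf u x v y \<Longrightarrow> conf v y u x"
    and conf_adj: "conf u x v y \<Longrightarrow> adj u v"
    and conf_unique: "conf u x v y \<Longrightarrow> conf u x v y' \<Longrightarrow> y = y'"
begin

definition coloring :: "'v set \<Rightarrow> ('v \<Rightarrow> 'w) \<Rightarrow> bool" where
  "coloring P \<phi> \<longleftrightarrow> (\<forall>v\<in>P. \<phi> v \<in> L v) \<and> (\<forall>u\<in>P. \<forall>v\<in>P. \<not> conf u (\<phi> u) v (\<phi> v))"

definition available :: "'v set \<Rightarrow> ('v \<Rightarrow> 'w) \<Rightarrow> 'v \<Rightarrow> 'w set" where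
  "available P \<phi> v = {x \<in> L v. \<forall>u\<in>P. \<not> conf v x u (\<phi> u)}"

lemma coloring_subset: "coloring P \<phi> \<Longrightarrow> Q \<subseteq> P \<Longrightarrow> coloring Q \<phi>"
  unfolding coloring_def by blast

lemma available_finite: "v \<in> V \<Longrightarrow> finite (available P \<phi> v)"
  unfolding available_def using list_finite by simp

lemma available_insert: "b \<notin> P \<Longrightarrow> available (insert b P) (\<phi>(b := x)) v = {y \<in> available P \<phi> v. \<not> conf v y b x}"
  unfolding available_def by auto

lemma available_cong:
  assumes "\<And>u. adj v u \<Longrightarrow> (u \<in> P \<longleftrightarrow> u \<in> Q) \<and> \<phi> u = \<psi> u"
  shows "available P \<phi> v = available Q \<psi> v"
  unfolding available_def using assms conf_adj by (metis (mono_tags, lifting))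

lemma killed_at_most_one: "finite {y. conf v y b x \<and> Q y}" "card {y. conf v y b x \<and> Q y} \<le> 1"
proof -
  have "\<exists>z. {y. conf v y b x \<and> Q y} \<subseteq> {z}" using conf_unique conf_sym by blast
  then show "finite {y. conf v y b x \<and> Q y}" "card {y. conf v y b x \<and> Q y} \<le> 1"
    by (metis finite.emptyI finite_insert finite_subset,
        metis card.empty card_insert_le_m1 card_mono finite.emptyI finite_insert is_singletonI is_singleton_altdef)
qed

lemma available_card_insert:
  assumes "v \<in> V" "b \<notin> P"
  shows "card (available P \<phi> v) \<le> card (available (insert b P) (\<phi>(b := x)) v) + (if adj v b then 1 else 0)"
proof (cases "adj v b")
  case False
  then have "available (insert b P) (\<phi>(b := x)) v = available P \<phi> v" using available_insert[OF assms(2)] conf_adj by auto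
  then show ?thesis by simp
next
  case True
  have "available P \<phi> v \<subseteq> available (insert b P) (\<phi>(b := x)) v \<union> {y. conf v y b x \<and> True}"
    using available_insert[OF assms(2)] by auto
  then have "card (available P \<phi> v) \<le> card (available (insert b P) (\<phi>(b := x)) v \<union> {y. conf v y b x \<and> True})"
    by (rule card_mono[rotated]) (simp add: available_finite assms killed_at_most_one(1)[where Q = "\<lambda>_. True", simplified])
  also have "\<dots> \<le> card (available (insert b P) (\<phi>(b := x)) v) + card {y. conf v y b x \<and> True}" by (rule card_Un_le)
  also have "\<dots> \<le> card (available (insert b P) (\<phi>(b := x)) v) + 1" using killed_at_most_one(2) by (intro add_left_mono)
  finally show ?thesis using True by simp
qed

lemma available_lower:
  assumes "v \<in> V" "P \<subseteq> V"
  shows "c \<le> card (available P \<phi> v) + deg P v"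
proof -
  have fP: "finite P" using assms finV finite_subset by blast
  let ?N = "{u \<in> P. adj v u}"
  have "L v \<subseteq> available P \<phi> v \<union> (\<Union>u\<in>?N. {y. conf v y u (\<phi> u) \<and> True})"
    unfolding available_def using conf_adj by auto
  then have "card (L v) \<le> card (available P \<phi> v \<union> (\<Union>u\<in>?N. {y. conf v y u (\<phi> u) \<and> True}))"
    by (rule card_mono[rotated]) (use available_finite assms fP killed_at_most_one(1)[where Q = "\<lambda>_. True"] in simp)
  also have "\<dots> \<le> card (available P \<phi> v) + card (\<Union>u\<in>?N. {y. conf v y u (\<phi> u) \<and> True})" by (rule card_Un_le)
  also have "card (\<Union>u\<in>?N. {y. conf v y u (\<phi> u) \<and> True}) \<le> (\<Sum>u\<in>?N. card {y. conf v y u (\<phi> u) \<and> True})"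
    by (rule card_UN_le) (use fP in simp)
  also have "\<dots> \<le> (\<Sum>u\<in>?N. 1)" by (rule sum_mono) (rule killed_at_most_one(2))
  also have "\<dots> = deg P v" unfolding deg_def by simp
  finally show ?thesis using list_size assms by simp
qed

lemma coloring_insert: "coloring P \<phi> \<Longrightarrow> b \<notin> P \<Longrightarrow> x \<in> available P \<phi> b \<Longrightarrow> coloring (insert b P) (\<phi>(b := x))"
  unfolding coloring_def available_def by (auto dest: conf_sym conf_adj simp: adj_irrefl)

text \<open>Color \<open>S\<close> in an order in which each vertex other than \<open>v0\<close> still has an uncolored neighbor when
  its turn comes: it has a color left as its list was at least as long as its degree. The
  spare color is kept for \<open>v0\<close>.\<close>

lemma extend_surplus:
  assumes "finite S" "S \<subseteq> V" "S \<inter> P = {}" "is_connected S" "coloring P \<phi>"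
    and "\<And>v. v \<in> S \<Longrightarrow> deg S v \<le> card (available P \<phi> v)"
    and "v0 \<in> S" "deg S v0 < card (available P \<phi> v0)"
  shows "\<exists>\<psi>. coloring (P \<union> S) \<psi> \<and> (\<forall>u. u \<notin> S \<longrightarrow> \<psi> u = \<phi> u)"
  using assms
proof (induction "card S" arbitrary: S P \<phi> rule: less_induct)
  case less
  show ?case
  proof (cases "S = {v0}")
    case True
    then have "available P \<phi> v0 \<noteq> {}" using less.prems(8) by auto
    then obtain x where "x \<in> available P \<phi> v0" by blast
    then have "coloring (insert v0 P) (\<phi>(v0 := x))"
      by (rule coloring_insert[OF less.prems(5), rotated]) (use less.prems(3,7) in blast)
    then show ?thesis using True by (intro exI[of _ "\<phi>(v0 := x)"]) simp
  next
    case False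
    then obtain v where v: "v \<in> S" "v \<noteq> v0" "is_connected (S - {v})"
      using connected_noncut_vertex[OF less.prems(1,4,7)] by metis
    have "S \<noteq> {v}" using v(2) less.prems(7) by blast
    then have "deg S v \<ge> 1" by (rule connected_deg_pos[OF less.prems(1,4) v(1)])
    then have "available P \<phi> v \<noteq> {}" using less.prems(6)[OF v(1)] by auto
    then obtain x where x: "x \<in> available P \<phi> v" by blast
    have vP: "v \<notin> P" using v(1) less.prems(3) by blast
    let ?S = "S - {v}" and ?P = "insert v P" and ?\<phi> = "\<phi>(v := x)"
    have d: "deg ?S u + card (available P \<phi> u) \<le> card (available ?P ?\<phi> u) + deg S u" if "u \<in> S" for u
      using available_card_insert[OF _ vP, of u \<phi> x] deg_remove[OF less.prems(1) v(1), of u] that less.prems(2)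
      by (auto split: if_splits)
    have "\<exists>\<psi>. coloring (?P \<union> ?S) \<psi> \<and> (\<forall>u. u \<notin> ?S \<longrightarrow> \<psi> u = ?\<phi> u)"
    proof (rule less.hyps)
      show "card ?S < card S" using less.prems(1) v(1) by (rule card_Diff1_less)
      show "coloring ?P ?\<phi>" by (rule coloring_insert[OF less.prems(5) vP x])
      show "deg ?S u \<le> card (available ?P ?\<phi> u)" if "u \<in> ?S" for u
        using d[of u] less.prems(6)[of u] that by simp
      show "deg ?S v0 < card (available ?P ?\<phi> v0)" using d[of v0] less.prems(7,8) by simp
    qed (use less.prems(1,2,3,7) v in auto)
    moreover have "?P \<union> ?S = P \<union> S" using v(1) by blast
    ultimately show ?thesis using v(1) by auto
  qed
qed

text \<open>Giving \<open>t\<close> the color \<open>x\<close> takes no color away from its neighbor \<open>t'\<close>, so \<open>t'\<close> gains a spare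
  color in \<open>S - {t}\<close>.\<close>

lemma extend_mismatch:
  assumes "finite S" "S \<subseteq> V" "S \<inter> P = {}" "is_connected (S - {t})" "coloring P \<phi>"
    and d: "\<And>v. v \<in> S \<Longrightarrow> deg S v \<le> card (available P \<phi> v)"
    and t: "t \<in> S" "t' \<in> S" "adj t t'" "x \<in> available P \<phi> t" "\<And>y. y \<in> available P \<phi> t' \<Longrightarrow> \<not> conf t x t' y"
  shows "\<exists>\<psi>. coloring (P \<union> S) \<psi> \<and> (\<forall>u. u \<notin> S \<longrightarrow> \<psi> u = \<phi> u)"
proof -
  have tP: "t \<notin> P" using t assms(3) by blast
  let ?S = "S - {t}" and ?P = "insert t P" and ?\<phi> = "\<phi>(t := x)"
  have e: "deg ?S u + card (available P \<phi> u) \<le> card (available ?P ?\<phi> u) + deg S u" if "u \<in> S" for u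
    using available_card_insert[OF _ tP, of u \<phi> x] deg_remove[OF assms(1) t(1), of u] that assms(2)
    by (auto split: if_splits)
  have "\<exists>\<psi>. coloring (?P \<union> ?S) \<psi> \<and> (\<forall>u. u \<notin> ?S \<longrightarrow> \<psi> u = ?\<phi> u)"
  proof (rule extend_surplus)
    show "coloring ?P ?\<phi>" by (rule coloring_insert[OF assms(5) tP t(4)])
    show "deg ?S u \<le> card (available ?P ?\<phi> u)" if "u \<in> ?S" for u using e[of u] d[of u] that by simp
    show "t' \<in> ?S" using t adj_irrefl by blast
    have "available ?P ?\<phi> t' = available P \<phi> t'" using available_insert[OF tP] t(5) conf_sym by blast
    then show "deg ?S t' < card (available ?P ?\<phi> t')"
      using deg_remove[OF assms(1) t(1), of t'] d[OF t(2)] t(3) adj_sym by simp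
  qed (use assms(1,2,3,4) in auto)
  moreover have "?P \<union> ?S = P \<union> S" using t(1) by blast
  ultimately show ?thesis using t(1) by auto
qed

definition mismatch :: "'v set \<Rightarrow> ('v \<Rightarrow> 'w) \<Rightarrow> 'v \<Rightarrow> 'v \<Rightarrow> bool" where
  "mismatch P \<phi> t t' \<longleftrightarrow> (\<exists>x\<in>available P \<phi> t. \<forall>y\<in>available P \<phi> t'. \<not> conf t x t' y)"

definition surplus :: "'v set \<Rightarrow> ('v \<Rightarrow> 'w) \<Rightarrow> 'v \<Rightarrow> bool" where
  "surplus P \<phi> t \<longleftrightarrow> deg (V - P) t < card (available P \<phi> t)"

text \<open>What has to be known about two vertices of a clique of low vertices to be sure that the clique can
  be colored last (\<open>alive_extend\<close>). Either form of the property can be kept while further vertices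
  are colored.\<close>

definition alive :: "'v set \<Rightarrow> ('v \<Rightarrow> 'w) \<Rightarrow> 'v \<Rightarrow> 'v \<Rightarrow> bool" where
  "alive P \<phi> t t' \<longleftrightarrow> surplus P \<phi> t \<or> surplus P \<phi> t' \<or> mismatch P \<phi> t t' \<or> mismatch P \<phi> t' t"

lemma surplus_keep:
  assumes "surplus P \<phi> t" "t \<in> V" "b \<in> V" "b \<notin> P"
  shows "surplus (insert b P) (\<phi>(b := x)) t"
proof -
  have "deg (V - P) t = deg (V - P - {b}) t + (if adj t b then 1 else 0)"
    by (rule deg_remove) (use assms finV in auto)
  moreover have "V - P - {b} = V - insert b P" by blast
  ultimately show ?thesis using available_card_insert[OF assms(2,4), of \<phi> x] assms(1) unfolding surplus_def by simp
qed

lemma mismatch_keep: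
  assumes "mismatch P \<phi> t t'" "b \<notin> P"
  shows "\<exists>F. finite F \<and> card F \<le> 1 \<and> (\<not> adj t b \<longrightarrow> F = {}) \<and>
    (\<forall>x. x \<notin> F \<longrightarrow> mismatch (insert b P) (\<phi>(b := x)) t t')"
proof -
  obtain y where y: "y \<in> available P \<phi> t" "\<And>z. z \<in> available P \<phi> t' \<Longrightarrow> \<not> conf t y t' z"
    using assms(1) unfolding mismatch_def by blast
  let ?F = "{x. conf b x t y \<and> True}"
  have "mismatch (insert b P) (\<phi>(b := x)) t t'" if "x \<notin> ?F" for x
    unfolding mismatch_def using y that conf_sym by (intro bexI[of _ y]) (auto simp: available_insert[OF assms(2)])
  moreover have "\<not> adj t b \<longrightarrow> ?F = {}" using conf_adj adj_sym by blast
  ultimately show ?thesis using killed_at_most_one[of b t y "\<lambda>_. True"] by blast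
qed

text \<open>A mismatch is lost only if its witness is killed, and a neighbor \<open>b\<close> has at most one color that
  kills it. A surplus cannot be lost.\<close>

lemma alive_keep:
  assumes "alive P \<phi> t t'" "t \<in> V" "t' \<in> V" "b \<in> V" "b \<notin> P"
  shows "\<exists>F. finite F \<and> card F \<le> 1 \<and> (\<not> adj t b \<and> \<not> adj t' b \<longrightarrow> F = {}) \<and>
    (\<forall>x. x \<notin> F \<longrightarrow> alive (insert b P) (\<phi>(b := x)) t t')"
proof -
  consider "surplus P \<phi> t \<or> surplus P \<phi> t'" | "mismatch P \<phi> t t'" | "mismatch P \<phi> t' t"
    using assms(1) unfolding alive_def by blast
  then show ?thesis
  proof cases
    case 1
    then have "\<forall>x. alive (insert b P) (\<phi>(b := x)) t t'"
      using surplus_keep assms unfolding alive_def by blast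
    then show ?thesis by (intro exI[of _ "{}"]) simp
  next
    case 2 then show ?thesis using mismatch_keep[OF 2 assms(5)] unfolding alive_def by blast
  next
    case 3 then show ?thesis using mismatch_keep[OF 3 assms(5)] unfolding alive_def by blast
  qed
qed

text \<open>Suppose that all colors of \<open>t\<close> have partners among the colors of \<open>t'\<close>. If the color of \<open>b\<close> kills a
  color of \<open>t\<close>, the partner of the killed color becomes a mismatch, because \<open>b\<close> kills nothing at
  \<open>t'\<close>. If it kills nothing, \<open>t\<close> loses an uncolored neighbor but no color and has a surplus. If,
  on the other hand, there is a mismatch already, one color of \<open>b\<close> is forbidden in order to keep it.\<close>

lemma alive_create:
  assumes "P \<subseteq> V" "t \<in> V" "b \<in> V" "b \<notin> P" "adj t b" "\<not> adj t' b" "deg V t = c"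
  shows "\<exists>F. finite F \<and> card F \<le> 1 \<and> (\<forall>x. x \<notin> F \<longrightarrow> alive (insert b P) (\<phi>(b := x)) t t')"
proof (cases "mismatch P \<phi> t t'")
  case True
  then show ?thesis using mismatch_keep[OF True assms(4)] unfolding alive_def by blast
next
  case False
  have "alive (insert b P) (\<phi>(b := x)) t t'" for x
  proof (cases "\<exists>y\<in>available P \<phi> t. conf t y b x")
    case True
    then obtain y where y: "y \<in> available P \<phi> t" "conf t y b x" by blast
    obtain z where z: "z \<in> available P \<phi> t'" "conf t y t' z" using False y unfolding mismatch_def by blast
    have "z \<in> available (insert b P) (\<phi>(b := x)) t'"
      using z(1) assms(6) conf_adj by (auto simp: available_insert[OF assms(4)])
    moreover have "\<not> conf t' z t y'" if "y' \<in> available (insert b P) (\<phi>(b := x)) t" for y'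
      using that y(2) conf_unique[OF conf_sym[OF z(2)]] by (auto simp: available_insert[OF assms(4)])
    ultimately show ?thesis unfolding alive_def mismatch_def by blast
  next
    case none: False
    then have "available (insert b P) (\<phi>(b := x)) t = available P \<phi> t" by (auto simp: available_insert[OF assms(4)])
    moreover have "deg (V - P) t = deg (V - P - {b}) t + (if adj t b then 1 else 0)"
      by (rule deg_remove) (use assms finV in auto)
    moreover have "V - P - {b} = V - insert b P" by blast
    moreover have "deg (P \<union> (V - P)) t = deg P t + deg (V - P) t"
      by (rule deg_union) (use assms finV finite_subset in auto)
    moreover have "P \<union> (V - P) = V" using assms(1) by blast
    moreover have "c \<le> card (available P \<phi> t) + deg P t" by (rule available_lower[OF assms(2,1)])
    ultimately have "surplus (insert b P) (\<phi>(b := x)) t" using assms(5,7) unfolding surplus_def by simp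
    then show ?thesis unfolding alive_def by blast
  qed
  then show ?thesis by (intro exI[of _ "{}"]) simp
qed

lemma low_available:
  assumes "P \<subseteq> V" "t \<in> V" "deg V t = c"
  shows "deg (V - P) t \<le> card (available P \<phi> t)"
proof -
  have "deg (P \<union> (V - P)) t = deg P t + deg (V - P) t"
    by (rule deg_union) (use assms finV finite_subset in auto)
  moreover have "P \<union> (V - P) = V" using assms(1) by blast
  ultimately show ?thesis using available_lower[OF assms(2,1), of \<phi>] assms(3) by simp
qed

lemma alive_extend:
  assumes P: "P \<subseteq> V" "coloring P \<phi>" and W: "W \<subseteq> V" "W \<inter> P = {}" "is_clique W"
    and t: "t \<in> W" "t' \<in> W" "t \<noteq> t'" and low: "\<And>v. v \<in> W \<Longrightarrow> deg V v = c"
    and nb: "\<And>v u. v \<in> W \<Longrightarrow> u \<in> V \<Longrightarrow> adj v u \<Longrightarrow> u \<in> W \<or> u \<in> P"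
    and alive: "alive P \<phi> t t'"
  shows "\<exists>\<psi>. coloring (P \<union> W) \<psi> \<and> (\<forall>u. u \<notin> W \<longrightarrow> \<psi> u = \<phi> u)"
proof -
  have fW: "finite W" using W(1) finV finite_subset by blast
  have dW: "deg W v = deg (V - P) v" if "v \<in> W" for v
    by (rule deg_cong) (use nb[OF that] W in blast)
  have d: "deg W v \<le> card (available P \<phi> v)" if "v \<in> W" for v
    using low_available[OF P(1) _ low[OF that], of \<phi>] dW[OF that] W(1) that by auto
  have cl: "is_connected W" "is_connected (W - {u})" for u using W(3) clique_connected clique_subset by blast+
  have adj: "adj t t'" "adj t' t" using t W(3) by (auto simp: is_clique_def)
  consider v where "v \<in> W" "surplus P \<phi> v" | "mismatch P \<phi> t t'" | "mismatch P \<phi> t' t"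
    using alive t unfolding alive_def by blast
  then show ?thesis
  proof cases
    case 1
    then show ?thesis using extend_surplus[OF fW W(1,2) cl(1) P(2) d 1(1)] dW[OF 1(1)]
      unfolding surplus_def by simp
  next
    case 2
    then show ?thesis using extend_mismatch[OF fW W(1,2) cl(2) P(2) d t(1,2) adj(1)]
      unfolding mismatch_def by blast
  next
    case 3
    then show ?thesis using extend_mismatch[OF fW W(1,2) cl(2) P(2) d t(2,1) adj(2)]
      unfolding mismatch_def by blast
  qed
qed

end

section \<open>Low vertices of critical covers\<close>

locale critical_cover = cover adj V L conf c
  for adj :: "'v \<Rightarrow> 'v \<Rightarrow> bool" and V :: "'v set" and L :: "'v \<Rightarrow> 'w set"
    and conf :: "'v \<Rightarrow> 'w \<Rightarrow> 'v \<Rightarrow> 'w \<Rightarrow> bool" and c :: nat +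
  assumes not_colorable: "\<not> coloring V \<phi>"
    and colorable_minus: "v \<in> V \<Longrightarrow> \<exists>\<phi>. coloring (V - {v}) \<phi>"
begin

lemma colorable_proper:
  assumes "S \<subseteq> V" "S \<noteq> {}"
  shows "\<exists>\<phi>. coloring (V - S) \<phi>"
proof -
  obtain v where v: "v \<in> S" using assms by blast
  then obtain \<phi> where "coloring (V - {v}) \<phi>" using colorable_minus assms by blast
  then show ?thesis using coloring_subset[of _ _ "V - S"] v by blast
qed

lemma min_degree: "v \<in> V \<Longrightarrow> c \<le> deg V v"
proof (rule ccontr)
  assume v: "v \<in> V" and l: "\<not> c \<le> deg V v"
  obtain \<phi> where \<phi>: "coloring (V - {v}) \<phi>" using colorable_minus[OF v] by blast
  have "deg (V - {v}) v \<le> deg V v" by (rule deg_mono) (use finV in auto)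
  then have "0 < card (available (V - {v}) \<phi> v)" using available_lower[OF v, of "V - {v}" \<phi>] l by auto
  then obtain x where "x \<in> available (V - {v}) \<phi> v" by fastforce
  then have "coloring (insert v (V - {v})) (\<phi>(v := x))" using coloring_insert[OF \<phi>] by blast
  then show False using not_colorable v by (simp add: insert_absorb)
qed

definition low :: "'v set" where "low = {v \<in> V. deg V v = c}"

lemma low_subset: "low \<subseteq> V" unfolding low_def by blast

lemma low_deg: "v \<in> low \<Longrightarrow> deg V v = c" unfolding low_def by blast

text \<open>Color everything outside a two-connected set \<open>S\<close> of low vertices. If \<open>S\<close> cannot be colored, every
  list has exactly as many colors as the degree in \<open>S\<close>, and every color of \<open>t\<close> has a partner at
  each neighbor \<open>t'\<close>. Partners of different colors differ, so degrees cannot decrease along an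
  edge in either direction.\<close>

lemma low_hereditarily_regular: "hereditarily_regular low"
  unfolding hereditarily_regular_def
proof (intro allI impI ballI)
  fix S u v assume S: "S \<subseteq> low" "two_connected S" and u: "u \<in> S" and v: "v \<in> S"
  have SV: "S \<subseteq> V" using S(1) low_subset by blast
  then have fS: "finite S" by (rule finite_subset[OF _ finV])
  have cS: "is_connected S" "\<And>t. t \<in> S \<Longrightarrow> is_connected (S - {t})" using S unfolding two_connected_def by blast+
  obtain \<phi> where \<phi>: "coloring (V - S) \<phi>" using colorable_proper[OF SV] u by blast
  have VS: "V - S \<union> S = V" "S \<inter> (V - S) = {}" "V - (V - S) = S" using SV by blast+
  have d: "deg S t \<le> card (available (V - S) \<phi> t)" if "t \<in> S" for t
    using low_available[of "V - S" t \<phi>] VS low_deg that S(1) SV by auto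
  have eq: "card (available (V - S) \<phi> t) = deg S t" if t: "t \<in> S" for t
    using extend_surplus[OF fS SV VS(2) cS(1) \<phi> d t] d[OF t] VS(1) not_colorable by fastforce
  have le: "deg S t \<le> deg S t'" if t: "t \<in> S" "t' \<in> S" "adj t t'" for t t'
  proof -
    have "\<exists>y\<in>available (V - S) \<phi> t'. conf t x t' y" if "x \<in> available (V - S) \<phi> t" for x
      using extend_mismatch[OF fS SV VS(2) cS(2)[OF t(1)] \<phi> d t that] VS(1) not_colorable by auto
    then obtain f where f: "\<And>x. x \<in> available (V - S) \<phi> t \<Longrightarrow> f x \<in> available (V - S) \<phi> t' \<and> conf t x t' (f x)"
      by metis
    have "inj_on f (available (V - S) \<phi> t)" using f conf_sym conf_unique by (metis inj_onI)
    then have "card (available (V - S) \<phi> t) \<le> card (available (V - S) \<phi> t')"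
      by (rule card_inj_on_le) (use f available_finite t SV in auto)
    then show ?thesis using eq t by simp
  qed
  have "{w \<in> S. deg S w = deg S u} = S"
  proof (rule ccontr)
    assume ne: "{w \<in> S. deg S w = deg S u} \<noteq> S"
    then obtain a b where "a \<in> S" "deg S a = deg S u" "b \<in> S" "deg S b \<noteq> deg S u" "adj a b"
      using is_connectedD[OF cS(1), of "{w \<in> S. deg S w = deg S u}"] u by blast
    then show False using le[of a b] le[of b a] adj_sym by auto
  qed
  then show "deg S u = deg S v" using v by force
qed

text \<open>Otherwise \<open>b\<close> has at least two colors left when everything but \<open>b\<close> and \<open>W\<close> is colored, and one of
  them makes \<open>t\<close> and \<open>t'\<close> alive.\<close>

lemma partial_neighbor_excess:
  assumes W: "W \<subseteq> low" "is_clique W" and b: "b \<in> V" "b \<notin> W"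
    and t: "t \<in> W" "adj t b" "t' \<in> W" "\<not> adj t' b"
  shows "deg W b + c \<le> deg V b + 1"
proof (rule ccontr)
  assume neg: "\<not> deg W b + c \<le> deg V b + 1"
  let ?P = "V - insert b W"
  have WV: "W \<subseteq> V" using W low_subset by blast
  have fW: "finite W" by (rule finite_subset[OF WV finV])
  obtain \<phi> where \<phi>: "coloring ?P \<phi>" using colorable_proper[of "insert b W"] WV b by blast
  have "deg (?P \<union> insert b W) b = deg ?P b + deg (insert b W) b"
    by (rule deg_union) (use finV fW in auto)
  moreover have "?P \<union> insert b W = V" using WV b by blast
  ultimately have "deg V b = deg ?P b + deg (insert b W) b" by (simp only:)
  then have dVb: "deg V b = deg ?P b + deg W b" by (simp only: deg_insert_self)
  have "c \<le> card (available ?P \<phi> b) + deg ?P b" by (rule available_lower) (use b in auto)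
  then have a2: "2 \<le> card (available ?P \<phi> b)" using dVb neg by linarith
  obtain F where F: "finite F" "card F \<le> 1" "\<And>x. x \<notin> F \<Longrightarrow> alive (insert b ?P) (\<phi>(b := x)) t t'"
    using alive_create[of ?P t b t' \<phi>] t b WV low_deg W by blast
  have "\<not> available ?P \<phi> b \<subseteq> F" using card_mono[OF F(1), of "available ?P \<phi> b"] a2 F(2) by auto
  then obtain x where x: "x \<in> available ?P \<phi> b" "x \<notin> F" by blast
  have P': "insert b ?P = V - W" using b by blast
  have cc: "coloring (V - W) (\<phi>(b := x))" using coloring_insert[OF \<phi> _ x(1)] P' by simp
  have "\<exists>\<psi>. coloring (V - W \<union> W) \<psi> \<and> (\<forall>u. u \<notin> W \<longrightarrow> \<psi> u = (\<phi>(b := x)) u)"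
  proof (rule alive_extend[OF _ cc WV _ W(2) t(1,3)])
    show "t \<noteq> t'" using t by blast
    show "alive (V - W) (\<phi>(b := x)) t t'" using F(3)[OF x(2)] P' by simp
    show "deg V v = c" if "v \<in> W" for v using low_deg that W(1) by blast
  qed auto
  moreover have "V - W \<union> W = V" using WV by blast
  ultimately show False using not_colorable by auto
qed

text \<open>If the excesses of \<open>z\<close> and \<open>z'\<close> are small, then after coloring the rest both have so many colors
  left that two of these kill the same color of \<open>t\<close>, or one of them kills none. As \<open>z\<close> and \<open>z'\<close> are
  not adjacent, both colors can be used, and \<open>t\<close> has a surplus in \<open>W\<close>.\<close>

lemma common_neighbors_excess:
  assumes W: "W \<subseteq> low" "is_clique W" "t \<in> W" and z: "z \<in> V" "z' \<in> V" "z \<notin> W" "z' \<notin> W" "z \<noteq> z'" "\<not> adj z z'"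
    and all: "\<And>t. t \<in> W \<Longrightarrow> adj t z \<and> adj t z'"
  shows "2 * c + card W \<le> deg V z + deg V z' + 1"
proof (rule ccontr)
  assume neg: "\<not> 2 * c + card W \<le> deg V z + deg V z' + 1"
  let ?P = "V - (W \<union> {z, z'})"
  define w where "w = card W"
  have WV: "W \<subseteq> V" using W low_subset by blast
  have fW: "finite W" by (rule finite_subset[OF WV finV])
  have w1: "w \<ge> 1" unfolding w_def using fW W(3) by (simp add: Suc_le_eq card_gt_0_iff) blast
  obtain \<phi> where \<phi>: "coloring ?P \<phi>" using colorable_proper[of "W \<union> {z, z'}"] WV z by blast
  have split: "deg V v = deg ?P v + deg (W \<union> {z, z'}) v" for v
  proof -
    have "deg (?P \<union> (W \<union> {z, z'})) v = deg ?P v + deg (W \<union> {z, z'}) v"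
      by (rule deg_union) (use finV fW in auto)
    moreover have "?P \<union> (W \<union> {z, z'}) = V" using WV z by blast
    ultimately show ?thesis by (simp only:)
  qed
  have Wset: "{u \<in> W \<union> {z, z'}. adj z u} = W" "{u \<in> W \<union> {z, z'}. adj z' u} = W"
    using all z adj_sym adj_irrefl by blast+
  have dz: "deg V z = deg ?P z + w" "deg V z' = deg ?P z' + w"
    using split[of z] split[of z'] Wset unfolding deg_def w_def by simp_all
  have "{u \<in> W \<union> {z, z'}. adj t u} = W - {t} \<union> {z, z'}"
    using all[OF W(3)] W adj_irrefl z unfolding is_clique_def by auto
  moreover have "card (W - {t} \<union> {z, z'}) = (w - 1) + 2"
    unfolding w_def using fW W(3) z by (subst card_Un_disjoint) auto
  ultimately have dt: "deg V t = deg ?P t + w + 1" using split[of t] w1 unfolding deg_def by simp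
  have az: "c + w \<le> card (available ?P \<phi> z) + deg V z" "c + w \<le> card (available ?P \<phi> z') + deg V z'"
    using available_lower[of z ?P \<phi>] available_lower[of z' ?P \<phi>] dz z(1,2) by (auto simp del: Un_insert_right)
  have at: "w + 1 \<le> card (available ?P \<phi> t)"
  proof -
    have tV: "t \<in> V" "deg V t = c" using W(1,3) WV low_deg by blast+
    have "c \<le> card (available ?P \<phi> t) + deg ?P t" by (rule available_lower[OF tV(1)]) blast
    then show ?thesis using tV(2) dt by linarith
  qed
  have mz: "c \<le> deg V z" "c \<le> deg V z'" using min_degree z by auto
  have "0 < card (available ?P \<phi> z)" "0 < card (available ?P \<phi> z')" using az mz neg w_def by linarith+
  then have ne: "available ?P \<phi> z \<noteq> {}" "available ?P \<phi> z' \<noteq> {}" by (metis card.empty less_irrefl)+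
  define A where "A = available ?P \<phi> t"
  have fA: "finite A" unfolding A_def using available_finite W WV by blast
  define kill where "kill = (\<lambda>v x. {y \<in> A. conf t y v x})"
  have k1: "card (kill v x) \<le> 1" for v x
    unfolding kill_def using killed_at_most_one(2)[of t v x "\<lambda>y. y \<in> A"] by (simp add: conj_commute)
  have fk: "finite (kill v x)" for v x unfolding kill_def using fA by simp
  \<comment> \<open>There are colors of \<open>z\<close> and \<open>z'\<close> that together leave \<open>t\<close> at least \<open>w\<close> colors.\<close>
  have "\<exists>x\<in>available ?P \<phi> z. \<exists>x'\<in>available ?P \<phi> z'. w + card (kill z x \<union> kill z' x') \<le> card A"
  proof (cases "\<exists>x\<in>available ?P \<phi> z. \<exists>x'\<in>available ?P \<phi> z'. card (kill z x \<union> kill z' x') \<le> 1")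
    case True
    then obtain x x' where x: "x \<in> available ?P \<phi> z" "x' \<in> available ?P \<phi> z'" "card (kill z x \<union> kill z' x') \<le> 1"
      by blast
    have "w + card (kill z x \<union> kill z' x') \<le> card A" using x(3) at unfolding A_def by linarith
    then show ?thesis using x(1,2) by blast
  next
    case False
    then have two: "\<not> card (kill z x \<union> kill z' x') \<le> 1" if "x \<in> available ?P \<phi> z" "x' \<in> available ?P \<phi> z'" for x x'
      using that by blast
    obtain x x' where x: "x \<in> available ?P \<phi> z" "x' \<in> available ?P \<phi> z'" using ne by blast
    show ?thesis
    proof (cases "w + 2 \<le> card A")
      case True
      have "card (kill z x \<union> kill z' x') \<le> 2"
        using card_Un_le[of "kill z x" "kill z' x'"] k1[of z x] k1[of z' x'] by linarith
      then have "w + card (kill z x \<union> kill z' x') \<le> card A" using True by linarith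
      then show ?thesis using x by blast
    next
      case False
      have nk: "kill z y \<noteq> {}" if "y \<in> available ?P \<phi> z" for y
        using two[OF that x(2)] k1[of z' x'] by fastforce
      have nk': "kill z' y \<noteq> {}" if "y \<in> available ?P \<phi> z'" for y
        using two[OF x(1) that] k1[of z x] by fastforce
      define f where "f = (\<lambda>x. SOME y. y \<in> kill z x)"
      define f' where "f' = (\<lambda>x. SOME y. y \<in> kill z' x)"
      have f: "f x \<in> kill z x" if "x \<in> available ?P \<phi> z" for x
        unfolding f_def by (rule some_in_eq[THEN iffD2]) (rule nk[OF that])
      have f': "f' x \<in> kill z' x" if "x \<in> available ?P \<phi> z'" for x
        unfolding f'_def by (rule some_in_eq[THEN iffD2]) (rule nk'[OF that])
      have "inj_on f (available ?P \<phi> z)"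
      proof (rule inj_onI)
        fix x y assume "x \<in> available ?P \<phi> z" "y \<in> available ?P \<phi> z" "f x = f y"
        then show "x = y" using f[of x] f[of y] conf_unique[of t "f x" z x y] unfolding kill_def by simp
      qed
      then have c1: "card (f ` available ?P \<phi> z) = card (available ?P \<phi> z)" by (rule card_image)
      have "inj_on f' (available ?P \<phi> z')"
      proof (rule inj_onI)
        fix x y assume "x \<in> available ?P \<phi> z'" "y \<in> available ?P \<phi> z'" "f' x = f' y"
        then show "x = y" using f'[of x] f'[of y] conf_unique[of t "f' x" z' x y] unfolding kill_def by simp
      qed
      then have c2: "card (f' ` available ?P \<phi> z') = card (available ?P \<phi> z')" by (rule card_image)
      have "f ` available ?P \<phi> z \<inter> f' ` available ?P \<phi> z' \<noteq> {}"
      proof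
        assume "f ` available ?P \<phi> z \<inter> f' ` available ?P \<phi> z' = {}"
        then have "card (f ` available ?P \<phi> z \<union> f' ` available ?P \<phi> z') = card (available ?P \<phi> z) + card (available ?P \<phi> z')"
          using c1 c2 available_finite z by (subst card_Un_disjoint) auto
        moreover have "card (f ` available ?P \<phi> z \<union> f' ` available ?P \<phi> z') \<le> card A"
          by (rule card_mono[OF fA]) (use f f' in \<open>auto simp: kill_def\<close>)
        ultimately show False using az neg False w_def by linarith
      qed
      then obtain x x' where xx: "x \<in> available ?P \<phi> z" "x' \<in> available ?P \<phi> z'" "f x = f' x'" by blast
      have single: "kill v y = {a}" if "a \<in> kill v y" for v y a
        using that conf_unique conf_sym unfolding kill_def by blast
      have "kill z x \<union> kill z' x' = {f x}"
        using single[OF f[OF xx(1)]] single[OF f'[OF xx(2)]] xx(3) by simp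
      then show ?thesis using two[OF xx(1,2)] by simp
    qed
  qed
  then obtain x x' where x: "x \<in> available ?P \<phi> z" "x' \<in> available ?P \<phi> z'" "w + card (kill z x \<union> kill z' x') \<le> card A" by blast
  have zP: "z \<notin> ?P" "z' \<notin> insert z ?P" using z by auto
  have col1: "coloring (insert z ?P) (\<phi>(z := x))" by (rule coloring_insert[OF \<phi> zP(1) x(1)])
  have "x' \<in> available (insert z ?P) (\<phi>(z := x)) z'"
    using x(2) available_insert[OF zP(1)] z(6) conf_adj adj_sym by blast
  note col2 = coloring_insert[OF col1 zP(2) this]
  define \<psi> where "\<psi> = \<phi>(z := x, z' := x')"
  have PW: "insert z' (insert z ?P) = V - W" using z by blast
  have c2: "coloring (V - W) \<psi>" using col2 unfolding PW \<psi>_def .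
  have "available (V - W) \<psi> t = A - (kill z x \<union> kill z' x')"
    unfolding PW[symmetric] \<psi>_def available_insert[OF zP(2)] available_insert[OF zP(1)] A_def[symmetric] kill_def by auto
  moreover have "card (A - (kill z x \<union> kill z' x')) = card A - card (kill z x \<union> kill z' x')"
    by (rule card_Diff_subset) (use fk in \<open>auto simp: kill_def\<close>)
  ultimately have wt: "w \<le> card (available (V - W) \<psi> t)" using x(3) by simp
  have VW: "V - (V - W) = W" "V - W \<union> W = V" "W \<inter> (V - W) = {}" using WV by blast+
  have "\<exists>\<chi>. coloring (V - W \<union> W) \<chi> \<and> (\<forall>u. u \<notin> W \<longrightarrow> \<chi> u = \<psi> u)"
  proof (rule extend_surplus[OF fW WV VW(3) clique_connected[OF W(2)] c2])
    show "deg W v \<le> card (available (V - W) \<psi> v)" if "v \<in> W" for v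
      using low_available[of "V - W" v \<psi>] low_deg that W WV VW(1) by auto
    show "deg W t < card (available (V - W) \<psi> t)" using wt deg_less_card[OF fW W(3)] unfolding w_def by simp
  qed (rule W(3))
  then show False using VW(2) not_colorable by auto
qed

end

section \<open>Hall's theorem with capacities and a reducible configuration\<close>

text \<open>The induction of Halmos and Vaughan: split along a tight set if there is one. Otherwise
  the condition has room for assigning one item to any of its options of positive capacity.\<close>

lemma capacitated_hall:
  fixes A :: "'i \<Rightarrow> 'b set" and cap :: "'b \<Rightarrow> nat"
  assumes "finite I" and "\<And>i. i \<in> I \<Longrightarrow> finite (A i)"
    and "\<And>X. finite X \<Longrightarrow> card {i \<in> I. A i \<subseteq> X} \<le> sum cap X"
  shows "\<exists>a. (\<forall>i\<in>I. a i \<in> A i) \<and> (\<forall>b. card {i \<in> I. a i = b} \<le> cap b)"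
  using assms
proof (induction "card I" arbitrary: I A cap rule: less_induct)
  case less
  note finI = less.prems(1) and finA = less.prems(2) and hall = less.prems(3)
  show ?case
  proof (cases "I = {}")
    case False
    then obtain i0 where i0: "i0 \<in> I" by blast
    show ?thesis
    proof (cases "\<exists>X. finite X \<and> 0 < card {i \<in> I. A i \<subseteq> X} \<and> card {i \<in> I. A i \<subseteq> X} < card I
        \<and> card {i \<in> I. A i \<subseteq> X} = sum cap X")
      case True
      then obtain X where X: "finite X" "0 < card {i \<in> I. A i \<subseteq> X}" "card {i \<in> I. A i \<subseteq> X} < card I"
        "card {i \<in> I. A i \<subseteq> X} = sum cap X" by blast
      define I1 where "I1 = {i \<in> I. A i \<subseteq> X}"
      define I2 where "I2 = {i \<in> I. \<not> A i \<subseteq> X}"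
      have I12: "I = I1 \<union> I2" "I1 \<inter> I2 = {}" "finite I1" "finite I2" "I1 \<subseteq> I" "I2 \<subseteq> I"
        unfolding I1_def I2_def using finI by auto
      have cI: "card I = card I1 + card I2" unfolding I12(1) by (rule card_Un_disjoint) (use I12 in auto)
      have "\<exists>a. (\<forall>i\<in>I1. a i \<in> A i) \<and> (\<forall>b. card {i \<in> I1. a i = b} \<le> cap b)"
      proof (rule less.hyps)
        show "card I1 < card I" using X(3) unfolding I1_def .
        show "card {i \<in> I1. A i \<subseteq> Y} \<le> sum cap Y" if "finite Y" for Y
        proof -
          have "card {i \<in> I1. A i \<subseteq> Y} \<le> card {i \<in> I. A i \<subseteq> Y}"
            by (rule card_mono) (use finI I12(5) in auto)
          then show ?thesis using hall[OF that] by linarith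
        qed
      qed (use I12 finA in auto)
      then obtain a1 where a1: "\<forall>i\<in>I1. a1 i \<in> A i" "\<forall>b. card {i \<in> I1. a1 i = b} \<le> cap b" by blast
      have "\<exists>a. (\<forall>i\<in>I2. a i \<in> A i - X) \<and> (\<forall>b. card {i \<in> I2. a i = b} \<le> cap b)"
      proof (rule less.hyps)
        show "card I2 < card I" using cI X(2) unfolding I1_def by simp
        show "card {i \<in> I2. A i - X \<subseteq> Y} \<le> sum cap Y" if Y: "finite Y" for Y
        proof -
          have "{i \<in> I. A i \<subseteq> X \<union> Y} = I1 \<union> {i \<in> I2. A i - X \<subseteq> Y}" unfolding I1_def I2_def by blast
          then have "card {i \<in> I. A i \<subseteq> X \<union> Y} = card I1 + card {i \<in> I2. A i - X \<subseteq> Y}"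
            using I12 by (simp only:) (rule card_Un_disjoint, auto)
          moreover have "card {i \<in> I. A i \<subseteq> X \<union> Y} \<le> sum cap (X \<union> Y)" by (rule hall) (use X(1) Y in simp)
          moreover have "sum cap (X \<union> Y) \<le> sum cap X + sum cap Y"
            using sum.union_inter[OF X(1) Y, of cap] by simp
          ultimately show ?thesis using X(4) unfolding I1_def by linarith
        qed
      qed (use I12 finA in auto)
      then obtain a2 where a2: "\<forall>i\<in>I2. a2 i \<in> A i - X" "\<forall>b. card {i \<in> I2. a2 i = b} \<le> cap b" by blast
      define a where "a = (\<lambda>i. if i \<in> I1 then a1 i else a2 i)"
      have "a i \<in> A i" if "i \<in> I" for i
        using a1(1) a2(1) that I12(1) unfolding a_def by auto
      moreover have "card {i \<in> I. a i = b} \<le> cap b" for b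
      proof (cases "b \<in> X")
        case True
        have "{i \<in> I. a i = b} = {i \<in> I1. a1 i = b}"
          using a2(1) True I12(1,2) unfolding a_def by auto
        then show ?thesis using a1(2) by simp
      next
        case False
        have "a1 i \<noteq> b" if "i \<in> I1" for i using a1(1) that False unfolding I1_def by blast
        then have "{i \<in> I. a i = b} = {i \<in> I2. a2 i = b}" using I12(1,2) unfolding a_def by auto
        then show ?thesis using a2(2) by simp
      qed
      ultimately show ?thesis by blast
    next
      case False
      have "1 \<le> card {i \<in> I. A i \<subseteq> A i0}" using i0 finI by (simp add: Suc_le_eq card_gt_0_iff) blast
      also have "\<dots> \<le> sum cap (A i0)" by (rule hall) (rule finA[OF i0])
      finally obtain b where b: "b \<in> A i0" "0 < cap b"
        by (metis gr0I not_one_le_zero sum.neutral)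
      let ?cap = "cap(b := cap b - 1)" and ?I = "I - {i0}"
      have c1: "card ?I + 1 = card I" using i0 finI by (metis Suc_eq_plus1 card.remove)
      have "\<exists>a. (\<forall>i\<in>?I. a i \<in> A i) \<and> (\<forall>d. card {i \<in> ?I. a i = d} \<le> ?cap d)"
      proof (rule less.hyps)
        show "card ?I < card I" using c1 by simp
        show "card {i \<in> ?I. A i \<subseteq> X} \<le> sum ?cap X" if X: "finite X" for X
        proof -
          have m: "card {i \<in> ?I. A i \<subseteq> X} \<le> card {i \<in> I. A i \<subseteq> X}" by (rule card_mono) (use finI in auto)
          show ?thesis
          proof (cases "b \<in> X")
            case False
            then have "sum ?cap X = sum cap X" by (intro sum.cong) auto
            then show ?thesis using m hall[OF X] by simp
          next
            case True
            have s: "sum ?cap X + 1 = sum cap X"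
            proof -
              have "sum ?cap X = ?cap b + sum ?cap (X - {b})" by (rule sum.remove[OF X True])
              also have "sum ?cap (X - {b}) = sum cap (X - {b})" by (rule sum.cong) auto
              finally show ?thesis using sum.remove[OF X True, of cap] b(2) by simp
            qed
            consider "card {i \<in> I. A i \<subseteq> X} = 0" | "card {i \<in> I. A i \<subseteq> X} < sum cap X"
              | "card {i \<in> I. A i \<subseteq> X} = sum cap X" "\<not> card {i \<in> I. A i \<subseteq> X} < card I"
              using hall[OF X] \<open>\<not> (\<exists>X. _ X)\<close> X by (metis gr0I le_neq_implies_less)
            then show ?thesis
            proof cases
              case 1 then show ?thesis using m by simp
            next
              case 2 then show ?thesis using m s by simp
            next
              case 3
              have "card {i \<in> ?I. A i \<subseteq> X} \<le> card ?I" by (rule card_mono) (use finI in auto)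
              then show ?thesis using 3 s c1 by linarith
            qed
          qed
        qed
      qed (use finI finA in auto)
      then obtain a where a: "\<forall>i\<in>?I. a i \<in> A i" "\<forall>d. card {i \<in> ?I. a i = d} \<le> ?cap d" by blast
      define a' where "a' = a(i0 := b)"
      have "card {i \<in> I. a' i = d} \<le> cap d" for d
      proof (cases "d = b")
        case True
        have "{i \<in> I. a' i = d} = insert i0 {i \<in> ?I. a i = b}" unfolding a'_def using True i0 by auto
        then have "card {i \<in> I. a' i = d} \<le> card {i \<in> ?I. a i = b} + 1"
          by (simp add: card_insert_if finI)
        then show ?thesis using a(2)[rule_format, of b] b(2) True by simp
      next
        case False
        have "{i \<in> I. a' i = d} = {i \<in> ?I. a i = d}" unfolding a'_def using False by auto
        then show ?thesis using a(2)[rule_format, of d] False by simp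
      qed
      moreover have "\<forall>i\<in>I. a' i \<in> A i" unfolding a'_def using a(1) b(1) by auto
      ultimately show ?thesis by blast
    qed
  qed simp
qed

context cover
begin

lemma alive_cong:
  assumes "\<And>u. adj t u \<or> adj t' u \<Longrightarrow> (u \<in> P \<longleftrightarrow> u \<in> Q) \<and> \<phi> u = \<psi> u"
  shows "alive P \<phi> t t' \<longleftrightarrow> alive Q \<psi> t t'"
proof -
  have "available P \<phi> t = available Q \<psi> t" "available P \<phi> t' = available Q \<psi> t'" using assms by (auto intro!: available_cong)
  moreover have "deg (V - P) t = deg (V - Q) t" by (rule deg_cong) (use assms in blast)
  moreover have "deg (V - P) t' = deg (V - Q) t'" by (rule deg_cong) (use assms in blast)
  ultimately show ?thesis unfolding alive_def surplus_def mismatch_def by simp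
qed

end

context critical_cover
begin

text \<open>Color everything outside \<open>R\<close> and the cliques in \<open>I\<close>, then \<open>R\<close> in the order of \<open>pos\<close>, and the
  cliques at the end. The vertex \<open>a W\<close> is responsible for making \<open>p W\<close> and \<open>q W\<close> alive, which costs
  it one color. Those vertices that come later and see \<open>p W\<close> or \<open>q W\<close> reserve one color to keep
  them alive. In total, a vertex \<open>b\<close> has to avoid at most as many colors as the capacity
  condition counts, since its edges to the cliques do not restrict it in any other way.\<close>

lemma reducible_configuration:
  fixes a p q :: "'v set \<Rightarrow> 'v" and pos :: "'v \<Rightarrow> nat" and reserve :: "'v set \<Rightarrow> 'v \<Rightarrow> bool"
  assumes R: "R \<subseteq> V" "R \<noteq> {}" and finI: "finite I"
    and W: "\<And>W. W \<in> I \<Longrightarrow> W \<subseteq> low \<and> is_clique W \<and> W \<inter> R = {}"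
    and apart: "\<And>W W' u v. W \<in> I \<Longrightarrow> W' \<in> I \<Longrightarrow> W \<noteq> W' \<Longrightarrow> u \<in> W \<Longrightarrow> v \<in> W' \<Longrightarrow> u \<noteq> v \<and> \<not> adj u v"
    and a: "\<And>W. W \<in> I \<Longrightarrow> a W \<in> R \<and> p W \<in> W \<and> q W \<in> W \<and> adj (p W) (a W) \<and> \<not> adj (q W) (a W)"
    and pos: "inj_on pos R"
    and later: "\<And>W b. W \<in> I \<Longrightarrow> b \<in> R \<Longrightarrow> pos (a W) < pos b \<Longrightarrow> adj (p W) b \<or> adj (q W) b \<Longrightarrow> reserve W b"
    and cap: "\<And>b. b \<in> R \<Longrightarrow> deg (V - \<Union>I) b + card {W \<in> I. reserve W b} + card {W \<in> I. a W = b} < c"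
  shows False
proof -
  define M where "M = \<Union>I"
  have MV: "M \<subseteq> V" unfolding M_def using W low_subset by blast
  have MR: "M \<inter> R = {}" unfolding M_def using W by blast
  define P where "P = (\<lambda>n. (V - R - M) \<union> {b \<in> R. pos b < n})"
  have PV: "P n \<subseteq> V" for n unfolding P_def using R by blast
  have pq: "p W \<in> V" "q W \<in> V" "deg V (p W) = c" if "W \<in> I" for W
    using a[OF that] W[OF that] low_subset low_deg by blast+
  have "\<exists>\<phi>. coloring (P n) \<phi> \<and> (\<forall>W\<in>I. a W \<in> R \<and> pos (a W) < n \<longrightarrow> alive (P n) \<phi> (p W) (q W))" for n
  proof (induction n)
    case 0
    have "P 0 = V - (R \<union> M)" unfolding P_def by auto
    then show ?case using colorable_proper[of "R \<union> M"] R MV by auto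
  next
    case (Suc n)
    then obtain \<phi> where \<phi>: "coloring (P n) \<phi>" "\<And>W. W \<in> I \<Longrightarrow> pos (a W) < n \<Longrightarrow> alive (P n) \<phi> (p W) (q W)"
      using a by blast
    show ?case
    proof (cases "\<exists>b\<in>R. pos b = n")
      case False
      then have "{b \<in> R. pos b < Suc n} = {b \<in> R. pos b < n}" using less_Suc_eq by auto
      then have "P (Suc n) = P n" unfolding P_def by simp
      moreover have "pos (a W) < n" if "W \<in> I" "pos (a W) < Suc n" for W
        using a[OF that(1)] that False less_Suc_eq by metis
      ultimately show ?thesis using \<phi> by (intro exI[of _ \<phi>]) simp
    next
      case True
      then obtain b where b: "b \<in> R" "pos b = n" by blast
      have bV: "b \<in> V" using b R by blast
      have bP: "b \<notin> P n" unfolding P_def using b by simp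
      have "{r \<in> R. pos r < Suc n} = insert b {r \<in> R. pos r < n}"
        using b pos less_Suc_eq by (auto dest: inj_onD)
      then have P': "P (Suc n) = insert b (P n)" unfolding P_def by auto
      have "\<exists>F. finite F \<and> card F \<le> (if reserve W b then 1 else 0) + (if a W = b then 1 else 0) \<and>
          (\<forall>x. x \<notin> F \<longrightarrow> pos (a W) < Suc n \<longrightarrow> alive (insert b (P n)) (\<phi>(b := x)) (p W) (q W))"
        if W: "W \<in> I" for W
      proof -
        consider "a W = b" | "pos (a W) < n" | "\<not> pos (a W) < Suc n"
        proof -
          have "a W = b" if "pos (a W) = n"
            by (rule inj_onD[OF pos]) (use a[OF W] b that in auto)
          then show ?thesis using that by linarith
        qed
        then show ?thesis
        proof cases
          case 1
          have ab: "adj (p W) b" "\<not> adj (q W) b" using a[OF W] 1 by blast+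
          obtain F where F: "finite F" "card F \<le> 1" "\<forall>x. x \<notin> F \<longrightarrow> alive (insert b (P n)) (\<phi>(b := x)) (p W) (q W)"
            using alive_create[OF PV pq(1)[OF W] bV bP ab pq(3)[OF W]] by blast
          show ?thesis using F 1 by (intro exI[of _ F]) simp
        next
          case 2
          obtain F where F: "finite F" "card F \<le> 1" "\<not> adj (p W) b \<and> \<not> adj (q W) b \<longrightarrow> F = {}"
            "\<forall>x. x \<notin> F \<longrightarrow> alive (insert b (P n)) (\<phi>(b := x)) (p W) (q W)"
            using alive_keep[OF \<phi>(2)[OF W 2] pq(1,2)[OF W] bV bP] by blast
          have "card F \<le> (if reserve W b then 1 else 0)" using F(2,3) later[OF W b(1)] 2 b(2) by auto
          then show ?thesis using F by (intro exI[of _ F]) simp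
        next
          case 3
          then show ?thesis by (intro exI[of _ "{}"]) simp
        qed
      qed
      then obtain F where F: "\<And>W. W \<in> I \<Longrightarrow> finite (F W)"
        "\<And>W. W \<in> I \<Longrightarrow> card (F W) \<le> (if reserve W b then 1 else 0) + (if a W = b then 1 else 0)"
        "\<And>W x. W \<in> I \<Longrightarrow> x \<notin> F W \<Longrightarrow> pos (a W) < Suc n \<Longrightarrow> alive (insert b (P n)) (\<phi>(b := x)) (p W) (q W)"
        by metis
      have "card (\<Union>W\<in>I. F W) \<le> (\<Sum>W\<in>I. card (F W))" by (rule card_UN_le[OF finI])
      also have "\<dots> \<le> (\<Sum>W\<in>I. (if reserve W b then 1 else 0) + (if a W = b then 1 else 0))"
        by (rule sum_mono) (rule F(2))
      also have "\<dots> = card {W \<in> I. reserve W b} + card {W \<in> I. a W = b}"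
        by (simp add: sum.distrib finI sum.If_cases Int_def)
      finally have "card (\<Union>W\<in>I. F W) \<le> card {W \<in> I. reserve W b} + card {W \<in> I. a W = b}" .
      moreover have "deg (P n) b \<le> deg (V - M) b"
        by (rule deg_mono) (use finV R MR in \<open>auto simp: P_def\<close>)
      moreover have "c \<le> card (available (P n) \<phi> b) + deg (P n) b" by (rule available_lower[OF bV PV])
      ultimately have "card (\<Union>W\<in>I. F W) < card (available (P n) \<phi> b)" using cap[OF b(1)] unfolding M_def by linarith
      moreover have "finite (\<Union>W\<in>I. F W)" using finI F(1) by blast
      ultimately have "\<not> available (P n) \<phi> b \<subseteq> (\<Union>W\<in>I. F W)" using card_mono by (metis not_less)
      then obtain x where x: "x \<in> available (P n) \<phi> b" "\<And>W. W \<in> I \<Longrightarrow> x \<notin> F W" by blast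
      have "coloring (insert b (P n)) (\<phi>(b := x))" by (rule coloring_insert[OF \<phi>(1) bP x(1)])
      then show ?thesis unfolding P' using F(3) x(2) by blast
    qed
  qed
  moreover obtain n where n: "\<And>b. b \<in> R \<Longrightarrow> pos b < n"
  proof -
    have "finite (pos ` R)" using R finV finite_subset by blast
    then show ?thesis using that[of "Suc (Max (pos ` R))"] by (simp add: le_imp_less_Suc)
  qed
  moreover have Pn: "P n = V - M" unfolding P_def using n MR R by auto
  ultimately obtain \<phi> where \<phi>: "coloring (V - M) \<phi>" "\<And>W. W \<in> I \<Longrightarrow> alive (V - M) \<phi> (p W) (q W)"
    using a by metis
  have "J \<subseteq> I \<Longrightarrow> \<exists>\<psi>. coloring (V - M \<union> \<Union>J) \<psi> \<and> (\<forall>u. u \<notin> \<Union>J \<longrightarrow> \<psi> u = \<phi> u)" if "finite J" for J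
    using that
  proof (induction J)
    case empty then show ?case using \<phi>(1) by auto
  next
    case (insert W J)
    then have WI: "W \<in> I" and JI: "J \<subseteq> I" by blast+
    obtain \<psi> where \<psi>: "coloring (V - M \<union> \<Union>J) \<psi>" "\<And>u. u \<notin> \<Union>J \<Longrightarrow> \<psi> u = \<phi> u" using insert.IH[OF JI] by blast
    let ?Q = "V - M \<union> \<Union>J"
    have far: "u \<notin> \<Union>J" if "t \<in> W" "adj t u" for t u
      using apart[OF WI] that JI insert.hyps(2) by blast
    have "alive ?Q \<psi> (p W) (q W) \<longleftrightarrow> alive (V - M) \<phi> (p W) (q W)"
    proof (rule alive_cong)
      fix u assume "adj (p W) u \<or> adj (q W) u"
      then have "u \<notin> \<Union>J" using far a[OF WI] by blast
      then show "(u \<in> ?Q \<longleftrightarrow> u \<in> V - M) \<and> \<psi> u = \<phi> u" using \<psi>(2) by blast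
    qed
    then have al: "alive ?Q \<psi> (p W) (q W)" using \<phi>(2)[OF WI] by blast
    have "\<exists>\<chi>. coloring (?Q \<union> W) \<chi> \<and> (\<forall>u. u \<notin> W \<longrightarrow> \<chi> u = \<psi> u)"
    proof (rule alive_extend[OF _ \<psi>(1) _ _ _ _ _ _ _ _ al])
      show "?Q \<subseteq> V" using JI MV unfolding M_def by blast
      show "W \<subseteq> V" using W[OF WI] low_subset by blast
      show "W \<inter> ?Q = {}"
      proof -
        have "W \<inter> \<Union>J = {}" using apart[OF WI] JI insert.hyps(2) by blast
        moreover have "W \<subseteq> M" unfolding M_def using WI by blast
        ultimately show ?thesis by blast
      qed
      show "is_clique W" "p W \<in> W" "q W \<in> W" using W[OF WI] a[OF WI] by blast+
      show "p W \<noteq> q W" using a[OF WI] by metis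
      show "deg V v = c" if "v \<in> W" for v using that W[OF WI] low_deg by blast
      show "u \<in> W \<or> u \<in> ?Q" if vu: "v \<in> W" "u \<in> V" "adj v u" for v u
      proof (rule ccontr)
        assume n: "\<not> (u \<in> W \<or> u \<in> ?Q)"
        then obtain W' where "W' \<in> I" "u \<in> W'" using vu(2) unfolding M_def by blast
        then show False using apart[OF WI, of W' v u] vu n by blast
      qed
    qed
    then obtain \<chi> where \<chi>: "coloring (?Q \<union> W) \<chi>" "\<And>u. u \<notin> W \<Longrightarrow> \<chi> u = \<psi> u" by blast
    have "?Q \<union> W = V - M \<union> \<Union>(insert W J)" by blast
    moreover have "\<chi> u = \<phi> u" if "u \<notin> \<Union>(insert W J)" for u using that \<chi>(2) \<psi>(2) by auto
    ultimately show ?case using \<chi>(1) by auto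
  qed
  from this[OF finI] obtain \<psi> where "coloring (V - M \<union> \<Union>I) \<psi>" by blast
  moreover have "V - M \<union> \<Union>I = V" using MV unfolding M_def by blast
  ultimately show False using not_colorable by simp
qed

end

section \<open>Cliques with many light edges\<close>

context critical_cover
begin

definition excess :: "'v \<Rightarrow> nat" where "excess v = deg V v - c"

definition high :: "'v set" where "high = V - low"

text \<open>The two vertices of \<open>W\<close> that \<open>b\<close> misses provide the two light edges in the last conclusion of
  \<open>light_choices\<close>. High vertices that see more of \<open>W\<close> reserve a color for it instead.\<close>

definition light :: "'v set \<Rightarrow> 'v \<Rightarrow> bool" where
  "light W b \<longleftrightarrow> deg W b + 2 \<le> card W"

definition light_edges :: "'v set \<Rightarrow> 'v set \<Rightarrow> nat" where
  "light_edges W X = (\<Sum>b\<in>{b \<in> X. light W b}. deg W b)"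

lemma light_edges_alt:
  assumes "finite W" "finite X"
  shows "light_edges W X = (\<Sum>t\<in>W. card {b \<in> X. light W b \<and> adj t b})"
proof -
  have "light_edges W X = (\<Sum>b\<in>{b \<in> X. light W b}. \<Sum>t\<in>W. if adj b t then 1 else 0)"
    unfolding light_edges_def deg_def by (intro sum.cong) (simp_all add: sum.If_cases assms Int_def)
  also have "\<dots> = (\<Sum>t\<in>W. \<Sum>b\<in>{b \<in> X. light W b}. if adj b t then 1 else 0)" by (rule sum.swap)
  also have "\<dots> = (\<Sum>t\<in>W. card {b \<in> X. light W b \<and> adj t b})"
  proof (rule sum.cong)
    fix t
    have "{b \<in> X. light W b} \<inter> {b. adj b t} = {b \<in> X. light W b \<and> adj t b}" using adj_sym by blast
    then show "(\<Sum>b\<in>{b \<in> X. light W b}. if adj b t then 1 else 0) = card {b \<in> X. light W b \<and> adj t b}"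
      by (simp add: sum.If_cases assms)
  qed simp
  finally show ?thesis .
qed

lemma light_edges_union:
  "finite A \<Longrightarrow> finite B \<Longrightarrow> A \<inter> B = {} \<Longrightarrow> light_edges W (A \<union> B) = light_edges W A + light_edges W B"
proof -
  assume f: "finite A" "finite B" "A \<inter> B = {}"
  have "{b \<in> A \<union> B. light W b} = {b \<in> A. light W b} \<union> {b \<in> B. light W b}" by blast
  then show ?thesis unfolding light_edges_def by (simp only:) (rule sum.union_disjoint, use f in auto)
qed

text \<open>For each \<open>t \<in> W\<close> look at its last light neighbor in \<open>R\<close>, and let \<open>q\<close> be a vertex of \<open>W\<close> where it
  comes earliest, or where there is none. Every \<open>t\<close> with a later last light neighbor \<open>b\<close> offers \<open>b\<close>
  as the vertex that makes \<open>t\<close> and \<open>q\<close> alive; after \<open>b\<close> no light neighbor of \<open>t\<close> or \<open>q\<close> follows.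

  The last conclusion says that a set that contains all offers has at least two light edges to \<open>W\<close>.
  If the earliest last neighbor exists, it misses two vertices of \<open>W\<close>, and each of
  them makes an offer. If \<open>q\<close> has no light neighbors in \<open>R\<close>, the only exception is that
  a single vertex of \<open>W\<close> has some left.\<close>

lemma light_choices:
  assumes W: "W \<subseteq> V" "finite W" and R: "finite R" and pos: "inj_on pos R" "\<And>b. b \<in> R \<Longrightarrow> 0 < (pos b :: nat)"
    and act: "0 < light_edges W R" and rho: "\<And>t. t \<in> W \<Longrightarrow> card {b \<in> R. adj t b} \<le> \<rho>"
  obtains A q where "A \<noteq> {}" "A \<subseteq> R" "q \<in> W"
    "\<And>b. b \<in> A \<Longrightarrow> \<exists>t\<in>W. adj t b \<and> \<not> adj q b \<and>
        (\<forall>b'\<in>R. pos b < pos b' \<and> (adj t b' \<or> adj q b') \<longrightarrow> \<not> light W b')"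
    "\<And>X. finite X \<Longrightarrow> A \<subseteq> X \<Longrightarrow> 2 \<le> light_edges W X \<or> 1 \<le> light_edges W X \<and> light_edges W R \<le> \<rho>"
proof -
  define lt where "lt = (\<lambda>t. {b \<in> R. light W b \<and> adj t b})"
  define val where "val = (\<lambda>t. Max (insert 0 (pos ` lt t)))"
  have flt: "finite (lt t)" for t unfolding lt_def using R by simp
  have val_ge: "pos b \<le> val t" if "b \<in> lt t" for b t
    unfolding val_def by (rule Max_ge) (use flt that in auto)
  have val_at: "\<exists>b\<in>lt t. pos b = val t" if "0 < val t" for t
  proof -
    have "val t \<in> insert 0 (pos ` lt t)" unfolding val_def by (rule Max_in) (use flt in auto)
    then show ?thesis using that by auto
  qed
  have val_0: "val t = 0 \<longleftrightarrow> lt t = {}" for t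
  proof
    assume "val t = 0"
    then show "lt t = {}" using val_ge[of _ t] pos(2) unfolding lt_def by fastforce
  qed (simp add: val_def)
  have alt: "light_edges W R = (\<Sum>t\<in>W. card (lt t))" unfolding lt_def by (rule light_edges_alt[OF W(2) R])
  have "W \<noteq> {}" using act alt by auto
  then obtain q where q: "q \<in> W" "\<And>t. t \<in> W \<Longrightarrow> val q \<le> val t"
    using ex_has_least_nat[of "\<lambda>t. t \<in> W" _ val] by blast
  define N where "N = {t \<in> W. val q < val t}"
  define A where "A = {b \<in> R. light W b \<and> (\<exists>t\<in>N. adj t b \<and> pos b = val t)}"
  have fN: "finite N" unfolding N_def using W by simp
  have bt: "\<exists>b\<in>A. adj t b" if t: "t \<in> N" for t
  proof -
    have "0 < val t" using t unfolding N_def by auto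
    then obtain b where "b \<in> lt t" "pos b = val t" using val_at[of t] by blast
    then show ?thesis unfolding A_def lt_def using t by blast
  qed
  have cardN: "card N \<le> light_edges W X" if X: "finite X" "A \<subseteq> X" for X
  proof -
    have "card N = (\<Sum>t\<in>N. 1)" by simp
    also have "\<dots> \<le> (\<Sum>t\<in>N. card {b \<in> X. light W b \<and> adj t b})"
    proof (rule sum_mono)
      fix t assume "t \<in> N"
      then obtain b where "b \<in> A" "adj t b" using bt by blast
      then have "b \<in> {b \<in> X. light W b \<and> adj t b}" using X(2) unfolding A_def by blast
      then have "0 < card {b \<in> X. light W b \<and> adj t b}" using X(1) by (intro card_gt_0_iff[THEN iffD2]) auto
      then show "1 \<le> card {b \<in> X. light W b \<and> adj t b}" by simp
    qed
    also have "\<dots> \<le> (\<Sum>t\<in>W. card {b \<in> X. light W b \<and> adj t b})"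
      by (rule sum_mono2) (use W in \<open>auto simp: N_def\<close>)
    also have "\<dots> = light_edges W X" by (rule light_edges_alt[OF W(2) X(1), symmetric])
    finally show ?thesis .
  qed
  have main: "2 \<le> card N \<or> 1 \<le> card N \<and> light_edges W R \<le> \<rho>"
  proof (cases "val q = 0")
    case False
    then obtain b0 where b0: "b0 \<in> lt q" "pos b0 = val q" using val_at by blast
    have "{t \<in> W. \<not> adj b0 t} \<subseteq> N"
    proof
      fix t assume t: "t \<in> {t \<in> W. \<not> adj b0 t}"
      have "val t \<noteq> val q"
      proof
        assume e: "val t = val q"
        then have "0 < val t" using False by simp
        then obtain b where b: "b \<in> lt t" "pos b = val t" using val_at[of t] by blast
        then have "b = b0" using inj_onD[OF pos(1)] b0 e unfolding lt_def by auto
        then show False using b(1) t adj_sym unfolding lt_def by blast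
      qed
      then show "t \<in> N" unfolding N_def using q(2)[of t] t by auto
    qed
    then have "card {t \<in> W. \<not> adj b0 t} \<le> card N" using fN by (rule card_mono[rotated])
    moreover have "card W = card {t \<in> W. adj b0 t} + card {t \<in> W. \<not> adj b0 t}"
      using W(2) by (subst card_Un_disjoint[symmetric]) (auto intro: arg_cong[where f = card])
    moreover have "deg W b0 + 2 \<le> card W" using b0(1) unfolding lt_def light_def by blast
    ultimately show ?thesis unfolding deg_def by linarith
  next
    case True
    have Nlt: "t \<in> N \<longleftrightarrow> lt t \<noteq> {}" if "t \<in> W" for t using that True val_0[of t] unfolding N_def by auto
    have sN: "light_edges W R = (\<Sum>t\<in>N. card (lt t))"
      unfolding alt by (rule sum.mono_neutral_right) (use W Nlt in \<open>auto simp: N_def\<close>)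
    then have "N \<noteq> {}" using act by auto
    then have "1 \<le> card N" using fN by (simp add: Suc_le_eq card_gt_0_iff)
    moreover have "light_edges W R \<le> \<rho>" if N1: "card N = 1"
    proof -
      obtain t where t: "N = {t}" using N1 by (auto simp: card_1_singleton_iff)
      then have "t \<in> W" unfolding N_def by blast
      have "card (lt t) \<le> card {b \<in> R. adj t b}" unfolding lt_def by (rule card_mono) (use R in auto)
      then show ?thesis using rho[OF \<open>t \<in> W\<close>] sN t by simp
    qed
    ultimately show ?thesis by linarith
  qed
  show ?thesis
  proof (rule that[of A q])
    have "N \<noteq> {}" using main by auto
    then show "A \<noteq> {}" using bt by blast
    show "A \<subseteq> R" unfolding A_def by blast
    show "q \<in> W" by (rule q(1))
    show "\<exists>t\<in>W. adj t b \<and> \<not> adj q b \<and>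
        (\<forall>b'\<in>R. pos b < pos b' \<and> (adj t b' \<or> adj q b') \<longrightarrow> \<not> light W b')" if b: "b \<in> A" for b
    proof -
      obtain t where t: "t \<in> W" "val q < val t" "adj t b" "pos b = val t" and bR: "b \<in> R" "light W b"
        using b unfolding A_def N_def by blast
      have "\<not> adj q b" using val_ge[of b q] bR t unfolding lt_def by auto
      moreover have "\<not> light W b'" if "b' \<in> R" "pos b < pos b'" "adj t b' \<or> adj q b'" for b'
        using val_ge[of b' t] val_ge[of b' q] that t unfolding lt_def by auto
      ultimately show ?thesis using t by blast
    qed
    show "2 \<le> light_edges W X \<or> 1 \<le> light_edges W X \<and> light_edges W R \<le> \<rho>" if "finite X" "A \<subseteq> X" for X
      using main cardN[OF that] by linarith
  qed
qed

text \<open>The set \<open>C\<close> consists of vertices that are colored in advance; their edges to the cliques have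
  been paid for. A set \<open>X\<close> that violates Hall's condition for the remaining high vertices has a large
  excess compared with its edges to the cliques, except for one edge to each clique whose offers
  it exhausts. Such a clique has two light edges to \<open>X\<close>, so at least half of its light
  edges to \<open>X\<close> are paid for; hence the factor 2. The only exception arises when at most \<open>\<rho> W\<close>
  light edges remain; these are given up by the minimum.\<close>

lemma light_edges_step:
  fixes \<rho> :: "'v set \<Rightarrow> nat"
  assumes finI: "finite I0"
    and W0: "\<And>W. W \<in> I0 \<Longrightarrow> W \<subseteq> low \<and> is_clique W"
    and apart: "\<And>W W' u v. W \<in> I0 \<Longrightarrow> W' \<in> I0 \<Longrightarrow> W \<noteq> W' \<Longrightarrow> u \<in> W \<Longrightarrow> v \<in> W' \<Longrightarrow> u \<noteq> v \<and> \<not> adj u v"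
    and rho: "\<And>W t. W \<in> I0 \<Longrightarrow> t \<in> W \<Longrightarrow> card {b \<in> high. adj t b} \<le> \<rho> W"
    and C: "C \<subseteq> high" "C \<noteq> high"
  obtains X where "X \<noteq> {}" "X \<subseteq> high - C"
    "(\<Sum>W\<in>I0. min (light_edges W (C \<union> X)) (light_edges W high - \<rho> W))
      \<le> (\<Sum>W\<in>I0. min (light_edges W C) (light_edges W high - \<rho> W)) + 2 * (\<Sum>b\<in>X. excess b + 1)"
proof -
  define R where "R = high - C"
  have hV: "high \<subseteq> V" unfolding high_def by blast
  have fh: "finite high" by (rule finite_subset[OF hV finV])
  have RV: "R \<subseteq> V" "R \<noteq> {}" "finite R" "R \<subseteq> high" unfolding R_def using C hV fh by auto
  have fC: "finite C" using C fh finite_subset by blast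
  have fW: "finite W" "W \<subseteq> V" if "W \<in> I0" for W
    using W0[OF that] low_subset finV by (meson finite_subset order_trans)+
  obtain pos0 :: "'v \<Rightarrow> nat" where pos0: "inj_on pos0 R" using finite_imp_inj_to_nat_seg[OF RV(3)] by blast
  define pos where "pos = (\<lambda>b. Suc (pos0 b))"
  have pos: "inj_on pos R" "\<And>b. 0 < pos b" using pos0 unfolding pos_def inj_on_def by auto
  define I where "I = {W \<in> I0. 0 < light_edges W R}"
  have II: "I \<subseteq> I0" "finite I" unfolding I_def using finI by auto
  define offers where "offers = (\<lambda>W A q. A \<noteq> {} \<and> A \<subseteq> R \<and> q \<in> W \<and>
      (\<forall>b\<in>A. \<exists>t\<in>W. adj t b \<and> \<not> adj q b \<and>
        (\<forall>b'\<in>R. pos b < pos b' \<and> (adj t b' \<or> adj q b') \<longrightarrow> \<not> light W b')) \<and>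
      (\<forall>X. finite X \<longrightarrow> A \<subseteq> X \<longrightarrow> 2 \<le> light_edges W X \<or> 1 \<le> light_edges W X \<and> light_edges W R \<le> \<rho> W))"
  have ex: "\<exists>A q. offers W A q" if W: "W \<in> I" for W
  proof -
    have WI: "W \<in> I0" and act: "0 < light_edges W R" using W unfolding I_def by auto
    have r: "card {b \<in> R. adj t b} \<le> \<rho> W" if "t \<in> W" for t
    proof -
      have "card {b \<in> R. adj t b} \<le> card {b \<in> high. adj t b}" by (rule card_mono) (use RV fh in auto)
      then show ?thesis using rho[OF WI that] by simp
    qed
    have pos2: "0 < pos b" if "b \<in> R" for b by (rule pos(2))
    show ?thesis
    proof (rule light_choices[OF fW(2)[OF WI] fW(1)[OF WI] RV(3) pos(1) pos2 act r])
      fix A q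
      assume "A \<noteq> {}" "A \<subseteq> R" "q \<in> W"
        and 1: "\<And>b. b \<in> A \<Longrightarrow> \<exists>t\<in>W. adj t b \<and> \<not> adj q b \<and>
          (\<forall>b'\<in>R. pos b < pos b' \<and> (adj t b' \<or> adj q b') \<longrightarrow> \<not> light W b')"
        and 2: "\<And>X. finite X \<Longrightarrow> A \<subseteq> X \<Longrightarrow> 2 \<le> light_edges W X \<or> 1 \<le> light_edges W X \<and> light_edges W R \<le> \<rho> W"
      then have "offers W A q" unfolding offers_def by (intro conjI ballI allI impI) (assumption | rule 1 2)+
      then show ?thesis by blast
    qed
  qed
  then obtain A q where Aq0: "\<And>W. W \<in> I \<Longrightarrow> offers W (A W) (q W)" by metis
  have Aq: "A W \<noteq> {}" "A W \<subseteq> R" "q W \<in> W" if "W \<in> I" for W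
    using Aq0[OF that] unfolding offers_def by blast+
  have Aq4: "\<exists>t\<in>W. adj t b \<and> \<not> adj (q W) b \<and>
      (\<forall>b'\<in>R. pos b < pos b' \<and> (adj t b' \<or> adj (q W) b') \<longrightarrow> \<not> light W b')" if "W \<in> I" "b \<in> A W" for W b
    using Aq0[OF that(1)] that(2) unfolding offers_def by blast
  have Aq5: "2 \<le> light_edges W X \<or> 1 \<le> light_edges W X \<and> light_edges W R \<le> \<rho> W"
    if "W \<in> I" "finite X" "A W \<subseteq> X" for W X
    using Aq0[OF that(1)] that(2,3) unfolding offers_def by blast
  define reserve where "reserve = (\<lambda>W b. \<not> light W b \<and> 1 \<le> deg W b)"
  define cp where "cp = (\<lambda>b. int c - 1 - int (deg (V - \<Union>I) b) - int (card {W \<in> I. reserve W b}))"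
  \<comment> \<open>If the options could be assigned within the capacities, the high vertices outside \<open>C\<close> and
    the cliques in \<open>I\<close> would form a reducible configuration.\<close>
  have "\<exists>X\<subseteq>R. X \<noteq> {} \<and> (\<Sum>b\<in>X. cp b) < int (card {W \<in> I. A W \<subseteq> X})"
  proof (rule ccontr)
    assume none: "\<not> ?thesis"
    have cp0: "0 \<le> cp b" if "b \<in> R" for b
    proof (rule ccontr)
      assume "\<not> 0 \<le> cp b"
      then have "(\<Sum>b\<in>{b}. cp b) < int (card {W \<in> I. A W \<subseteq> {b}})" by simp
      then show False using none that by blast
    qed
    have "\<exists>a. (\<forall>W\<in>I. a W \<in> A W) \<and> (\<forall>b. card {W \<in> I. a W = b} \<le> nat (cp b))"
    proof (rule capacitated_hall[OF II(2)])
      show "finite (A W)" if "W \<in> I" for W using Aq(2)[OF that] RV(3) finite_subset by blast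
      show "card {W \<in> I. A W \<subseteq> X} \<le> (\<Sum>b\<in>X. nat (cp b))" if X: "finite X" for X
      proof (cases "{W \<in> I. A W \<subseteq> X} = {}")
        case True then show ?thesis by (metis card.empty zero_le)
      next
        case False
        have "{W \<in> I. A W \<subseteq> X} = {W \<in> I. A W \<subseteq> X \<inter> R}" using Aq(2) by blast
        then have "card {W \<in> I. A W \<subseteq> X} = card {W \<in> I. A W \<subseteq> X \<inter> R}" by (rule arg_cong)
        moreover have "X \<inter> R \<noteq> {}" using False Aq(1,2) by blast
        then have "int (card {W \<in> I. A W \<subseteq> X \<inter> R}) \<le> (\<Sum>b\<in>X \<inter> R. cp b)"
          using none by (metis Int_lower2 not_less)
        moreover have "(\<Sum>b\<in>X \<inter> R. cp b) = (\<Sum>b\<in>X \<inter> R. int (nat (cp b)))"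
          by (rule sum.cong) (use cp0 in auto)
        moreover have "(\<Sum>b\<in>X \<inter> R. nat (cp b)) \<le> (\<Sum>b\<in>X. nat (cp b))"
          by (rule sum_mono2) (use X in auto)
        moreover have "(\<Sum>b\<in>X \<inter> R. int (nat (cp b))) = int (\<Sum>b\<in>X \<inter> R. nat (cp b))"
          by (rule of_nat_sum[symmetric])
        ultimately show ?thesis by linarith
      qed
    qed
    then obtain a where a: "\<And>W. W \<in> I \<Longrightarrow> a W \<in> A W" "\<And>b. card {W \<in> I. a W = b} \<le> nat (cp b)" by blast
    have "\<exists>t. t \<in> W \<and> adj t (a W) \<and> \<not> adj (q W) (a W) \<and>
        (\<forall>b'\<in>R. pos (a W) < pos b' \<and> (adj t b' \<or> adj (q W) b') \<longrightarrow> \<not> light W b')" if "W \<in> I" for W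
      using Aq4[OF that a(1)[OF that]] by blast
    then obtain p where p: "\<And>W. W \<in> I \<Longrightarrow> p W \<in> W \<and> adj (p W) (a W) \<and> \<not> adj (q W) (a W) \<and>
        (\<forall>b'\<in>R. pos (a W) < pos b' \<and> (adj (p W) b' \<or> adj (q W) b') \<longrightarrow> \<not> light W b')" by metis
    show False
    proof (rule reducible_configuration[OF RV(1,2) II(2) _ _ _ pos(1)])
      show "W \<subseteq> low \<and> is_clique W \<and> W \<inter> R = {}" if "W \<in> I" for W
        using W0 that II(1) unfolding R_def high_def by blast
      show "u \<noteq> v \<and> \<not> adj u v" if "W \<in> I" "W' \<in> I" "W \<noteq> W'" "u \<in> W" "v \<in> W'" for W W' u v
        using apart[of W W' u v] that II(1) by blast
      show "a W \<in> R \<and> p W \<in> W \<and> q W \<in> W \<and> adj (p W) (a W) \<and> \<not> adj (q W) (a W)" if "W \<in> I" for W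
        using p[OF that] a(1)[OF that] Aq(2,3)[OF that] by blast
      show "reserve W b" if "W \<in> I" "b \<in> R" "pos (a W) < pos b" "adj (p W) b \<or> adj (q W) b" for W b
      proof -
        have WI: "W \<in> I0" using that(1) II(1) by blast
        have "\<exists>t\<in>W. adj b t" using that(4) p[OF that(1)] Aq(3)[OF that(1)] adj_sym by blast
        then have "1 \<le> deg W b" using deg_pos[OF fW(1)[OF WI]] by blast
        then show ?thesis unfolding reserve_def using p[OF that(1)] that by blast
      qed
      show "deg (V - \<Union>I) b + card {W \<in> I. reserve W b} + card {W \<in> I. a W = b} < c" if "b \<in> R" for b
        using a(2)[of b] cp0[OF that] unfolding cp_def by linarith
    qed
  qed
  then obtain X where X: "X \<subseteq> R" "X \<noteq> {}" "(\<Sum>b\<in>X. cp b) < int (card {W \<in> I. A W \<subseteq> X})" by blast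
  have fX: "finite X" using X(1) RV(3) finite_subset by blast
  define opt where "opt = (\<lambda>W. if A W \<subseteq> X then 1 else 0 :: int)"
  define hv where "hv = (\<lambda>W b. if reserve W b then 1 else 0 :: int)"
  have cpb: "cp b = (\<Sum>W\<in>I. int (deg W b) - hv W b) - int (excess b + 1)" if "b \<in> X" for b
  proof -
    have bV: "b \<in> V" using that X(1) RV(1) by blast
    have MV: "\<Union>I \<subseteq> V" using fW(2) II(1) by blast
    have "deg (V - \<Union>I \<union> \<Union>I) b = deg (V - \<Union>I) b + deg (\<Union>I) b"
      by (rule deg_union) (use finV MV finite_subset in auto)
    moreover have "V - \<Union>I \<union> \<Union>I = V" using MV by blast
    moreover have "deg (\<Union>I) b = (\<Sum>W\<in>I. deg W b)"
    proof -
      have "{u \<in> \<Union>I. adj b u} = (\<Union>W\<in>I. {u \<in> W. adj b u})" by blast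
      then have "deg (\<Union>I) b = card (\<Union>W\<in>I. {u \<in> W. adj b u})" unfolding deg_def by simp
      also have "\<dots> = (\<Sum>W\<in>I. card {u \<in> W. adj b u})"
      proof (rule card_UN_disjoint[OF II(2)])
        show "\<forall>W\<in>I. finite {u \<in> W. adj b u}" using fW(1) II(1) by auto
        show "\<forall>W\<in>I. \<forall>W'\<in>I. W \<noteq> W' \<longrightarrow> {u \<in> W. adj b u} \<inter> {u \<in> W'. adj b u} = {}"
          using apart II(1) by blast
      qed
      finally show ?thesis unfolding deg_def .
    qed
    ultimately have "deg V b = deg (V - \<Union>I) b + (\<Sum>W\<in>I. deg W b)" by (simp only:)
    moreover have "deg V b = c + excess b" unfolding excess_def using min_degree[OF bV] by simp
    ultimately have "int c + int (excess b) = int (deg (V - \<Union>I) b) + (\<Sum>W\<in>I. int (deg W b))"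
      by (metis of_nat_add of_nat_sum)
    moreover have "int (card {W \<in> I. reserve W b}) = (\<Sum>W\<in>I. hv W b)"
      unfolding hv_def by (simp add: sum.If_cases II(2) Int_def)
    ultimately show ?thesis unfolding cp_def by (simp add: sum_subtractf)
  qed
  have "int (card {W \<in> I. A W \<subseteq> X}) = (\<Sum>W\<in>I. opt W)"
    unfolding opt_def by (simp add: sum.If_cases II(2) Int_def)
  moreover have "(\<Sum>b\<in>X. cp b) = (\<Sum>b\<in>X. \<Sum>W\<in>I. int (deg W b) - hv W b) - (\<Sum>b\<in>X. int (excess b + 1))"
    by (simp add: cpb sum_subtractf cong: sum.cong)
  moreover have "(\<Sum>b\<in>X. \<Sum>W\<in>I. int (deg W b) - hv W b) = (\<Sum>W\<in>I. \<Sum>b\<in>X. int (deg W b) - hv W b)"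
    by (rule sum.swap)
  moreover have "(\<Sum>W\<in>I. int (light_edges W X)) \<le> (\<Sum>W\<in>I. \<Sum>b\<in>X. int (deg W b) - hv W b)"
  proof (rule sum_mono)
    fix W
    have "int (light_edges W X) = (\<Sum>b\<in>X. if light W b then int (deg W b) else 0)"
      unfolding light_edges_def by (simp add: sum.If_cases fX Int_def)
    also have "\<dots> \<le> (\<Sum>b\<in>X. int (deg W b) - hv W b)"
      by (rule sum_mono) (auto simp: hv_def reserve_def)
    finally show "int (light_edges W X) \<le> (\<Sum>b\<in>X. int (deg W b) - hv W b)" .
  qed
  ultimately have ineq: "(\<Sum>W\<in>I. int (light_edges W X) - opt W) \<le> (\<Sum>b\<in>X. int (excess b + 1))"
    using X(3) by (simp add: sum_subtractf)
  define m where "m = (\<lambda>W. light_edges W high - \<rho> W)"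
  have CX: "light_edges W (C \<union> X) = light_edges W C + light_edges W X" for W
    by (rule light_edges_union) (use fC fX X(1) in \<open>auto simp: R_def\<close>)
  have CR: "light_edges W high = light_edges W C + light_edges W R" for W
  proof -
    have "light_edges W (C \<union> R) = light_edges W C + light_edges W R"
      by (rule light_edges_union) (use fC RV(3) in \<open>auto simp: R_def\<close>)
    moreover have "C \<union> R = high" unfolding R_def using C by blast
    ultimately show ?thesis by simp
  qed
  define dlt where "dlt = (\<lambda>W. int (min (light_edges W (C \<union> X)) (m W)) - int (min (light_edges W C) (m W)))"
  have d1: "dlt W \<le> 2 * (int (light_edges W X) - opt W)" if "W \<in> I" for W
  proof (cases "A W \<subseteq> X")
    case False then show ?thesis unfolding dlt_def opt_def CX by simp
  next
    case True
    from Aq5[OF that fX True] show ?thesis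
    proof
      assume "2 \<le> light_edges W X"
      then show ?thesis unfolding dlt_def opt_def CX using True by simp
    next
      assume "1 \<le> light_edges W X \<and> light_edges W R \<le> \<rho> W"
      moreover from this have "m W \<le> light_edges W C" unfolding m_def CR by linarith
      ultimately show ?thesis unfolding dlt_def opt_def CX using True by simp
    qed
  qed
  have d0: "dlt W = 0" if "W \<in> I0 - I" for W
  proof -
    have "light_edges W R = 0" using that unfolding I_def by simp
    moreover have "light_edges W X \<le> light_edges W R"
      unfolding light_edges_def by (rule sum_mono2) (use RV(3) X(1) in auto)
    ultimately show ?thesis unfolding dlt_def CX by simp
  qed
  have "(\<Sum>W\<in>I0. dlt W) = (\<Sum>W\<in>I. dlt W)"
    by (rule sum.mono_neutral_right[OF finI II(1)]) (use d0 in auto)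
  also have "\<dots> \<le> (\<Sum>W\<in>I. 2 * (int (light_edges W X) - opt W))" by (rule sum_mono) (rule d1)
  also have "\<dots> = 2 * (\<Sum>W\<in>I. int (light_edges W X) - opt W)" by (rule sum_distrib_left[symmetric])
  also have "\<dots> \<le> 2 * (\<Sum>b\<in>X. int (excess b + 1))" using ineq by linarith
  finally have "(\<Sum>W\<in>I0. int (min (light_edges W (C \<union> X)) (m W)))
      \<le> (\<Sum>W\<in>I0. int (min (light_edges W C) (m W))) + 2 * (\<Sum>b\<in>X. int (excess b + 1))"
    unfolding dlt_def by (simp add: sum_subtractf)
  then have "int (\<Sum>W\<in>I0. min (light_edges W (C \<union> X)) (m W))
      \<le> int ((\<Sum>W\<in>I0. min (light_edges W C) (m W)) + 2 * (\<Sum>b\<in>X. excess b + 1))"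
    unfolding of_nat_add of_nat_mult of_nat_sum by simp
  then have "(\<Sum>W\<in>I0. min (light_edges W (C \<union> X)) (m W))
      \<le> (\<Sum>W\<in>I0. min (light_edges W C) (m W)) + 2 * (\<Sum>b\<in>X. excess b + 1)"
    by (simp only: of_nat_le_iff)
  then show ?thesis using that[of X] X(1,2) unfolding m_def R_def by blast
qed

text \<open>Starting from the empty set, \<open>light_edges_step\<close> enlarges \<open>C\<close> until it is the set of all high
  vertices.\<close>

lemma light_edges_bound:
  fixes \<rho> :: "'v set \<Rightarrow> nat"
  assumes finI: "finite I0"
    and W0: "\<And>W. W \<in> I0 \<Longrightarrow> W \<subseteq> low \<and> is_clique W"
    and apart: "\<And>W W' u v. W \<in> I0 \<Longrightarrow> W' \<in> I0 \<Longrightarrow> W \<noteq> W' \<Longrightarrow> u \<in> W \<Longrightarrow> v \<in> W' \<Longrightarrow> u \<noteq> v \<and> \<not> adj u v"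
    and rho: "\<And>W t. W \<in> I0 \<Longrightarrow> t \<in> W \<Longrightarrow> card {b \<in> high. adj t b} \<le> \<rho> W"
  shows "(\<Sum>W\<in>I0. light_edges W high - \<rho> W) \<le> 2 * (\<Sum>b\<in>high. excess b + 1)"
proof -
  define m where "m = (\<lambda>W. light_edges W high - \<rho> W)"
  define inv where "inv = (\<lambda>C. (\<Sum>W\<in>I0. min (light_edges W C) (m W)) \<le> 2 * (\<Sum>b\<in>C. excess b + 1))"
  have fh: "finite high" unfolding high_def using finV by simp
  have "C \<subseteq> high \<Longrightarrow> inv C \<Longrightarrow> inv high" for C
  proof (induction "card (high - C)" arbitrary: C rule: less_induct)
    case less
    show ?case
    proof (cases "C = high")
      case True then show ?thesis using less.prems by simp
    next
      case False
      show ?thesis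
      proof (rule light_edges_step[OF finI W0 apart rho less.prems(1) False])
        fix X
        assume X: "X \<noteq> {}" "X \<subseteq> high - C"
          "(\<Sum>W\<in>I0. min (light_edges W (C \<union> X)) (light_edges W high - \<rho> W))
            \<le> (\<Sum>W\<in>I0. min (light_edges W C) (light_edges W high - \<rho> W)) + 2 * (\<Sum>b\<in>X. excess b + 1)"
        have "finite C" "finite X" using less.prems(1) X(2) fh by (meson Diff_subset finite_subset order_trans)+
        then have "(\<Sum>b\<in>C \<union> X. excess b + 1) = (\<Sum>b\<in>C. excess b + 1) + (\<Sum>b\<in>X. excess b + 1)"
          by (rule sum.union_disjoint) (use X(2) in blast)
        then have "inv (C \<union> X)" using X(3) less.prems(2) unfolding inv_def m_def by linarith
        moreover have "card (high - (C \<union> X)) < card (high - C)"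
          by (rule psubset_card_mono) (use X(1,2) fh in auto)
        moreover have "C \<union> X \<subseteq> high" using X(2) less.prems(1) by blast
        ultimately show "inv high" using less.hyps by blast
      qed
    qed
  qed
  moreover have "inv {}" unfolding inv_def light_edges_def by simp
  ultimately have "inv high" by blast
  then show ?thesis unfolding inv_def m_def by simp
qed

end

section \<open>Bounds on the total excess\<close>

context sgraph
begin

lemma is_cliqueD: "is_clique S \<Longrightarrow> u \<in> S \<Longrightarrow> v \<in> S \<Longrightarrow> u \<noteq> v \<Longrightarrow> adj u v"
  unfolding is_clique_def by blast

lemma sum_deg_swap: "finite A \<Longrightarrow> finite B \<Longrightarrow> (\<Sum>v\<in>A. deg B v) = (\<Sum>b\<in>B. deg A b)"
proof -
  assume f: "finite A" "finite B"
  have "(\<Sum>v\<in>A. deg B v) = (\<Sum>v\<in>A. \<Sum>b\<in>B. if adj v b then 1 else 0)"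
    unfolding deg_def by (simp add: sum.If_cases f Int_def)
  also have "\<dots> = (\<Sum>b\<in>B. \<Sum>v\<in>A. if adj v b then 1 else 0)" by (rule sum.swap)
  also have "\<dots> = (\<Sum>b\<in>B. deg A b)"
  proof (rule sum.cong)
    fix b
    have "A \<inter> {v. adj v b} = {v \<in> A. adj b v}" using adj_sym by blast
    then show "(\<Sum>v\<in>A. if adj v b then 1 else 0) = deg A b"
      unfolding deg_def by (simp add: sum.If_cases f)
  qed simp
  finally show ?thesis .
qed

end

context critical_cover
begin

definition total_excess :: nat where "total_excess = (\<Sum>v\<in>V. excess v)"

lemma deg_excess: "v \<in> V \<Longrightarrow> deg V v = c + excess v"
  unfolding excess_def using min_degree by simp

lemma low_finite: "finite low" "finite high" "low \<inter> high = {}" "low \<union> high = V"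
  unfolding high_def using low_subset finV finite_subset by auto

lemma excess_high: "v \<in> high \<Longrightarrow> 1 \<le> excess v"
  unfolding high_def low_def excess_def using min_degree[of v] by auto

lemma total_excess_high: "total_excess = (\<Sum>b\<in>high. excess b)"
  unfolding total_excess_def
  by (rule sum.mono_neutral_right) (use finV in \<open>auto simp: high_def low_def excess_def\<close>)

lemma card_high: "card high \<le> total_excess"
  unfolding total_excess_high using sum_mono[of high "\<lambda>_. 1" excess] excess_high by simp

lemma card_V: "card V = card low + card high"
  using card_Un_disjoint[of low high] low_finite by simp

lemma deg_low_high: "v \<in> V \<Longrightarrow> deg V v = deg low v + deg high v"
  using deg_union[of low high v] low_finite by simp

text \<open>The edges between low and high vertices, counted from both sides. A high vertex has degree
  \<open>c + excess b\<close>, which is at most \<open>(c + 1) * excess b\<close>.\<close>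

lemma slack_low: "slack (int c) low \<le> int (c + 1) * int total_excess"
proof -
  have "slack (int c) low = (\<Sum>v\<in>low. int (deg high v))"
    unfolding slack_def
  proof (rule sum.cong)
    fix v assume v: "v \<in> low"
    then show "int c - int (deg low v) = int (deg high v)"
      using low_deg[OF v] deg_low_high[of v] low_subset by auto
  qed simp
  also have "\<dots> = int (\<Sum>v\<in>low. deg high v)" by simp
  also have "(\<Sum>v\<in>low. deg high v) = (\<Sum>b\<in>high. deg low b)" by (rule sum_deg_swap) (rule low_finite)+
  also have "(\<Sum>b\<in>high. deg low b) \<le> (\<Sum>b\<in>high. (c + 1) * excess b)"
  proof (rule sum_mono)
    fix b assume b: "b \<in> high"
    have bV: "b \<in> V" using b unfolding high_def by blast
    have "deg low b \<le> c + excess b" using deg_low_high[OF bV] deg_excess[OF bV] by simp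
    moreover have "c * 1 + excess b \<le> c * excess b + excess b"
      using excess_high[OF b] by (intro add_right_mono mult_left_mono) auto
    ultimately have "deg low b \<le> c * excess b + excess b" by linarith
    then show "deg low b \<le> (c + 1) * excess b" by simp
  qed
  also have "(\<Sum>b\<in>high. (c + 1) * excess b) = (c + 1) * total_excess"
    unfolding total_excess_high by (rule sum_distrib_left[symmetric])
  finally show ?thesis by (simp only: of_nat_mult of_nat_le_iff)
qed

lemma deg_low_le: "v \<in> low \<Longrightarrow> deg low v \<le> c"
  using low_deg deg_mono[OF finV low_subset, of v] by simp

lemma gallai_excess:
  assumes c: "3 \<le> c" "c \<le> 23" and no: "\<And>S. S \<subseteq> V \<Longrightarrow> is_clique S \<Longrightarrow> card S \<noteq> c + 1" and V: "V \<noteq> {}"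
  shows "card V < 28 * total_excess"
proof (cases "low = {}")
  case True
  then have "card V \<le> total_excess" using card_V card_high by simp
  moreover have "0 < card V" using V finV by (simp add: card_gt_0_iff)
  ultimately show ?thesis by linarith
next
  case False
  have "(int (c + 1) - 1) * slack (int (c + 1) - 1) low \<ge> (int (c + 1) - 3) * int (card low) + 2 * (int (c + 1) - 1)"
    by (rule gallai_slack[OF low_finite(1) low_hereditarily_regular])
      (use c no low_subset False deg_low_le in auto)
  then have g: "int c * slack (int c) low \<ge> (int c - 2) * int (card low) + 2 * int c" by simp
  have "int c * slack (int c) low \<le> int c * (int (c + 1) * int total_excess)"
    by (rule mult_left_mono) (use slack_low in auto)
  with g have 1: "(int c - 2) * int (card low) + 2 * int c \<le> int c * (int (c + 1) * int total_excess)" by linarith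
  define x where "x = int total_excess"
  have "(int c - 2) * int (card high) \<le> (int c - 2) * x"
    using card_high c unfolding x_def by (intro mult_left_mono) auto
  with 1 have "(int c - 2) * int (card V) + 2 * int c \<le> (int c * (int c + 1) + (int c - 2)) * x"
    unfolding card_V x_def by (simp add: algebra_simps)
  also have "\<dots> \<le> ((int c - 2) * 28) * x"
  proof (rule mult_right_mono)
    have "(int c - 3) * (23 - int c) \<ge> 0" using c by simp
    then show "int c * (int c + 1) + (int c - 2) \<le> (int c - 2) * 28" using c by (simp add: algebra_simps)
  qed (simp add: x_def)
  finally have fin: "(int c - 2) * int (card V) + 2 * int c \<le> ((int c - 2) * 28) * x" .
  have "(int c - 2) * int (card V) < (int c - 2) * (28 * x)" using fin c(1) unfolding mult.assoc by linarith
  then have "int (card V) < 28 * x" using c(1) mult_less_cancel_left_pos[of "int c - 2"] by simp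
  then show ?thesis unfolding x_def by simp
qed

definition low_clique :: "'v \<Rightarrow> 'v set" where
  "low_clique t = insert t {u \<in> low. adj t u}"

definition big_cliques :: "'v set set" where
  "big_cliques = low_clique ` simplicial (c + 1) low"

text \<open>The vertices of \<open>S\<close> that have no low neighbor outside \<open>S\<close>.\<close>

definition inner :: "'v set \<Rightarrow> 'v set" where
  "inner S = {t \<in> simplicial (c + 1) low. low_clique t = S}"

lemma big_cliqueD:
  assumes "S \<in> big_cliques"
  shows "S \<subseteq> low" "finite S" "is_clique S" "3 * (c + 1) \<le> 4 * card S" "inner S \<noteq> {}"
proof -
  obtain t where t: "t \<in> simplicial (c + 1) low" "S = low_clique t" using assms unfolding big_cliques_def by blast
  show sl: "S \<subseteq> low" using t unfolding low_clique_def simplicial_def by blast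
  then show fS: "finite S" using low_finite(1) finite_subset by blast
  show cl: "is_clique S" using t unfolding low_clique_def simplicial_def by blast
  have "card S = deg low t + 1" unfolding t(2) low_clique_def deg_def
    using adj_irrefl low_finite by simp
  then show "3 * (c + 1) \<le> 4 * card S" using t unfolding simplicial_def by simp
  show "inner S \<noteq> {}" using t unfolding inner_def by blast
qed

lemma inner_subset: "inner S \<subseteq> S" unfolding inner_def low_clique_def by blast

lemma inner_neighbors: "t \<in> inner S \<Longrightarrow> u \<in> low \<Longrightarrow> adj t u \<Longrightarrow> u \<in> S"
  unfolding inner_def low_clique_def by blast

text \<open>Two large cliques with a single common vertex would give it a low degree above \<open>c\<close>. With two common
  vertices, one clique together with a vertex of the other is two-connected but not regular.\<close>

lemma big_cliques_disjoint:
  assumes S: "S \<in> big_cliques" "S' \<in> big_cliques" "S \<noteq> S'" and c: "15 \<le> c"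
  shows "S \<inter> S' = {}"
proof (rule ccontr)
  assume ne: "S \<inter> S' \<noteq> {}"
  note D = big_cliqueD[OF S(1)] and D' = big_cliqueD[OF S(2)]
  obtain t where t: "t \<in> inner S" using D by blast
  obtain t' where t': "t' \<in> inner S'" using D' by blast
  have tS: "t \<in> S" "t' \<in> S'" using t t' inner_subset by blast+
  have absorb: "U \<subseteq> U'" if "U \<in> big_cliques" "v \<in> U" "v \<in> inner U'" for U U' v
  proof
    fix u assume u: "u \<in> U"
    note E = big_cliqueD[OF that(1)]
    show "u \<in> U'"
    proof (cases "u = v")
      case True then show ?thesis using subsetD[OF inner_subset that(3)] by simp
    next
      case False
      then have vu: "adj v u" using E(3) that(2) u unfolding is_clique_def by metis
      show ?thesis by (rule inner_neighbors[OF that(3) subsetD[OF E(1) u] vu])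
    qed
  qed
  have t'S: "t' \<notin> S"
  proof
    assume a: "t' \<in> S"
    have "S \<subseteq> S'" by (rule absorb[OF S(1) a t'])
    moreover from this have "S' \<subseteq> S" using absorb[OF S(2) _ t] tS by blast
    ultimately show False using S(3) by blast
  qed
  have nadj: "\<not> adj t t'" using inner_neighbors[OF t] t'S tS D'(1) by blast
  obtain x where x: "x \<in> S" "x \<in> S'" using ne by blast
  have xt: "x \<noteq> t'" using x t'S by blast
  have t'x: "adj t' x" by (rule is_cliqueD[OF D'(3) tS(2) x(2)]) (use xt in simp)
  show False
  proof (cases "\<exists>y\<in>S \<inter> S'. y \<noteq> x")
    case True
    then obtain y where y: "y \<in> S" "y \<in> S'" "y \<noteq> x" by blast
    have t'y: "adj t' y" by (rule is_cliqueD[OF D'(3) tS(2) y(2)]) (use y(1) t'S in blast)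
    have tc: "two_connected (insert t' S)"
      by (rule two_connected_insert[OF clique_two_connected[OF D(3)] x(1) y(1) _ t'x t'y]) (use y(3) in simp)
    have "insert t' S \<subseteq> low" using D(1) D'(1) tS by blast
    then have "deg (insert t' S) t = deg (insert t' S) x"
      using hereditarily_regularD[OF low_hereditarily_regular _ tc] tS x by blast
    moreover have "deg (insert t' S) t = card S - 1"
      using deg_insert_not_adj[OF nadj] deg_clique[OF D(2,3) tS(1)] by simp
    moreover have "deg (insert t' S) x = card S - 1 + 1"
      using deg_insert_adj[OF D(2) t'S adj_sym[OF t'x]] deg_clique[OF D(2,3) x(1)] by simp
    ultimately show False by simp
  next
    case False
    then have int: "S \<inter> S' = {x}" using x by blast
    have "S \<union> S' - {x} \<subseteq> {u \<in> low. adj x u}"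
      using D(1) D'(1) is_cliqueD[OF D(3) x(1)] is_cliqueD[OF D'(3) x(2)] by blast
    then have "card (S \<union> S' - {x}) \<le> deg low x"
      unfolding deg_def by (intro card_mono) (use low_finite in auto)
    moreover have "card (S \<union> S') + 1 = card S + card S'" using card_Un_Int[OF D(2) D'(2)] int by simp
    moreover have "card (S \<union> S') = Suc (card (S \<union> S' - {x}))"
      by (rule card.remove) (use x D(2) D'(2) in auto)
    moreover have "deg low x \<le> c" using deg_low_le x D(1) by blast
    ultimately have "card S + card S' \<le> c + 2" by simp
    moreover have "3 * c + 3 \<le> 4 * card S" "3 * c + 3 \<le> 4 * card S'" using D(4) D'(4) by simp_all
    ultimately show False using c by linarith
  qed
qed

lemma inner_deg_high: 
  assumes "S \<in> big_cliques" "t \<in> inner S"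
  shows "deg high t + card S = c + 1"
proof -
  have t: "t \<in> low" using assms big_cliqueD(1) inner_subset by blast
  then have "t \<in> V" using low_subset by blast
  then have "deg low t + deg high t = c" using deg_low_high[of t] low_deg[OF t] by simp
  moreover have "card S = deg low t + 1"
  proof -
    have "S = insert t {u \<in> low. adj t u}" using assms(2) unfolding inner_def low_clique_def by blast
    then show ?thesis unfolding deg_def using adj_irrefl low_finite by simp
  qed
  ultimately show ?thesis by simp
qed

text \<open>Some \<open>t0\<close> has no light neighbor, so its high neighbors see all of \<open>W\<close> or all but one vertex. In
  the latter case \<open>partial_neighbor_excess\<close> applies. In the former all
  vertices of \<open>W\<close> have the same neighbors outside \<open>W\<close>. With \<open>W\<close> these form a set of \<open>c + 1\<close> vertices,
  which is not a clique, and \<open>common_neighbors_excess\<close> applies to two nonadjacent ones.\<close>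

lemma rich_neighbor:
  assumes S: "S \<in> big_cliques" and few: "light_edges (inner S) high < card (inner S)"
    and w2: "2 \<le> card (inner S)"
    and no: "\<And>S. S \<subseteq> V \<Longrightarrow> is_clique S \<Longrightarrow> card S \<noteq> c + 1"
  shows "\<exists>b\<in>high. deg (inner S) b + 1 = card (inner S) \<and> card (inner S) \<le> excess b + 2 \<or>
      deg (inner S) b = card (inner S) \<and> card (inner S) \<le> 2 * excess b + 1"
proof -
  define W where "W = inner S"
  note D = big_cliqueD[OF S]
  have WS: "W \<subseteq> S" unfolding W_def by (rule inner_subset)
  have Wlow: "W \<subseteq> low" and Wcl: "is_clique W" and fW: "finite W"
    using WS D clique_subset finite_subset by blast+
  have dle: "deg W b \<le> card W" for b unfolding deg_def by (rule card_mono) (use fW in auto)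
  have hV: "b \<in> V" "b \<notin> W" if "b \<in> high" for b using that Wlow unfolding high_def by blast+
  show ?thesis unfolding W_def[symmetric]
  proof (cases "\<exists>b\<in>high. deg W b + 1 = card W")
    case True
    then obtain b where b: "b \<in> high" "deg W b + 1 = card W" by blast
    obtain t where t: "t \<in> W" "adj t b"
    proof -
      have "1 \<le> deg W b" using b(2) w2 unfolding W_def by simp
      then show ?thesis using that deg_pos[OF fW] adj_sym by blast
    qed
    obtain t' where t': "t' \<in> W" "\<not> adj t' b"
    proof (rule ccontr)
      assume "\<not> thesis"
      then have "{u \<in> W. adj b u} = W" using that adj_sym by blast
      then show False using b(2) unfolding deg_def by simp
    qed
    have "deg W b + c \<le> deg V b + 1"
      by (rule partial_neighbor_excess[OF Wlow Wcl hV[OF b(1)] t t'])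
    then have "card W \<le> excess b + 2" using b deg_excess[OF hV(1)[OF b(1)]] by simp
    then show "\<exists>b\<in>high. deg W b + 1 = card W \<and> card W \<le> excess b + 2 \<or> deg W b = card W \<and> card W \<le> 2 * excess b + 1"
      using b by blast
  next
    case False
    obtain t0 where t0: "t0 \<in> W" "\<And>b. b \<in> high \<Longrightarrow> adj t0 b \<Longrightarrow> \<not> light W b"
    proof (rule ccontr)
      assume n: "\<not> thesis"
      have "card W = (\<Sum>t\<in>W. 1)" by simp
      also have "\<dots> \<le> (\<Sum>t\<in>W. card {b \<in> high. light W b \<and> adj t b})"
      proof (rule sum_mono)
        fix t assume "t \<in> W"
        then have "{b \<in> high. light W b \<and> adj t b} \<noteq> {}" using n that[of t] by blast
        then have "0 < card {b \<in> high. light W b \<and> adj t b}"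
          using low_finite(2) by (simp add: card_gt_0_iff)
        then show "1 \<le> card {b \<in> high. light W b \<and> adj t b}" by simp
      qed
      also have "\<dots> = light_edges W high" by (rule light_edges_alt[OF fW low_finite(2), symmetric])
      finally show False using few unfolding W_def by simp
    qed
    define N where "N = {b \<in> high. adj t0 b}"
    have fN: "finite N" "N \<subseteq> high" unfolding N_def using low_finite(2) by auto
    have Nfull: "deg W b = card W" if b: "b \<in> N" for b
    proof -
      have "\<not> deg W b + 2 \<le> card W" using t0(2)[of b] b unfolding N_def light_def by blast
      moreover have "deg W b + 1 \<noteq> card W" using False b fN(2) by blast
      ultimately show ?thesis using dle[of b] by linarith
    qed
    have Nadj: "adj t b" if "b \<in> N" "t \<in> W" for b t
    proof -
      have "{u \<in> W. adj b u} = W"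
        by (rule card_subset_eq[OF fW]) (use Nfull[OF that(1)] in \<open>auto simp: deg_def\<close>)
      then show ?thesis using that(2) adj_sym by blast
    qed
    have "card N + card S = c + 1" using inner_deg_high[OF S, of t0] t0(1) unfolding N_def W_def deg_def by simp
    moreover have "S \<inter> N = {}" using D(1) fN(2) unfolding high_def by blast
    ultimately have "card (S \<union> N) = c + 1" using card_Un_disjoint[OF D(2) fN(1)] by simp
    then have "\<not> is_clique (S \<union> N)" using no[of "S \<union> N"] D(1) fN(2) low_finite(4) by blast
    then obtain z z' where z: "z \<in> S \<union> N" "z' \<in> S \<union> N" "z \<noteq> z'" "\<not> adj z z'" unfolding is_clique_def by blast
    have adjW: "adj t u" if "t \<in> W" "u \<in> S \<union> N" "u \<noteq> t" for t u
    proof (cases "u \<in> N")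
      case True then show ?thesis using Nadj that(1) by blast
    next
      case False
      then have "u \<in> S" "t \<in> S" using that(1,2) WS by blast+
      then show ?thesis using is_cliqueD[OF D(3)] that(3) by metis
    qed
    have zW: "z \<notin> W" "z' \<notin> W" using adjW z adj_sym by metis+
    have zV: "z \<in> V" "z' \<in> V" using z D(1) fN(2) low_finite(4) by blast+
    have "2 * c + card W \<le> deg V z + deg V z' + 1"
      by (rule common_neighbors_excess[OF Wlow Wcl t0(1) zV zW z(3,4)]) (use adjW z zW in metis)
    then have ex: "card W \<le> excess z + excess z' + 1" using deg_excess zV by simp
    have "\<exists>u\<in>N. card W \<le> 2 * excess u + 1"
    proof -
      have pos: "u \<in> N" if u: "u \<in> S \<union> N" "card W \<le> 2 * excess u + 1" for u
      proof (rule ccontr)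
        assume "u \<notin> N"
        then have "u \<in> low" using u D(1) by blast
        then have "excess u = 0" unfolding excess_def using low_deg by simp
        then show False using u w2 unfolding W_def by simp
      qed
      have "card W \<le> 2 * excess z + 1 \<or> card W \<le> 2 * excess z' + 1" using ex by linarith
      then show ?thesis using pos z by blast
    qed
    then show "\<exists>b\<in>high. deg W b + 1 = card W \<and> card W \<le> excess b + 2 \<or> deg W b = card W \<and> card W \<le> 2 * excess b + 1"
      using Nfull fN(2) by blast
  qed
qed

text \<open>A vertex \<open>b\<close> of excess \<open>x\<close> has degree \<open>cc + x\<close>, so \<open>d * (x / (cc + x))\<close> is the part of its excess that
  falls to a clique of \<open>s\<close> vertices to whose \<open>w\<close> inner vertices it sends \<open>d\<close> edges. The bound is the
  linear one that fits the final summation.\<close>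

lemma share_bound:
  fixes w s x d cc :: real
  assumes s: "12 \<le> s" "w \<le> s" "s < 2 * w" and cc: "3 * (cc + 1) \<le> 4 * s" "0 < cc + x" "0 \<le> x" "0 \<le> cc"
    and r: "d + 1 = w \<and> w \<le> x + 2 \<or> d = w \<and> w \<le> 2 * x + 1"
  shows "w / 2 - s / 4 \<le> d * (x / (cc + x))"
proof -
  have cs: "cc \<le> 4 * s / 3 - 1" using cc by simp
  have cancel: "B \<le> A" if "0 < m" "0 \<le> m * (A - B)" for A B m :: real
    using that by (simp add: zero_le_mult_iff)
  have "(2 * w - s) * (cc + x) \<le> 4 * d * x"
    using r
  proof
    assume h: "d = w \<and> w \<le> 2 * x + 1"
    have "(2 * w - s) * cc \<le> (2 * w - s) * (4 * s / 3 - 1)" by (rule mult_left_mono) (use cs s in auto)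
    also have "\<dots> \<le> (2 * w + s) * ((w - 1) / 2)"
    proof -
      have "6 * ((2 * w + s) * ((w - 1) / 2) - (2 * w - s) * (4 * s / 3 - 1)) =
          6 * (w - 13 / 12 * s)\<^sup>2 + (23 / 24 * s - 9) * s + 6 * w"
        by (simp add: power2_eq_square field_simps)
      also have "\<dots> \<ge> 0" using s by simp
      finally show ?thesis by (rule cancel[rotated]) simp
    qed
    also have "\<dots> \<le> (2 * w + s) * x" by (rule mult_left_mono) (use h s in auto)
    finally show ?thesis using h by (simp add: algebra_simps)
  next
    assume h: "d + 1 = w \<and> w \<le> x + 2"
    then have d: "d = w - 1" by simp
    have "(2 * w - s) * cc \<le> (2 * w - s) * (4 * s / 3 - 1)" by (rule mult_left_mono) (use cs s in auto)
    also have "\<dots> \<le> (2 * w + s - 4) * (w - 2)"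
    proof -
      have "3 * ((2 * w + s - 4) * (w - 2) - (2 * w - s) * (4 * s / 3 - 1)) =
          6 * (w - 5 / 12 * s)\<^sup>2 + (71 / 24 * s - 27) * s + 18 * (s - w) + 24"
        by (simp add: power2_eq_square field_simps)
      also have "\<dots> \<ge> 0" using s by simp
      finally show ?thesis by (rule cancel[rotated]) simp
    qed
    also have "\<dots> \<le> (2 * w + s - 4) * x" by (rule mult_left_mono) (use h s in auto)
    finally show ?thesis unfolding d by (simp add: algebra_simps)
  qed
  then show ?thesis using cc(2) by (simp add: field_simps)
qed

text \<open>Every large clique \<open>S\<close> with \<open>w\<close> inner vertices is paid for by light edges or by a rich
  neighbor; the two linear bounds combine to \<open>2 * w - card S\<close> summing to at most 10 times the total
  excess. The inner vertices are the simplicial ones, which by \<open>simplicial_many\<close> and \<open>slack_low\<close> are all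
  but 6 times the total excess of the low vertices. Hence there are at most 22 times as many low
  vertices as the total excess.\<close>

lemma large_excess:
  assumes c: "15 \<le> c" and no: "\<And>S. S \<subseteq> V \<Longrightarrow> is_clique S \<Longrightarrow> card S \<noteq> c + 1"
  shows "card V \<le> 23 * total_excess"
proof -
  define x where "x = real total_excess"
  define Q where "Q = big_cliques"
  define w where "w = (\<lambda>S. real (card (inner S)))"
  define s where "s = (\<lambda>S :: 'v set. real (card S))"
  define Q1 where "Q1 = {S \<in> Q. card (inner S) \<le> light_edges (inner S) high}"
  have fgood: "finite (simplicial (c + 1) low)" using low_finite unfolding simplicial_def by simp
  have fQ: "finite Q" unfolding Q_def big_cliques_def using fgood by simp
  note D = big_cliqueD[folded Q_def]
  have fin_inner: "finite (inner S)" if "S \<in> Q" for S using D(2)[OF that] inner_subset finite_subset by blast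
  have ws: "w S \<le> s S" if "S \<in> Q" for S
    unfolding w_def s_def using card_mono[OF D(2)[OF that] inner_subset] by simp
  have s34: "3 * (real c + 1) \<le> 4 * s S" if "S \<in> Q" for S
  proof -
    have "real (3 * (c + 1)) \<le> real (4 * card S)" using D(4)[OF that] by (simp only: of_nat_le_iff)
    then show ?thesis unfolding s_def by simp
  qed
  have disj: "S \<inter> S' = {}" if "S \<in> Q" "S' \<in> Q" "S \<noteq> S'" for S S'
    using big_cliques_disjoint that c unfolding Q_def by blast
  have apart: "u \<noteq> v \<and> \<not> adj u v" if "S \<in> Q" "S' \<in> Q" "S \<noteq> S'" "u \<in> inner S" "v \<in> inner S'" for S S' u v
    using disj[OF that(1-3)] inner_neighbors[OF that(4), of v] inner_subset[of S] inner_subset[of S'] that D(1)[OF that(2)] by blast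
  have inj: "inj_on inner Q"
  proof (rule inj_onI, rule ccontr)
    fix S S' assume a: "S \<in> Q" "S' \<in> Q" "inner S = inner S'" "S \<noteq> S'"
    then show False using disj[OF a(1,2,4)] inner_subset[of S] inner_subset[of S'] D(5)[OF a(1)] by blast
  qed
  \<comment> \<open>As \<open>card S\<close> is at least three times \<open>c + 1 - card S\<close>, the light edges that remain after the
    subtraction of \<open>\<rho>\<close> still pay for the clique.\<close>
  have I: "(\<Sum>S\<in>Q1. w S - s S / 3) \<le> 4 * x"
  proof -
    define \<rho> where "\<rho> = (\<lambda>W. Max ((\<lambda>t. deg high t) ` W))"
    have rho: "\<rho> (inner S) + card S = c + 1" if S: "S \<in> Q" for S
    proof -
      have dt: "deg high t = c + 1 - card S" if "t \<in> inner S" for t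
        using inner_deg_high[OF _ that] S unfolding Q_def by simp
      have "\<rho> (inner S) = c + 1 - card S" unfolding \<rho>_def
        by (rule Max_eqI) (use fin_inner[OF S] dt D(5)[OF S] in auto)
      moreover obtain t where "t \<in> inner S" using D(5)[OF S] by blast
      then have "card S \<le> c + 1" using inner_deg_high[of S t] S unfolding Q_def by simp
      ultimately show ?thesis by simp
    qed
    have "(\<Sum>W\<in>inner ` Q1. light_edges W high - \<rho> W) \<le> 2 * (\<Sum>b\<in>high. excess b + 1)"
    proof (rule light_edges_bound)
      show "finite (inner ` Q1)" unfolding Q1_def using fQ by simp
      show "W \<subseteq> low \<and> is_clique W" if W: "W \<in> inner ` Q1" for W
      proof -
        obtain S where S: "S \<in> Q" "W = inner S" using W unfolding Q1_def by blast
        then show ?thesis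
          using order_trans[OF inner_subset D(1)[OF S(1)]] clique_subset[OF D(3)[OF S(1)] inner_subset] by simp
      qed
      show "u \<noteq> v \<and> \<not> adj u v"
        if WW: "W \<in> inner ` Q1" "W' \<in> inner ` Q1" "W \<noteq> W'" "u \<in> W" "v \<in> W'" for W W' u v
      proof -
        obtain S S' where "S \<in> Q" "S' \<in> Q" "W = inner S" "W' = inner S'" "S \<noteq> S'"
          using WW(1,2,3) unfolding Q1_def by blast
        then show ?thesis using apart[of S S' u v] WW(4,5) by simp
      qed
      show "card {b \<in> high. adj t b} \<le> \<rho> W" if "W \<in> inner ` Q1" "t \<in> W" for W t
      proof -
        have "finite W" using that(1) fin_inner unfolding Q1_def by blast
        then show ?thesis unfolding \<rho>_def deg_def using that(2) by (intro Max_ge) auto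
      qed
    qed
    also have "2 * (\<Sum>b\<in>high. excess b + 1) \<le> 4 * total_excess"
      using card_high unfolding total_excess_high by (simp add: sum_Suc)
    finally have "(\<Sum>W\<in>inner ` Q1. light_edges W high - \<rho> W) \<le> 4 * total_excess" .
    moreover have "inj_on inner Q1" by (rule inj_on_subset[OF inj]) (auto simp: Q1_def)
    ultimately have "(\<Sum>S\<in>Q1. light_edges (inner S) high - \<rho> (inner S)) \<le> 4 * total_excess"
      by (simp add: sum.reindex)
    then have "real (\<Sum>S\<in>Q1. light_edges (inner S) high - \<rho> (inner S)) \<le> 4 * x"
      unfolding x_def by linarith
    moreover have "(\<Sum>S\<in>Q1. w S - s S / 3) \<le> (\<Sum>S\<in>Q1. real (light_edges (inner S) high - \<rho> (inner S)))"
    proof (rule sum_mono)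
      fix S assume S: "S \<in> Q1"
      then have SQ: "S \<in> Q" "card (inner S) \<le> light_edges (inner S) high" unfolding Q1_def by auto
      define g where "g = light_edges (inner S) high - \<rho> (inner S)"
      have "card (inner S) + card S \<le> g + (c + 1)"
        using rho[OF SQ(1)] SQ(2) unfolding g_def by linarith
      then have "w S + s S \<le> real g + (real c + 1)"
        unfolding w_def s_def by linarith
      then show "w S - s S / 3 \<le> real (light_edges (inner S) high - \<rho> (inner S))"
        using s34[OF SQ(1)] unfolding g_def[symmetric] by (simp add: field_simps)
    qed
    ultimately show ?thesis by simp
  qed
  \<comment> \<open>The others have a neighbor of large excess, which shares its excess among its low neighbors.\<close>
  have II: "(\<Sum>S\<in>Q - Q1. w S / 2 - s S / 4) \<le> x"
  proof -
    define sh where "sh = (\<lambda>b. real (excess b) / (real c + real (excess b)))"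
    have sh0: "0 \<le> sh b" for b unfolding sh_def by simp
    have "(\<Sum>S\<in>Q - Q1. w S / 2 - s S / 4) \<le> (\<Sum>S\<in>Q - Q1. \<Sum>b\<in>high. real (deg (inner S) b) * sh b)"
    proof (rule sum_mono)
      fix S assume "S \<in> Q - Q1"
      then have S: "S \<in> Q" "light_edges (inner S) high < card (inner S)" unfolding Q1_def by auto
      show "w S / 2 - s S / 4 \<le> (\<Sum>b\<in>high. real (deg (inner S) b) * sh b)"
      proof (cases "s S < 2 * w S")
        case False
        have "0 \<le> (\<Sum>b\<in>high. real (deg (inner S) b) * sh b)" by (rule sum_nonneg) (use sh0 in simp)
        then show ?thesis using False by linarith
      next
        case True
        have s12: "12 \<le> s S" using D(4)[OF S(1)] c unfolding s_def by simp
        then have "2 \<le> card (inner S)" using True unfolding w_def by linarith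
        then obtain b where b: "b \<in> high"
          "deg (inner S) b + 1 = card (inner S) \<and> card (inner S) \<le> excess b + 2 \<or>
           deg (inner S) b = card (inner S) \<and> card (inner S) \<le> 2 * excess b + 1"
          using rich_neighbor[OF _ S(2) _ no] S(1) unfolding Q_def by blast
        have "w S / 2 - s S / 4 \<le> real (deg (inner S) b) * sh b"
          unfolding sh_def
        proof (rule share_bound[OF s12 ws[OF S(1)] True s34[OF S(1)]])
          show "real (deg (inner S) b) + 1 = w S \<and> w S \<le> real (excess b) + 2 \<or>
              real (deg (inner S) b) = w S \<and> w S \<le> 2 * real (excess b) + 1"
            using b(2) unfolding w_def by linarith
        qed (use c in auto)
        also have "\<dots> \<le> (\<Sum>b\<in>high. real (deg (inner S) b) * sh b)"
          by (rule member_le_sum[OF b(1)]) (use sh0 low_finite in auto)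
        finally show ?thesis .
      qed
    qed
    also have "\<dots> = (\<Sum>b\<in>high. \<Sum>S\<in>Q - Q1. real (deg (inner S) b) * sh b)" by (rule sum.swap)
    also have "\<dots> \<le> (\<Sum>b\<in>high. real (excess b))"
    proof (rule sum_mono)
      fix b assume b: "b \<in> high"
      have bV: "b \<in> V" using b unfolding high_def by blast
      have "(\<Sum>S\<in>Q - Q1. deg (inner S) b) = card (\<Union>S\<in>Q - Q1. {u \<in> inner S. adj b u})"
        unfolding deg_def
      proof (rule card_UN_disjoint[symmetric])
        show "finite (Q - Q1)" using fQ by simp
        show "\<forall>S\<in>Q - Q1. finite {u \<in> inner S. adj b u}" using fin_inner by auto
        show "\<forall>S\<in>Q - Q1. \<forall>S'\<in>Q - Q1. S \<noteq> S' \<longrightarrow> {u \<in> inner S. adj b u} \<inter> {u \<in> inner S'. adj b u} = {}"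
          using disj inner_subset by blast
      qed
      also have "\<dots> \<le> deg V b" unfolding deg_def
      proof (rule card_mono)
        show "(\<Union>S\<in>Q - Q1. {u \<in> inner S. adj b u}) \<subseteq> {u \<in> V. adj b u}"
          using order_trans[OF inner_subset order_trans[OF D(1) low_subset]] by blast
      qed (use finV in simp)
      finally have "(\<Sum>S\<in>Q - Q1. deg (inner S) b) \<le> c + excess b" using deg_excess[OF bV] by simp
      then have le: "real (\<Sum>S\<in>Q - Q1. deg (inner S) b) \<le> real c + real (excess b)" by linarith
      have "(\<Sum>S\<in>Q - Q1. real (deg (inner S) b) * sh b) = real (\<Sum>S\<in>Q - Q1. deg (inner S) b) * sh b"
        by (simp add: sum_distrib_right)
      also have "\<dots> \<le> (real c + real (excess b)) * sh b" by (rule mult_right_mono[OF le sh0])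
      also have "\<dots> = real (excess b)" unfolding sh_def using c by simp
      finally show "(\<Sum>S\<in>Q - Q1. real (deg (inner S) b) * sh b) \<le> real (excess b)" .
    qed
    also have "\<dots> = x" unfolding x_def total_excess_high by simp
    finally show ?thesis .
  qed
  have "(\<Sum>S\<in>Q. 2 * w S - s S) = (\<Sum>S\<in>Q - Q1. 2 * w S - s S) + (\<Sum>S\<in>Q1. 2 * w S - s S)"
    by (rule sum.subset_diff) (use fQ in \<open>auto simp: Q1_def\<close>)
  also have "(\<Sum>S\<in>Q - Q1. 2 * w S - s S) = (\<Sum>S\<in>Q - Q1. 4 * (w S / 2 - s S / 4))" by simp
  also have "\<dots> = 4 * (\<Sum>S\<in>Q - Q1. w S / 2 - s S / 4)" by (rule sum_distrib_left[symmetric])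
  also have "(\<Sum>S\<in>Q1. 2 * w S - s S) \<le> (\<Sum>S\<in>Q1. 3 / 2 * (w S - s S / 3))"
    by (rule sum_mono) (use ws in \<open>auto simp: Q1_def\<close>)
  also have "\<dots> = 3 / 2 * (\<Sum>S\<in>Q1. w S - s S / 3)" by (rule sum_distrib_left[symmetric])
  finally have "(\<Sum>S\<in>Q. 2 * w S - s S)
      \<le> 4 * (\<Sum>S\<in>Q - Q1. w S / 2 - s S / 4) + 3 / 2 * (\<Sum>S\<in>Q1. w S - s S / 3)" by simp
  then have "(\<Sum>S\<in>Q. 2 * w S - s S) \<le> 10 * x" using I II by linarith
  moreover have "(\<Sum>S\<in>Q. 2 * w S - s S) = 2 * (\<Sum>S\<in>Q. w S) - (\<Sum>S\<in>Q. s S)"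
    by (simp add: sum_subtractf sum_distrib_left)
  ultimately have main: "2 * (\<Sum>S\<in>Q. w S) - (\<Sum>S\<in>Q. s S) \<le> 10 * x" by linarith
  have "(\<Sum>S\<in>Q. card (inner S)) = card (\<Union>S\<in>Q. inner S)"
    by (rule card_UN_disjoint[symmetric]) (use fQ fin_inner disj inner_subset in blast)+
  moreover have "(\<Union>S\<in>Q. inner S) = simplicial (c + 1) low"
    unfolding Q_def big_cliques_def inner_def by blast
  ultimately have good: "(\<Sum>S\<in>Q. w S) = real (card (simplicial (c + 1) low))"
    unfolding w_def by (simp flip: of_nat_sum)
  have "(\<Sum>S\<in>Q. card S) = card (\<Union>S\<in>Q. S)"
    by (rule card_UN_disjoint[symmetric]) (use fQ D(2) disj in auto)
  also have "\<dots> \<le> card low" by (rule card_mono) (use low_finite D(1) in auto)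
  finally have cover: "(\<Sum>S\<in>Q. s S) \<le> real (card low)" unfolding s_def by (simp flip: of_nat_sum)
  have "6 * slack (int (c + 1) - 1) low + int (c + 1) * int (card (simplicial (c + 1) low)) \<ge> int (c + 1) * int (card low)"
    by (rule simplicial_many[OF low_finite(1) low_hereditarily_regular])
      (use c no low_subset deg_low_le in auto)
  then have "int (c + 1) * int (card low) \<le> 6 * slack (int c) low + int (c + 1) * int (card (simplicial (c + 1) low))" by simp
  also have "\<dots> \<le> int (c + 1) * (6 * int total_excess + int (card (simplicial (c + 1) low)))"
    using slack_low by (simp add: algebra_simps)
  finally have "int (card low) \<le> 6 * int total_excess + int (card (simplicial (c + 1) low))"
    by (simp only: mult_le_cancel_left)
  then have "real (card low) \<le> 6 * x + real (card (simplicial (c + 1) low))" unfolding x_def by linarith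
  then have "real (card low) \<le> 22 * x" using main good cover by linarith
  then have "card low \<le> 22 * total_excess" unfolding x_def by linarith
  then show ?thesis using card_V card_high by linarith
qed

end

section \<open>Minimal triples\<close>

definition adjacent :: "('v, 'e) mgraph \<Rightarrow> 'v \<Rightarrow> 'v \<Rightarrow> bool" where
  "adjacent G u v \<longleftrightarrow> (\<exists>e\<in>edges G. ends G e = {u, v} \<and> u \<noteq> v)"

definition conflict ::
    "('v, 'e) mgraph \<Rightarrow> ('w, 'f) mgraph \<Rightarrow> ('v \<Rightarrow> 'w set) \<Rightarrow> 'v \<Rightarrow> 'w \<Rightarrow> 'v \<Rightarrow> 'w \<Rightarrow> bool" where
  "conflict G H L u x v y \<longleftrightarrow> u \<in> verts G \<and> v \<in> verts G \<and> x \<in> L u \<and> y \<in> L v \<and> u \<noteq> v \<and>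
     (\<exists>e\<in>edges H. ends H e = {x, y})"

lemma sgraph_adjacent: "sgraph (adjacent G)"
  by unfold_locales (auto simp: adjacent_def insert_commute)

lemma edges_between_le1: "simple_graph G \<Longrightarrow> card (edges_between G u v) \<le> 1"
proof -
  assume s: "simple_graph G"
  show ?thesis
  proof (cases "edges_between G u v = {}")
    case False
    then obtain e where e: "e \<in> edges G" "ends G e = {u, v}" unfolding edges_between_def by blast
    have "edges_between G u v \<subseteq> {e}"
      using s e unfolding simple_graph_def edges_between_def inj_on_def by auto
    then have "card (edges_between G u v) \<le> card {e}" by (intro card_mono) auto
    then show ?thesis by simp
  qed (metis card.empty zero_le)
qed

text \<open>As \<open>G\<close> is simple, the union of matchings over a pair of vertices is a single matching, or empty.\<close>

lemma conflict_matching: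
  assumes G: "simple_graph G" and cover: "correspondence_cover G H L"
    and u: "u \<in> verts G" "v \<in> verts G" "u \<noteq> v"
  shows "\<exists>M. matching (induced H (L u \<union> L v)) M \<and> edges (induced H (L u \<union> L v)) \<subseteq> M
    \<and> (\<not> adjacent G u v \<longrightarrow> M = {})"
proof -
  let ?H = "induced H (L u \<union> L v)"
  have "union_of_matchings (card (edges_between G u v)) ?H"
    using cover u unfolding correspondence_cover_def by simp
  then obtain M where M: "\<forall>i<card (edges_between G u v). matching ?H (M i)"
    "edges ?H = (\<Union>i<card (edges_between G u v). M i)"
    unfolding union_of_matchings_def by auto
  have "card (edges_between G u v) = 0 \<or> card (edges_between G u v) = 1"
    using edges_between_le1[OF G, of u v] by linarith
  then show ?thesis
  proof
    assume "card (edges_between G u v) = 0"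
    then have "edges ?H = {}" using M(2) by simp
    then show ?thesis by (intro exI[of _ "{}"]) (simp add: matching_def)
  next
    assume one: "card (edges_between G u v) = 1"
    then have "edges_between G u v \<noteq> {}" by auto
    then have "adjacent G u v" using u(3) unfolding adjacent_def edges_between_def by blast
    moreover have "matching ?H (M 0)" "edges ?H = M 0" using M one by auto
    ultimately show ?thesis by blast
  qed
qed

lemma conflict_edge:
  "conflict G H L u x v y \<Longrightarrow> \<exists>e\<in>edges (induced H (L u \<union> L v)). ends (induced H (L u \<union> L v)) e = {x, y}"
  unfolding conflict_def induced_def by auto

text \<open>To color all vertices but \<open>v\<close>, use the coloring that exists after the deletion of an edge of \<open>H\<close>
  that meets the list of \<open>v\<close>: this edge cannot join two colors taken from the other lists.\<close>

lemma critical_cover_of_minimal_triple: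
  assumes G: "simple_graph G" and min: "minimal_triple G H L" and meet: "every_list_meets_edge G H L"
    and size: "\<forall>v\<in>verts G. card (L v) = c" "0 < c"
  shows "critical_cover (adjacent G) (verts G) L (conflict G H L) c"
proof -
  have cover: "correspondence_cover G H L" using min unfolding minimal_triple_def by blast
  have mG: "multigraph G" and mH: "multigraph H" using cover unfolding correspondence_cover_def by auto
  have disj: "disjoint_family_on L (verts G)" and part: "(\<Union>v\<in>verts G. L v) = verts H"
    using cover unfolding correspondence_cover_def by auto
  interpret sgraph "adjacent G" by (rule sgraph_adjacent)
  interpret cover "adjacent G" "verts G" L "conflict G H L" c
  proof unfold_locales
    show "finite (verts G)" using mG unfolding multigraph_def by blast
    show "finite (L v)" "card (L v) = c" if "v \<in> verts G" for v
      using size that card_ge_0_finite by force+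
    show "conflict G H L v y u x" if "conflict G H L u x v y" for u x v y
      using that unfolding conflict_def by (auto simp: insert_commute)
    show "adjacent G u v" if a: "conflict G H L u x v y" for u x v y
    proof (rule ccontr)
      assume n: "\<not> adjacent G u v"
      have "u \<in> verts G" "v \<in> verts G" "u \<noteq> v" using a unfolding conflict_def by auto
      then have "edges (induced H (L u \<union> L v)) = {}" using conflict_matching[OF G cover] n by blast
      then show False using conflict_edge[OF a] by blast
    qed
    show "y = y'" if a: "conflict G H L u x v y" "conflict G H L u x v y'" for u x v y y'
    proof -
      let ?H = "induced H (L u \<union> L v)"
      have "u \<in> verts G" "v \<in> verts G" "u \<noteq> v" using a unfolding conflict_def by auto
      then obtain M where M: "matching ?H M" "edges ?H \<subseteq> M" using conflict_matching[OF G cover] by blast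
      obtain e e' where e: "e \<in> edges ?H" "ends ?H e = {x, y}" "e' \<in> edges ?H" "ends ?H e' = {x, y'}"
        using conflict_edge[OF a(1)] conflict_edge[OF a(2)] by blast
      have "e = e'"
      proof (rule ccontr)
        assume "e \<noteq> e'"
        then have "ends ?H e \<inter> ends ?H e' = {}" using M e unfolding matching_def by blast
        then show False using e by auto
      qed
      then have "{x, y} = {x, y'}" using e by simp
      then show ?thesis by (metis doubleton_eq_iff)
    qed
  qed
  show ?thesis
  proof unfold_locales
    show "\<not> coloring (verts G) \<phi>" for \<phi>
    proof
      assume a: "coloring (verts G) \<phi>"
      have "HL_coloring G H L \<phi>"
        unfolding HL_coloring_def independent_set_def
      proof (intro conjI ballI notI)
        show "\<phi> v \<in> L v" if "v \<in> verts G" for v using a that unfolding coloring_def by blast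
        then show "\<phi> ` verts G \<subseteq> verts H" using part by blast
        fix e assume e: "e \<in> edges H" "ends H e \<subseteq> \<phi> ` verts G"
        have "card (ends H e) = 2" using mH e unfolding multigraph_def by blast
        then obtain x y where xy: "ends H e = {x, y}" "x \<noteq> y" by (meson card_2_iff)
        then obtain u v where uv: "u \<in> verts G" "v \<in> verts G" "x = \<phi> u" "y = \<phi> v" using e(2) by blast
        then have "conflict G H L u (\<phi> u) v (\<phi> v)"
          unfolding conflict_def using a xy e(1) unfolding coloring_def by blast
        then show False using a uv unfolding coloring_def by blast
      qed
      then show False using min unfolding minimal_triple_def by blast
    qed
    show "\<exists>\<phi>. coloring (verts G - {v}) \<phi>" if v: "v \<in> verts G" for v
    proof -
      obtain e where e: "e \<in> edges H" "ends H e \<inter> L v \<noteq> {}"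
        using meet v unfolding every_list_meets_edge_def by blast
      obtain \<phi> where \<phi>: "HL_coloring G (delete_edge H e) L \<phi>"
        using min e(1) unfolding minimal_triple_def by blast
      have L\<phi>: "\<phi> u \<in> L u" if "u \<in> verts G" for u using \<phi> that unfolding HL_coloring_def by blast
      have "\<not> conflict G H L u (\<phi> u) w (\<phi> w)" if uw: "u \<in> verts G - {v}" "w \<in> verts G - {v}" for u w
      proof
        assume "conflict G H L u (\<phi> u) w (\<phi> w)"
        then obtain f where f: "f \<in> edges H" "ends H f = {\<phi> u, \<phi> w}" unfolding conflict_def by blast
        have out: "\<phi> z \<notin> L v" if "z \<in> verts G - {v}" for z
          using disj L\<phi>[of z] that v unfolding disjoint_family_on_def by blast
        have "f \<noteq> e"
        proof
          assume "f = e"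
          then have "{\<phi> u, \<phi> w} \<inter> L v \<noteq> {}" using e(2) f(2) by simp
          then show False using out[OF uw(1)] out[OF uw(2)] by auto
        qed
        then have "f \<in> edges (delete_edge H e)" "ends (delete_edge H e) f \<subseteq> \<phi> ` verts G"
          using f uw unfolding delete_edge_def by auto
        then show False using \<phi> unfolding HL_coloring_def independent_set_def by blast
      qed
      then show ?thesis unfolding coloring_def using L\<phi> by blast
    qed
  qed
qed

lemma handshake:
  assumes "simple_graph G"
  shows "(\<Sum>v\<in>verts G. card {u \<in> verts G. adjacent G v u}) = 2 * card (edges G)"
proof -
  have mG: "multigraph G" and inj: "inj_on (ends G) (edges G)" using assms unfolding simple_graph_def by auto
  have fV: "finite (verts G)" and fE: "finite (edges G)"
    and ends: "\<And>e. e \<in> edges G \<Longrightarrow> ends G e \<subseteq> verts G \<and> card (ends G e) = 2"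
    using mG unfolding multigraph_def by auto
  have "card {u \<in> verts G. adjacent G v u} = card {e \<in> edges G. v \<in> ends G e}" for v
  proof -
    have "ends G ` {e \<in> edges G. v \<in> ends G e} = (\<lambda>u. {v, u}) ` {u \<in> verts G. adjacent G v u}"
    proof
      show "(\<lambda>u. {v, u}) ` {u \<in> verts G. adjacent G v u} \<subseteq> ends G ` {e \<in> edges G. v \<in> ends G e}"
        unfolding adjacent_def by force
      show "ends G ` {e \<in> edges G. v \<in> ends G e} \<subseteq> (\<lambda>u. {v, u}) ` {u \<in> verts G. adjacent G v u}"
      proof
        fix X assume "X \<in> ends G ` {e \<in> edges G. v \<in> ends G e}"
        then obtain e where e: "e \<in> edges G" "v \<in> ends G e" "X = ends G e" by blast
        then obtain x y where xy: "ends G e = {x, y}" "x \<noteq> y" using ends[OF e(1)] by (meson card_2_iff)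
        define u where "u = (if v = x then y else x)"
        have "ends G e = {v, u}" "v \<noteq> u" using xy e(2) unfolding u_def by auto
        moreover from this have "u \<in> verts G" using ends[OF e(1)] by auto
        ultimately show "X \<in> (\<lambda>u. {v, u}) ` {u \<in> verts G. adjacent G v u}"
          unfolding adjacent_def using e by blast
      qed
    qed
    moreover have "card (ends G ` {e \<in> edges G. v \<in> ends G e}) = card {e \<in> edges G. v \<in> ends G e}"
      by (rule card_image) (rule inj_on_subset[OF inj], blast)
    moreover have "card ((\<lambda>u. {v, u}) ` {u \<in> verts G. adjacent G v u}) = card {u \<in> verts G. adjacent G v u}"
      by (rule card_image) (auto simp: inj_on_def doubleton_eq_iff)
    ultimately show ?thesis by simp
  qed
  then have "(\<Sum>v\<in>verts G. card {u \<in> verts G. adjacent G v u})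
      = (\<Sum>v\<in>verts G. \<Sum>e\<in>edges G. if v \<in> ends G e then 1 else 0)"
    by (simp add: sum.If_cases fE Int_def)
  also have "\<dots> = (\<Sum>e\<in>edges G. \<Sum>v\<in>verts G. if v \<in> ends G e then 1 else 0)" by (rule sum.swap)
  also have "\<dots> = (\<Sum>e\<in>edges G. 2)"
  proof (rule sum.cong)
    fix e assume e: "e \<in> edges G"
    have "verts G \<inter> {v. v \<in> ends G e} = ends G e" using ends[OF e] by blast
    then show "(\<Sum>v\<in>verts G. if v \<in> ends G e then 1 else 0 :: nat) = 2"
      using ends[OF e] by (simp add: sum.If_cases fV)
  qed simp
  finally show ?thesis by simp
qed

lemma complete_subgraph_of_clique:
  assumes G: "simple_graph G" and S: "S \<subseteq> verts G" "card S = k"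
    and adj: "\<And>u v. u \<in> S \<Longrightarrow> v \<in> S \<Longrightarrow> u \<noteq> v \<Longrightarrow> adjacent G u v"
  shows "has_complete_subgraph k G"
proof -
  let ?F = "induced G S"
  have F: "verts ?F = S" "edges ?F = {e \<in> edges G. ends G e \<subseteq> S}" "ends ?F = ends G"
    unfolding induced_def using S by auto
  have mF: "multigraph ?F" unfolding multigraph_def F
    using G S(1) finite_subset unfolding simple_graph_def multigraph_def by auto
  have "subgraph ?F G" unfolding subgraph_def using mF S(1) F by auto
  moreover have "simple_graph ?F" unfolding simple_graph_def F
    using mF G unfolding simple_graph_def by (auto intro: inj_on_subset)
  moreover have "edges_between ?F u v \<noteq> {}" if uv: "u \<in> S" "v \<in> S" "u \<noteq> v" for u v
  proof -
    obtain e where "e \<in> edges G" "ends G e = {u, v}" using adj[OF uv] unfolding adjacent_def by blast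
    then have "e \<in> edges_between ?F u v" unfolding edges_between_def F using uv by simp
    then show ?thesis by blast
  qed
  ultimately have "subgraph ?F G" "complete_graph k ?F"
    unfolding complete_graph_def F using S(2) by auto
  then show ?thesis unfolding has_complete_subgraph_def by blast
qed

theorem theorem5p1:
  fixes G :: "('v, 'e) mgraph" and H :: "('w, 'f) mgraph" and L :: "'v \<Rightarrow> 'w set"
    and k lam n :: nat
  assumes "k \<ge> 4" and "lam \<in> {24, 28}" and "lam = 24 \<longrightarrow> k \<ge> 352"
    and "simple_graph G" and "card (verts G) = n"
    and "minimal_triple G H L"
    and "every_list_meets_edge G H L"
    and "\<forall>v\<in>verts G. card (L v) = k - 1"
  shows "real (card (edges G)) > (real k - 1 + 1 / real lam) * (real n / 2)
       \<or> has_complete_subgraph k G"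
proof (cases "has_complete_subgraph k G")
  case no: False
  define c where "c = k - 1"
  have k: "k = c + 1" "3 \<le> c" using assms(1) unfolding c_def by auto
  have size: "\<forall>v\<in>verts G. card (L v) = c" "0 < c" using assms(8) k(2) unfolding c_def by auto
  interpret critical_cover "adjacent G" "verts G" L "conflict G H L" c
    by (rule critical_cover_of_minimal_triple[OF assms(4,6,7) size])
  have noclique: "card S \<noteq> c + 1" if "S \<subseteq> verts G" "is_clique S" for S
  proof
    assume "card S = c + 1"
    then have "card S = k" using k(1) by simp
    then show False using complete_subgraph_of_clique[OF assms(4) that(1)] is_cliqueD[OF that(2)] no by metis
  qed
  have ne: "verts G \<noteq> {}" using not_colorable unfolding coloring_def by auto
  then have n0: "0 < n" using finV assms(5) by (auto simp: card_gt_0_iff)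
  have "lam * total_excess > n"
  proof (cases "c \<le> 23")
    case True
    then have "lam = 28" using assms(2,3) k by auto
    then show ?thesis using gallai_excess[OF k(2) True noclique ne] assms(5) by simp
  next
    case False
    then have le: "n \<le> 23 * total_excess" using large_excess[OF _ noclique] assms(5) by simp
    then have "n < 24 * total_excess" using n0 by simp
    also have "\<dots> \<le> lam * total_excess" using assms(2) by auto
    finally show ?thesis .
  qed
  then have "real n < real lam * real total_excess" by (metis of_nat_less_iff of_nat_mult)
  then have ex: "real n / real lam < real total_excess"
    using assms(2) by (auto simp: divide_less_eq mult.commute)
  have "2 * card (edges G) = (\<Sum>v\<in>verts G. deg (verts G) v)"
    using handshake[OF assms(4)] unfolding deg_def by simp
  also have "\<dots> = (\<Sum>v\<in>verts G. c + excess v)" by (rule sum.cong) (use deg_excess in auto)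
  also have "\<dots> = n * c + total_excess" unfolding total_excess_def using assms(5) by (simp add: sum.distrib)
  finally have "2 * real (card (edges G)) = real n * real c + real total_excess"
    by (metis of_nat_add of_nat_mult of_nat_numeral)
  moreover have "(real k - 1 + 1 / real lam) * (real n / 2) = (real n * real c + real n / real lam) / 2"
    unfolding k(1) by (simp add: field_simps)
  ultimately show ?thesis using ex by simp
qed simp

end
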